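(* Let $X$ be an infinite set of cardinality $\kappa$. (1) If $\kappa$ is regular, then the symmetric precomplete clones on $X$ which do not contain $\mathcal{O}^{(1)}$ are exactly the clones $\mathrm{Pol}(\mathcal{G})$ with $\mathcal{G}\in\{\mathcal{A},\mathcal{B},\mathcal{E},\mathcal{F}\}\cup\{\mathcal{G}_\lambda : 1\le\lambda\le\kappa,\ \lambda\text{ a cardinal}\}$. (2) If $X$ is countably infinite or $\kappa$ is weakly compact, then the symmetric precomplete clones on $X$ are exactly the clones $\mathrm{Pol}(\mathcal{G})$ with $\mathcal{G}$ in the same list, together with the precomplete clones on $X$ containing $\mathcal{O}^{(1)}$, of which there are exactly two.
   Context: For $n\ge 1$, $\mathcal{O}^{(n)}$ is the set of all $n$-ary operations $X^n\to X$, and $\mathcal{O}=\bigcup_{n\ge 1}\mathcal{O}^{(n)}$. A clone on $X$ is a subset of $\mathcal{O}$ which contains all projections $\pi^n_k(x_1,\ldots,x_n)=x_k$ ($1\le k\le n$) and is closed under composition. A clone is precomplete iff it is a dual atom of the lattice of clones on $X$ ordered by inclusion (whose greatest element is $\mathcal{O}$). Let $\mathcal{S}$ be the set of all permutations of $X$. A clone $\mathcal{C}$ is symmetric iff $\mathcal{C}=\{\gamma^{-1}(f(\gamma(x_1),\ldots,\gamma(x_n))) : f\in\mathcal{C},\ \gamma\in\mathcal{S}\}$. For a submonoid $\mathcal{G}\subseteq\mathcal{O}^{(1)}$, $\mathrm{Pol}(\mathcal{G})$ is the clone of all $f\in\mathcal{O}$ such that $f(g_1,\ldots,g_n)\in\mathcal{G}$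 whenever $g_1,\ldots,g_n\in\mathcal{G}$, where $n$ is the arity of $f$ (here $f(g_1,\ldots,g_n)$ is $x\mapsto f(g_1(x),\ldots,g_n(x))$). A subset $S\subseteq X$ is large iff $|S|=|X|$, and small otherwise; it is co-large (co-small) iff $X\setminus S$ is large (small). A property holds for almost all $x\in X$ iff there is a co-small set $S\subseteq X$ such that it holds for all $x\in S$. A function $f\in\mathcal{O}^{(1)}$ is almost surjective iff almost all $x\in X$ are in the range of $f$. Define $\mathcal{A}=\{f\in\mathcal{O}^{(1)} : f^{-1}[\{y\}]\text{ is small for almost all }y\in X\}$; $\mathcal{B}=\{f\in\mathcal{O}^{(1)} : f^{-1}[\{y\}]\text{ is small for all }y\in X\}$; $\mathcal{E}=\{f\in\mathcal{O}^{(1)} : f\text{ is almost surjective}\}$; $\mathcal{F}=\{f\in\mathcal{O}^{(1)} : f\text{ is almost surjective or constant}\}$; $\mathcal{G}_\lambda=\{f\in\mathcal{O}^{(1)} : \text{if }A\subseteq X\text{ has cardinality }\lambda\text{ then }|X\setminus f[X\setminus A]|\ge\lambda\}$. *)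

theory Defs
  imports "HOL-Library.FuncSet" "HOL-Library.Countable_Set" "HOL-Library.Ramsey"
begin

unbundle cardinal_syntax

text \<open>The base set \<open>X\<close> is the universe of a type \<open>'a\<close>, and \<open>X\<^sup>n\<close> is the set of lists of length \<open>n\<close>.
  An operation carries its arity; its function part is \<open>undefined\<close> off \<open>X\<^sup>n\<close>, so that equality of
  operations is equality of functions \<open>X\<^sup>n \<rightarrow> X\<close>.\<close>

type_synonym 'a operation = "nat \<times> ('a list \<Rightarrow> 'a)"

definition tuples :: "nat \<Rightarrow> 'a list set" where
  "tuples n = {xs. length xs = n}"

definition nary_ops :: "nat \<Rightarrow> 'a operation set" where
  "nary_ops n = {n} \<times> (tuples n \<rightarrow>\<^sub>E UNIV)"

definition all_ops :: "'a operation set" where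
  "all_ops = (\<Union>n\<in>{1..}. nary_ops n)"

text \<open>Coordinates are counted from \<open>0\<close>.\<close>

definition projection :: "nat \<Rightarrow> nat \<Rightarrow> 'a operation" where
  "projection n k = (n, \<lambda>xs\<in>tuples n. xs ! k)"

text \<open>\<open>compose_op m f gs\<close> is \<open>f(g\<^sub>1, \<dots>, g\<^sub>n)\<close> for \<open>m\<close>-ary \<open>g\<^sub>1, \<dots>, g\<^sub>n\<close>, where \<open>n\<close> is the arity
  of \<open>f\<close>.\<close>

definition compose_op :: "nat \<Rightarrow> 'a operation \<Rightarrow> 'a operation list \<Rightarrow> 'a operation" where
  "compose_op m f gs = (m, \<lambda>xs\<in>tuples m. snd f (map (\<lambda>g. snd g xs) gs))"

definition is_clone :: "'a operation set \<Rightarrow> bool" where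
  "is_clone C \<longleftrightarrow>
     C \<subseteq> all_ops \<and>
     (\<forall>n\<ge>1. \<forall>k<n. projection n k \<in> C) \<and>
     (\<forall>m\<ge>1. \<forall>f\<in>C. \<forall>gs. length gs = fst f \<and> set gs \<subseteq> C \<inter> nary_ops m
        \<longrightarrow> compose_op m f gs \<in> C)"

definition precomplete :: "'a operation set \<Rightarrow> bool" where
  "precomplete C \<longleftrightarrow>
     is_clone C \<and> C \<subset> all_ops \<and> \<not> (\<exists>D. is_clone D \<and> C \<subset> D \<and> D \<subset> all_ops)"

definition conjugate_op :: "('a \<Rightarrow> 'a) \<Rightarrow> 'a operation \<Rightarrow> 'a operation" where
  "conjugate_op \<gamma> f = (fst f, \<lambda>xs\<in>tuples (fst f). inv \<gamma> (snd f (map \<gamma> xs)))"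

definition symmetric_clone :: "'a operation set \<Rightarrow> bool" where
  "symmetric_clone C \<longleftrightarrow> is_clone C \<and> C = {conjugate_op \<gamma> f | f \<gamma>. f \<in> C \<and> bij \<gamma>}"

definition Pol :: "('a \<Rightarrow> 'a) set \<Rightarrow> 'a operation set" where
  "Pol G = {f \<in> all_ops. \<forall>gs. length gs = fst f \<and> set gs \<subseteq> G
              \<longrightarrow> (\<lambda>x. snd f (map (\<lambda>g. g x) gs)) \<in> G}"

definition large :: "'a set \<Rightarrow> bool" where
  "large S \<longleftrightarrow> |S| =o |UNIV :: 'a set|"

definition small :: "'a set \<Rightarrow> bool" where
  "small S \<longleftrightarrow> \<not> large S"

definition co_small :: "'a set \<Rightarrow> bool" where
  "co_small S \<longleftrightarrow> small (- S)"

definition almost_all :: "('a \<Rightarrow> bool) \<Rightarrow> bool" where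
  "almost_all P \<longleftrightarrow> (\<exists>S. co_small S \<and> (\<forall>x\<in>S. P x))"

definition almost_surjective :: "('a \<Rightarrow> 'a) \<Rightarrow> bool" where
  "almost_surjective f \<longleftrightarrow> almost_all (\<lambda>x. x \<in> range f)"

definition monoid_A :: "('a \<Rightarrow> 'a) set" where
  "monoid_A = {f. almost_all (\<lambda>y. small (f -` {y}))}"

definition monoid_B :: "('a \<Rightarrow> 'a) set" where
  "monoid_B = {f. \<forall>y. small (f -` {y})}"

definition monoid_E :: "('a \<Rightarrow> 'a) set" where
  "monoid_E = {f. almost_surjective f}"

definition monoid_F :: "('a \<Rightarrow> 'a) set" where
  "monoid_F = {f. almost_surjective f \<or> (\<exists>c. f = (\<lambda>x. c))}"

definition monoid_G :: "'a rel \<Rightarrow> ('a \<Rightarrow> 'a) set" where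
  "monoid_G r = {f. \<forall>A. |A| =o r \<longrightarrow> r \<le>o |- (f ` (- A))|}"

text \<open>Every cardinal up to \<open>|X|\<close> is represented by a cardinal order on a subset of \<open>X\<close>.\<close>

definition listed_monoids :: "('a \<Rightarrow> 'a) set set" where
  "listed_monoids = {monoid_A, monoid_B, monoid_E, monoid_F} \<union>
     {monoid_G r | r :: 'a rel.
        Card_order r \<and> cone \<le>o r \<and> r \<le>o |UNIV :: 'a set|}"

text \<open>\<open>\<kappa>\<close> is uncountable and \<open>\<kappa> \<rightarrow> (\<kappa>)\<^sup>2\<^sub>2\<close>.\<close>

definition weakly_compact :: "'a rel \<Rightarrow> bool" where
  "weakly_compact \<kappa> \<longleftrightarrow>
     Card_order \<kappa> \<and> natLeq <o \<kappa> \<and>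
     (\<forall>c :: 'a set \<Rightarrow> bool. \<exists>H\<subseteq>Field \<kappa>. |H| =o \<kappa> \<and> (\<exists>b. c ` nsets H 2 \<subseteq> {b}))"

end

theory Submission
  imports Defs
begin

text \<open>A unary operation outside one of the listed monoids \<open>G\<close> generates together with \<open>Pol G\<close> all
  unary operations, and \<open>Pol G\<close> also provides an injective binary operation; this gives precompleteness.

  Conversely let \<open>C\<close> be symmetric and precomplete without all unary operations. A set of unary maps
  that is closed under \<open>C\<close> and under left multiplication by some map outside \<open>C\<close> is closed under all
  operations; this forces \<open>C\<close> to contain every permutation. If \<open>C\<close> were contained in no \<open>Pol G\<close>, then,
  using one operation of \<open>C\<close> that fails to preserve \<open>G\<close> for each \<open>G\<close> in turn, \<open>C\<close> would contain all
  constants, all surjections with large fibres, hence extensions of all partial maps with large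
  complement of the domain, and all two-valued maps with large fibres. Finally an operation that is not
  almost unary (it exists since the almost unary operations form a proper clone above the
  unary ones) yields all maps with one large fibre and then all unary maps.

  If \<open>\<kappa> \<rightarrow> (\<kappa>)\<^sup>2\<^sub>2\<close>, then \<open>\<kappa>\<close> is regular and every binary operation is canonical on the increasing pairs
  of some large set: it depends on at most one variable or is injective there. A clone above the unary
  operations that contains a binary operation which is not almost unary and one which is injective on
  the increasing pairs of a large set is the clone of all operations. So there are
  two precomplete clones above the unary operations, obtained by excluding either kind of
  binary operation.\<close>

section \<open>Large and small sets\<close>

text \<open>The maps showing that \<open>C\<close> fails to preserve some \<open>G\<close> lie in
  \<open>G\<close>, not in \<open>C\<close>, so they cannot simply be substituted. The remedy is
  always to pass to a large set on which each coordinate is injective, constant or of a known fibre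
  pattern, and to replace it there by a member of \<open>C\<close>. Since \<open>C\<close> has all
  permutations, a map is in \<open>C\<close> as soon as some member has fibres of the same sizes.
  This fixes the order in which the monoids are used: the failure on \<open>monoid_B\<close> gives a
  map constant on a large set, which together with the failure on \<open>monoid_E\<close> gives the
  constants; these replace coordinates in the failure on \<open>monoid_A\<close>; the map found
  there starts the descent along the \<open>monoid_G r\<close>; and \<open>monoid_F\<close> needs
  both constants and surjections with large fibres. Regularity enters because a union of few small
  sets must be small; already the closure of \<open>monoid_A\<close> and \<open>monoid_B\<close>
  under composition rests on it.\<close>

lemma finite_card_ordLess: "finite A \<Longrightarrow> infinite B \<Longrightarrow> |A| <o |B|"
  by (rule finite_ordLess_infinite [OF card_of_Well_order card_of_Well_order])
    (simp_all add: Field_card_of)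

lemma large_iff_ordLeq: "large (S :: 'a set) \<longleftrightarrow> |UNIV :: 'a set| \<le>o |S|"
  unfolding large_def
  by (metis card_of_mono1 ordIso_iff_ordLeq subset_UNIV)

lemma small_iff_ordLess: "small (S :: 'a set) \<longleftrightarrow> |S| <o |UNIV :: 'a set|"
  unfolding small_def large_iff_ordLeq
  using not_ordLeq_iff_ordLess [OF card_of_Well_order card_of_Well_order] by blast

lemma large_mono: "large S \<Longrightarrow> S \<subseteq> T \<Longrightarrow> large T"
  unfolding large_iff_ordLeq using card_of_mono1 ordLeq_transitive by blast

lemma small_mono: "small T \<Longrightarrow> S \<subseteq> T \<Longrightarrow> small S"
  unfolding small_def using large_mono by blast

lemma large_UNIV [simp]: "large UNIV"
  unfolding large_def by (rule card_of_refl)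

lemma large_iff_inj: "large (S :: 'a set) \<longleftrightarrow> (\<exists>f :: 'a \<Rightarrow> 'a. inj f \<and> range f \<subseteq> S)"
  unfolding large_iff_ordLeq by (rule card_of_ordLeq [symmetric])

lemma large_bij:
  fixes S T :: "'a set"
  assumes "large S" "large T"
  obtains f where "bij_betw f S T"
proof -
  have "|S| =o |T|"
    using assms ordIso_symmetric ordIso_transitive unfolding large_def by blast
  then show thesis using that unfolding card_of_ordIso [symmetric] by blast
qed

lemma bij_betw_large:
  fixes S T :: "'a set"
  assumes "bij_betw f S T"
  shows "large S \<longleftrightarrow> large T"
proof -
  have "|S| =o |T|" using assms card_of_ordIso by blast
  then show ?thesis
    using ordIso_symmetric ordIso_transitive unfolding large_def by blast
qed

lemma large_image:
  fixes f :: "'a \<Rightarrow> 'a"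
  shows "inj_on f S \<Longrightarrow> large (f ` S) \<longleftrightarrow> large S"
  using bij_betw_large inj_on_imp_bij_betw by blast

lemma small_image:
  fixes f :: "'a \<Rightarrow> 'a"
  shows "small S \<Longrightarrow> small (f ` S)"
  unfolding small_iff_ordLess using card_of_image ordLeq_ordLess_trans by blast

lemma image_large_imp_large:
  fixes f :: "'a \<Rightarrow> 'a"
  shows "large (f ` S) \<Longrightarrow> large S"
  using small_image unfolding small_def by blast

lemma bij_extend:
  fixes f :: "'a \<Rightarrow> 'a"
  assumes "inj_on f A" "|- A| =o |- (f ` A)|"
  obtains p where "bij p" "\<And>x. x \<in> A \<Longrightarrow> p x = f x" "\<And>x. x \<notin> A \<Longrightarrow> p x \<notin> f ` A"
proof -
  obtain g where g: "bij_betw g (- A) (- (f ` A))"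
    using assms(2) unfolding card_of_ordIso [symmetric] by blast
  let ?p = "\<lambda>x. if x \<in> A then f x else g x"
  have "bij_betw ?p A (f ` A)"
    using assms(1) by (simp add: bij_betw_def inj_on_def)
  moreover have "bij_betw ?p (- A) (- (f ` A))"
    using g by (simp add: bij_betw_def inj_on_def)
  ultimately have "bij_betw ?p (A \<union> - A) (f ` A \<union> - (f ` A))"
    by (rule bij_betw_combine) auto
  then have "bij ?p" by simp
  moreover have "\<And>x. x \<notin> A \<Longrightarrow> ?p x \<notin> f ` A"
    using g unfolding bij_betw_def by auto
  ultimately show thesis using that [of ?p] by simp
qed

lemma bij_extend_large:
  fixes f :: "'a \<Rightarrow> 'a"
  assumes "inj_on f A" "large (- A)" "large (- (f ` A))"
  obtains p where "bij p" "\<And>x. x \<in> A \<Longrightarrow> p x = f x" "\<And>x. x \<notin> A \<Longrightarrow> p x \<notin> f ` A"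
proof -
  have "|- A| =o |- (f ` A)|"
    using assms(2,3) ordIso_symmetric ordIso_transitive unfolding large_def by blast
  then show thesis using bij_extend [OF assms(1)] that by blast
qed

text \<open>\<open>|UNIV|\<close> is itself a well-order of \<open>X\<close> of least possible type;
  this is its strict part. Proper initial segments are therefore small, and recursions of length
  \<kappa> run along \<open>X\<close>.\<close>

definition prec :: "'a \<Rightarrow> 'a \<Rightarrow> bool" where
  "prec x y \<longleftrightarrow> x \<noteq> y \<and> (x, y) \<in> |UNIV :: 'a set|"

lemma wf_prec: "wf {(x :: 'a, y). prec x y}"
proof -
  have "{(x :: 'a, y). prec x y} = |UNIV :: 'a set| - Id" by (auto simp: prec_def)
  then show ?thesis
    using card_of_well_order_on [of "UNIV :: 'a set"] unfolding well_order_on_def by metis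
qed

lemma prec_total: "(x :: 'a) \<noteq> y \<Longrightarrow> prec x y \<or> prec y x"
  using card_of_well_order_on [of "UNIV :: 'a set"]
  unfolding prec_def well_order_on_def linear_order_on_def total_on_def by auto

lemma prec_trans: "prec (x :: 'a) y \<Longrightarrow> prec y z \<Longrightarrow> prec x z"
  using card_of_well_order_on [of "UNIV :: 'a set"]
  unfolding prec_def well_order_on_def linear_order_on_def partial_order_on_def preorder_on_def
    trans_def antisym_def by metis

lemma prec_irrefl [simp]: "\<not> prec x x"
  by (simp add: prec_def)

lemma prec_asym: "prec x y \<Longrightarrow> \<not> prec y x"
  using prec_trans prec_irrefl by metis

lemma small_below: "small {y :: 'a. prec y x}"
proof -
  have "{y :: 'a. prec y x} = underS |UNIV :: 'a set| x" by (auto simp: prec_def underS_def)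
  then show ?thesis
    unfolding small_iff_ordLess
    using card_of_underS [OF card_of_Card_order, of x "UNIV :: 'a set"] by (simp add: Field_card_of)
qed

text \<open>The type argument only serves to name the base set inside the locale.\<close>

locale infinite_base =
  fixes base :: "'a itself"
  assumes infinite_base: "infinite (UNIV :: 'a set)"
begin

lemma small_Un: "small (A :: 'a set) \<Longrightarrow> small B \<Longrightarrow> small (A \<union> B)"
  unfolding small_iff_ordLess by (rule card_of_Un_ordLess_infinite [OF infinite_base])

lemma finite_small: "finite (A :: 'a set) \<Longrightarrow> small A"
  unfolding small_iff_ordLess using infinite_base by (rule finite_card_ordLess [rotated])

lemma large_infinite: "large (A :: 'a set) \<Longrightarrow> infinite A"
  using finite_small unfolding small_def by blast

lemma large_nonempty: "large (A :: 'a set) \<Longrightarrow> A \<noteq> {}"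
  using large_infinite by blast

lemma small_empty [simp]: "small ({} :: 'a set)"
  by (rule finite_small) simp

lemma large_Diff_small: "large (A :: 'a set) \<Longrightarrow> small B \<Longrightarrow> large (A - B)"
  using small_Un [of "A - B" B] small_mono [of "A - B \<union> B" A] unfolding small_def by blast

lemma large_Un_cases: "large (A \<union> B :: 'a set) \<Longrightarrow> large A \<or> large B"
  using small_Un unfolding small_def by blast

lemma large_obtain:
  assumes "large (A :: 'a set)" "small B"
  obtains x where "x \<in> A" "x \<notin> B"
  using large_nonempty [OF large_Diff_small [OF assms]] by blast

lemma small_finite_UN:
  "finite I \<Longrightarrow> (\<And>i. i \<in> I \<Longrightarrow> small (F i :: 'a set)) \<Longrightarrow> small (\<Union>i\<in>I. F i)"
  by (induction I rule: finite_induct) (auto intro: small_Un)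

lemma card_square: "|(UNIV :: 'a set) \<times> (UNIV :: 'a set)| =o |UNIV :: 'a set|"
  by (rule card_of_Times_same_infinite [OF infinite_base])

lemma pairing_exists:
  obtains pair :: "'a \<times> 'a \<Rightarrow> 'a" where "bij pair"
  using card_square that unfolding card_of_ordIso [symmetric] by auto

lemma small_image2:
  fixes f :: "'a \<Rightarrow> 'a \<Rightarrow> 'a"
  assumes "small A" "small B"
  shows "small {f a b | a b. a \<in> A \<and> b \<in> B}"
proof -
  have "|A \<times> B| <o |UNIV :: 'a set|"
  proof (cases "finite (A \<union> B)")
    case True
    then show ?thesis
      using infinite_base by (intro finite_card_ordLess) simp_all
  next
    case False
    have "|A \<times> B| \<le>o |(A \<union> B) \<times> (A \<union> B)|" by (rule card_of_mono1) auto
    also have "|(A \<union> B) \<times> (A \<union> B)| =o |A \<union> B|"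
      by (rule card_of_Times_same_infinite [OF False])
    finally have "|A \<times> B| \<le>o |A \<union> B|" .
    then show ?thesis
      using small_Un [OF assms] unfolding small_iff_ordLess by (rule ordLeq_ordLess_trans)
  qed
  then have "|(\<lambda>(a, b). f a b) ` (A \<times> B)| <o |UNIV :: 'a set|"
    by (rule ordLeq_ordLess_trans [OF card_of_image])
  moreover have "{f a b | a b. a \<in> A \<and> b \<in> B} = (\<lambda>(a, b). f a b) ` (A \<times> B)" by auto
  ultimately show ?thesis by (simp add: small_iff_ordLess)
qed

text \<open>\<open>D\<close> is a copy of \<open>X \<times> X\<close>: the first coordinate is sent
  onto \<open>Y\<close>, the second supplies \<kappa> many points in every fibre. Splittings, tags
  and surjections with large fibres all come from here.\<close>

lemma fibred_map:
  fixes D :: "'a set" and Y :: "'b set"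
  assumes "large D" "|Y| \<le>o |UNIV :: 'a set|" "Y \<noteq> {}"
  obtains s :: "'a \<Rightarrow> 'b" where "\<And>x. s x \<in> Y" "\<And>y. y \<in> Y \<Longrightarrow> large {x \<in> D. s x = y}"
proof -
  obtain pair :: "'a \<times> 'a \<Rightarrow> 'a" where pair: "bij pair" by (rule pairing_exists)
  obtain d :: "'a \<Rightarrow> 'a" where d: "bij_betw d UNIV D" by (rule large_bij [OF large_UNIV assms(1)])
  obtain e :: "'a \<Rightarrow> 'b" where e: "e ` UNIV = Y"
    using assms(2,3) card_of_ordLeq2 [of Y "UNIV :: 'a set"] by blast
  define s where "s x = e (fst (inv pair (inv d x)))" for x
  have inv_d: "inv d (d x) = x" for x using d by (simp add: bij_betw_def)
  have inv_pair: "inv pair (pair x) = x" for x using pair by (simp add: bij_is_inj)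
  have "large {x \<in> D. s x = y}" if "y \<in> Y" for y
  proof -
    have "y \<in> range e" using e that by simp
    then obtain a where a: "e a = y" by auto
    have "inj (\<lambda>b. d (pair (a, b)))"
      by (rule inj_on_inverseI [of _ "\<lambda>z. snd (inv pair (inv d z))"]) (simp add: inv_d inv_pair)
    moreover have "range (\<lambda>b. d (pair (a, b))) \<subseteq> {x \<in> D. s x = y}"
      using d by (auto simp: s_def inv_d inv_pair a bij_betw_def)
    ultimately show ?thesis unfolding large_iff_inj by blast
  qed
  moreover have "s x \<in> Y" for x using e by (auto simp: s_def)
  ultimately show thesis using that by blast
qed

lemma large_split:
  assumes "large (S :: 'a set)"
  obtains A B where "A \<union> B = S" "A \<inter> B = {}" "large A" "large B"
proof -
  have "|UNIV :: bool set| \<le>o |UNIV :: 'a set|"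
    using infinite_base by (intro ordLess_imp_ordLeq finite_card_ordLess) simp_all
  then obtain s :: "'a \<Rightarrow> bool" where s: "\<And>y. large {x \<in> S. s x = y}"
    using fibred_map [OF assms, of "UNIV :: bool set"] by auto
  have "{x \<in> S. s x = True} \<union> {x \<in> S. s x = False} = S" by auto
  moreover have "{x \<in> S. s x = True} \<inter> {x \<in> S. s x = False} = {}" by auto
  ultimately show thesis using s [of True] s [of False] by (rule that)
qed

text \<open>Each \<open>L\<close> in \<open>\<L>\<close> keeps a large part outside the subset \<open>T'\<close>, because \<open>T'\<close> can be
  replaced by one of its two halves.\<close>

lemma large_subset_avoiding:
  assumes "finite \<L>" "large (T :: 'a set)" "\<And>L. L \<in> \<L> \<Longrightarrow> large L"
  obtains T' where "T' \<subseteq> T" "large T'" "\<And>L. L \<in> \<L> \<Longrightarrow> large (L - T')"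
proof -
  have "\<exists>T'\<subseteq>T. large T' \<and> (\<forall>L\<in>\<L>. large (L - T'))"
    using assms(1,3)
  proof (induction \<L> rule: finite_induct)
    case empty
    then show ?case using assms(2) by blast
  next
    case (insert L \<L>)
    then obtain T' where T': "T' \<subseteq> T" "large T'" "\<forall>L\<in>\<L>. large (L - T')" by auto
    obtain U V where UV: "U \<union> V = T'" "U \<inter> V = {}" "large U" "large V"
      using large_split [OF T'(2)] by blast
    have "large ((L - U) \<union> (L - V))"
      by (rule large_mono [of L]) (use insert.prems UV(2) in auto)
    then have "large (L - U) \<or> large (L - V)" by (rule large_Un_cases)
    then obtain W where W: "W \<subseteq> T'" "large W" "large (L - W)"
    proof
      assume "large (L - U)"
      then show thesis using UV by (intro that [of U]) auto
    next
      assume "large (L - V)"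
      then show thesis using UV by (intro that [of V]) auto
    qed
    have "large (L' - W)" if "L' \<in> \<L>" for L'
      by (rule large_mono [of "L' - T'"]) (use T' W that in auto)
    with W have "large W \<and> (\<forall>L\<in>insert L \<L>. large (L - W))" by simp
    moreover have "W \<subseteq> T" using W(1) T'(1) by (rule subset_trans)
    ultimately show ?case by blast
  qed
  then show thesis using that by blast
qed

text \<open>Bijections between corresponding fibres are glued. A clone with all permutations thus
  contains, with a map, every map whose fibres have the same sizes.\<close>

lemma same_fibres_bij:
  fixes e e' :: "'a \<Rightarrow> 'a"
  assumes "\<And>y. |e -` {y}| =o |e' -` {y}|"
  obtains p where "bij p" "\<And>x. e (p x) = e' x"
proof -
  have "\<forall>y. \<exists>q. bij_betw q (e' -` {y}) (e -` {y})"
    using assms card_of_ordIso ordIso_symmetric by blast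
  then obtain q where q: "\<And>y. bij_betw (q y) (e' -` {y}) (e -` {y})" by metis
  define p where "p x = q (e' x) x" for x
  have p: "e (p x) = e' x" for x
    using q [of "e' x"] unfolding p_def bij_betw_def by auto
  have "inj p"
  proof (rule injI)
    fix x x' assume eq: "p x = p x'"
    then have "e' x = e' x'" using p by metis
    then show "x = x'" using eq q [of "e' x"] unfolding p_def bij_betw_def inj_on_def by auto
  qed
  moreover have "y \<in> range p" for y
  proof -
    have "y \<in> q (e y) ` (e' -` {e y})" using q [of "e y"] unfolding bij_betw_def by auto
    then obtain x where "e' x = e y" "y = q (e y) x" by auto
    then have "y = p x" by (simp add: p_def)
    then show ?thesis by blast
  qed
  ultimately have "bij p" by (auto simp: bij_def)
  then show thesis using that p by blast
qed


end

section \<open>Regular base sets: small unions and transfinite selection\<close>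

locale regular_base = infinite_base base for base :: "'a itself" +
  assumes stable_base: "stable |UNIV :: 'a set|"
begin

lemma small_UN:
  fixes F :: "'a \<Rightarrow> 'a set"
  shows "small S \<Longrightarrow> (\<And>i. i \<in> S \<Longrightarrow> small (F i)) \<Longrightarrow> small (\<Union>i\<in>S. F i)"
  using stable_UNION [OF stable_base] unfolding small_iff_ordLess by blast

lemma large_fibre:
  fixes f :: "'a \<Rightarrow> 'a"
  assumes "large A" "small (f ` A)"
  obtains y where "y \<in> f ` A" "large {x \<in> A. f x = y}"
proof (rule ccontr)
  assume no: "\<not> thesis"
  then have "\<And>y. y \<in> f ` A \<Longrightarrow> small {x \<in> A. f x = y}" using that unfolding small_def by blast
  then have "small (\<Union>y\<in>f ` A. {x \<in> A. f x = y})" by (rule small_UN [OF assms(2)])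
  moreover have "(\<Union>y\<in>f ` A. {x \<in> A. f x = y}) = A" by auto
  ultimately show False using assms(1) unfolding small_def by simp
qed

lemma small_bounded:
  assumes "small (S :: 'a set)"
  obtains b where "\<And>x. x \<in> S \<Longrightarrow> prec x b"
proof -
  have "small (insert x {y. prec y x})" for x :: 'a
    using small_Un [OF finite_small small_below, of "{x}" x] by simp
  then have "small (\<Union>x\<in>S. insert x {y. prec y x})" by (rule small_UN [OF assms])
  with large_UNIV obtain b where b: "b \<notin> (\<Union>x\<in>S. insert x {y. prec y x})"
    by (rule large_obtain)
  have "prec x b" if "x \<in> S" for x
  proof -
    have "x \<noteq> b" "\<not> prec b x" using b that by auto
    then show ?thesis using prec_total by metis
  qed
  then show thesis by (rule that)
qed

text \<open>Recursion along \<open>prec\<close>: at stage \<open>t\<close> fewer than \<kappa>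
  points have been chosen, each forbids a small part of \<open>W t\<close>, and by regularity
  something is left. Only the earlier choice is tested against the later one.\<close>

lemma selection:
  fixes W :: "'a \<Rightarrow> 'a set"
  assumes large: "\<And>t. large (W t)" and conf: "\<And>t x. small {y \<in> W t. conf x y}"
  obtains c where "\<And>t. c t \<in> W t" "\<And>s t. prec s t \<Longrightarrow> \<not> conf (c s) (c t)"
proof -
  have "\<exists>c. \<forall>t. c t \<in> W t \<and> (\<forall>s. prec s t \<longrightarrow> \<not> conf (c s) (c t))"
  proof (rule dependent_wf_choice [OF wf_prec])
    fix t and c :: "'a \<Rightarrow> 'a"
    have "small (\<Union>s\<in>{s. prec s t}. {y \<in> W t. conf (c s) y})"
      by (rule small_UN [OF small_below conf])
    from large [of t] this obtain r
      where "r \<in> W t" "r \<notin> (\<Union>s\<in>{s. prec s t}. {y \<in> W t. conf (c s) y})"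
      by (rule large_obtain)
    then show "\<exists>r. r \<in> W t \<and> (\<forall>s. prec s t \<longrightarrow> \<not> conf (c s) r)" by blast
  next
    fix c c' :: "'a \<Rightarrow> 'a" and t r
    assume "\<And>s. (s, t) \<in> {(x, y). prec x y} \<Longrightarrow> c s = c' s"
    then have "\<And>s. prec s t \<Longrightarrow> c s = c' s" by blast
    then show "(r \<in> W t \<and> (\<forall>s. prec s t \<longrightarrow> \<not> conf (c s) r))
      = (r \<in> W t \<and> (\<forall>s. prec s t \<longrightarrow> \<not> conf (c' s) r))"
      by metis
  qed
  then show thesis using that by metis
qed

end

section \<open>Operations and clones\<close>

text \<open>Normal form of operations: arguments can use plain functions on lists, the restriction
  making equality extensional on tuples.\<close>

definition op_of :: "nat \<Rightarrow> ('a list \<Rightarrow> 'a) \<Rightarrow> 'a operation" where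
  "op_of n F = (n, restrict F (tuples n))"

lemma fst_op_of [simp]: "fst (op_of n F) = n"
  by (simp add: op_of_def)

lemma snd_op_of: "length xs = n \<Longrightarrow> snd (op_of n F) xs = F xs"
  by (simp add: op_of_def tuples_def)

lemma op_of_cong: "(\<And>xs. length xs = n \<Longrightarrow> F xs = G xs) \<Longrightarrow> op_of n F = op_of n G"
  unfolding op_of_def by (auto simp: tuples_def)

lemma op_of_eqD: "op_of n F = op_of n G \<Longrightarrow> length xs = n \<Longrightarrow> F xs = G xs"
  by (metis snd_op_of)

lemma all_ops_cases:
  assumes "f \<in> all_ops"
  obtains n F where "n \<ge> 1" "f = op_of n F"
proof -
  from assms obtain n g where "n \<ge> 1" "f = (n, g)" "g \<in> tuples n \<rightarrow>\<^sub>E UNIV"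
    unfolding all_ops_def nary_ops_def by auto
  then have "f = op_of n g" by (simp add: op_of_def PiE_restrict)
  with \<open>n \<ge> 1\<close> show thesis by (rule that)
qed

lemma op_of_nary: "op_of n F \<in> nary_ops n"
  unfolding op_of_def nary_ops_def by auto

lemma op_of_all_ops: "n \<ge> 1 \<Longrightarrow> op_of n F \<in> all_ops"
  unfolding all_ops_def using op_of_nary by auto

lemma nary_ops_cases: "f \<in> nary_ops n \<Longrightarrow> \<exists>F. f = op_of n F"
  unfolding nary_ops_def by (auto simp: op_of_def PiE_restrict intro: exI [of _ "snd f"])

lemma projection_op_of: "projection n k = op_of n (\<lambda>xs. xs ! k)"
  by (simp add: projection_def op_of_def)

lemma compose_op_of:
  assumes "length gs = n"
  shows "compose_op m (op_of n F) gs = op_of m (\<lambda>xs. F (map (\<lambda>g. snd g xs) gs))"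
  using assms by (auto simp: compose_op_def op_of_def tuples_def)

lemma is_cloneI:
  assumes "C \<subseteq> all_ops"
    and "\<And>n k. k < n \<Longrightarrow> op_of n (\<lambda>xs. xs ! k) \<in> C"
    and "\<And>n m F Gs. op_of n F \<in> C \<Longrightarrow> n \<ge> 1 \<Longrightarrow> m \<ge> 1 \<Longrightarrow> length Gs = n
      \<Longrightarrow> (\<And>G. G \<in> set Gs \<Longrightarrow> op_of m G \<in> C) \<Longrightarrow> op_of m (\<lambda>xs. F (map (\<lambda>G. G xs) Gs)) \<in> C"
  shows "is_clone C"
  unfolding is_clone_def
proof (intro conjI allI impI ballI)
  show "C \<subseteq> all_ops" by (rule assms(1))
  fix n k :: nat
  assume "k < n"
  then show "projection n k \<in> C" unfolding projection_op_of by (rule assms(2))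
next
  fix m :: nat and f :: "'a operation" and gs :: "'a operation list"
  assume m: "1 \<le> m" and f: "f \<in> C" and gs: "length gs = fst f \<and> set gs \<subseteq> C \<inter> nary_ops m"
  have "f \<in> all_ops" using f assms(1) by blast
  then obtain n F where nF: "n \<ge> 1" "f = op_of n F" by (rule all_ops_cases)
  have eq: "op_of m (snd g) = g" if "g \<in> set gs" for g
  proof -
    have "g \<in> nary_ops m" using gs that by blast
    then obtain G where "g = op_of m G" using nary_ops_cases by blast
    then show ?thesis by (simp add: op_of_def)
  qed
  have "op_of m (\<lambda>xs. F (map (\<lambda>G. G xs) (map snd gs))) \<in> C"
  proof (rule assms(3))
    show "op_of n F \<in> C" using f nF by simp
    show "length (map snd gs) = n" using gs nF by simp
    fix G assume "G \<in> set (map snd gs)"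
    then obtain g where "g \<in> set gs" "G = snd g" by auto
    then show "op_of m G \<in> C" using eq gs by auto
  qed (use nF m in auto)
  moreover have "compose_op m f gs = op_of m (\<lambda>xs. F (map (\<lambda>G. G xs) (map snd gs)))"
    using gs nF by (simp add: compose_op_of comp_def)
  ultimately show "compose_op m f gs \<in> C" by simp
qed

lemma clone_proj: "is_clone C \<Longrightarrow> k < n \<Longrightarrow> op_of n (\<lambda>xs. xs ! k) \<in> C"
  unfolding is_clone_def projection_op_of by simp

lemma clone_comp:
  assumes "is_clone C" "op_of n F \<in> C" "m \<ge> 1" "length Gs = n"
    and Gs: "\<And>G. G \<in> set Gs \<Longrightarrow> op_of m G \<in> C"
  shows "op_of m (\<lambda>xs. F (map (\<lambda>G. G xs) Gs)) \<in> C"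
proof -
  let ?gs = "map (op_of m) Gs"
  have "set ?gs \<subseteq> C \<inter> nary_ops m" using Gs op_of_nary by auto
  moreover have "length ?gs = fst (op_of n F)" using assms(4) by simp
  ultimately have "compose_op m (op_of n F) ?gs \<in> C"
    using assms(1-3) unfolding is_clone_def by blast
  moreover have "compose_op m (op_of n F) ?gs = op_of m (\<lambda>xs. F (map (\<lambda>G. G xs) Gs))"
    using assms(4) by (simp add: compose_op_of comp_def, intro op_of_cong)
      (simp add: snd_op_of cong: map_cong)
  ultimately show ?thesis by simp
qed

lemma clone_sub: "is_clone C \<Longrightarrow> C \<subseteq> all_ops"
  by (simp add: is_clone_def)

section \<open>Unary and binary members of a clone\<close>

definition unary_part :: "'a operation set \<Rightarrow> ('a \<Rightarrow> 'a) set" where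
  "unary_part C = {g. op_of 1 (\<lambda>xs. g (hd xs)) \<in> C}"

definition binary_part :: "'a operation set \<Rightarrow> ('a \<Rightarrow> 'a \<Rightarrow> 'a) set" where
  "binary_part C = {b. op_of 2 (\<lambda>xs. b (xs ! 0) (xs ! 1)) \<in> C}"

lemma unary_part_comp:
  assumes "is_clone C" "op_of n F \<in> C" "length gs = n" "set gs \<subseteq> unary_part C"
  shows "(\<lambda>x. F (map (\<lambda>g. g x) gs)) \<in> unary_part C"
proof -
  have "op_of 1 (\<lambda>xs. F (map (\<lambda>G. G xs) (map (\<lambda>g xs. g (hd xs)) gs))) \<in> C"
    by (rule clone_comp [OF assms(1,2)]) (use assms(3,4) in \<open>auto simp: unary_part_def\<close>)
  then show ?thesis by (simp add: unary_part_def comp_def)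
qed

lemma binary_part_comp:
  assumes "is_clone C" "op_of n F \<in> C" "length bs = n" "set bs \<subseteq> binary_part C"
  shows "(\<lambda>x y. F (map (\<lambda>b. b x y) bs)) \<in> binary_part C"
proof -
  have "op_of 2 (\<lambda>xs. F (map (\<lambda>G. G xs) (map (\<lambda>b xs. b (xs ! 0) (xs ! 1)) bs))) \<in> C"
    by (rule clone_comp [OF assms(1,2)]) (use assms(3,4) in \<open>auto simp: binary_part_def\<close>)
  then show ?thesis by (simp add: binary_part_def comp_def)
qed

lemma id_unary_part: "is_clone C \<Longrightarrow> (\<lambda>x. x) \<in> unary_part C"
proof -
  assume "is_clone C"
  then have "op_of 1 (\<lambda>xs. xs ! 0) \<in> C" by (rule clone_proj) simp
  moreover have "op_of 1 (\<lambda>xs. xs ! 0) = op_of 1 (\<lambda>xs. hd xs :: 'a)"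
    by (rule op_of_cong) (auto simp: length_Suc_conv)
  ultimately show ?thesis by (simp add: unary_part_def)
qed

lemma fst_binary_part: "is_clone C \<Longrightarrow> (\<lambda>x y. x) \<in> binary_part C"
  using clone_proj [of C 0 2] by (simp add: binary_part_def)

lemma snd_binary_part: "is_clone C \<Longrightarrow> (\<lambda>x y. y) \<in> binary_part C"
  using clone_proj [of C 1 2] by (simp add: binary_part_def)

lemma unary_unary:
  assumes "is_clone C" "g \<in> unary_part C" "h \<in> unary_part C"
  shows "(\<lambda>x. g (h x)) \<in> unary_part C"
  using unary_part_comp [OF assms(1), of 1 "\<lambda>xs. g (hd xs)" "[h]"] assms(2,3)
  by (simp add: unary_part_def)

lemma binary_unary:
  assumes "is_clone C" "b \<in> binary_part C" "g \<in> unary_part C" "h \<in> unary_part C"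
  shows "(\<lambda>x. b (g x) (h x)) \<in> unary_part C"
  using unary_part_comp [OF assms(1), of 2 "\<lambda>xs. b (xs ! 0) (xs ! 1)" "[g, h]"] assms(2-)
  by (simp add: binary_part_def)

lemma unary_binary:
  assumes "is_clone C" "g \<in> unary_part C" "b \<in> binary_part C"
  shows "(\<lambda>x y. g (b x y)) \<in> binary_part C"
  using binary_part_comp [OF assms(1), of 1 "\<lambda>xs. g (hd xs)" "[b]"] assms(2,3)
  by (simp add: unary_part_def)

lemma binary_binary:
  assumes "is_clone C" "b \<in> binary_part C" "p \<in> binary_part C" "q \<in> binary_part C"
  shows "(\<lambda>x y. b (p x y) (q x y)) \<in> binary_part C"
  using binary_part_comp [OF assms(1), of 2 "\<lambda>xs. b (xs ! 0) (xs ! 1)" "[p, q]"] assms(2-)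
  by (simp add: binary_part_def)

lemma unary_fst: "is_clone C \<Longrightarrow> g \<in> unary_part C \<Longrightarrow> (\<lambda>x y. g x) \<in> binary_part C"
  by (rule unary_binary [OF _ _ fst_binary_part])

lemma unary_snd: "is_clone C \<Longrightarrow> g \<in> unary_part C \<Longrightarrow> (\<lambda>x y. g y) \<in> binary_part C"
  by (rule unary_binary [OF _ _ snd_binary_part])

lemma binary_unary_args:
  assumes "is_clone C" "b \<in> binary_part C" "g \<in> unary_part C" "h \<in> unary_part C"
  shows "(\<lambda>x y. b (g x) (h y)) \<in> binary_part C"
  by (rule binary_binary [OF assms(1,2) unary_fst [OF assms(1,3)] unary_snd [OF assms(1,4)]])

lemma nary_ops_1_subset_iff: "nary_ops 1 \<subseteq> C \<longleftrightarrow> unary_part C = UNIV"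
proof
  assume "nary_ops 1 \<subseteq> C"
  then show "unary_part C = UNIV" using op_of_nary unfolding unary_part_def by blast
next
  assume eq: "unary_part C = UNIV"
  show "nary_ops 1 \<subseteq> C"
  proof
    fix f :: "'a operation"
    assume "f \<in> nary_ops 1"
    then obtain F where F: "f = op_of 1 F" using nary_ops_cases by blast
    have "op_of 1 F = op_of 1 (\<lambda>xs. F [hd xs])"
      by (rule op_of_cong) (metis One_nat_def length_0_conv length_Suc_conv list.sel(1))
    moreover have "(\<lambda>x. F [x]) \<in> unary_part C" using eq by simp
    ultimately show "f \<in> C" using F by (simp add: unary_part_def)
  qed
qed

text \<open>Iterating an injective binary operation gives injective operations of every arity; every
  operation is then a unary one applied to such an operation.\<close>

lemma clone_full:
  fixes u :: "'a \<Rightarrow> 'a"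
  assumes C: "is_clone C" and un: "unary_part C = UNIV"
    and b: "b \<in> binary_part C" and u: "\<And>x y x' y'. b (u x) (u y) = b (u x') (u y') \<Longrightarrow> x = x' \<and> y = y'"
  shows "C = all_ops"
proof
  \<comment> \<open>\<open>b\<close> is injective only on the square of the range of
    \<open>u\<close>; composing with \<open>u\<close>, which belongs to the clone like every unary
    map, makes this global.\<close>
  define b' where "b' x y = b (u x) (u y)" for x y
  have "u \<in> unary_part C" using un by simp
  then have b': "b' \<in> binary_part C" unfolding b'_def using binary_unary_args C b by blast
  \<comment> \<open>The arity stays fixed while \<open>J\<close> separates more and more entries; at
    \<open>k = 0\<close> any projection serves.\<close>
  have inj: "\<exists>J. op_of n J \<in> C \<and> (\<forall>xs ys. length xs = n \<longrightarrow> length ys = n \<longrightarrow> J xs = J ys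
      \<longrightarrow> take k xs = take k ys)" if "k \<le> n" "n \<ge> 1" for n k
    using that
  proof (induction k)
    case 0
    have "op_of n (\<lambda>xs. xs ! 0) \<in> C" by (rule clone_proj [OF C]) (use 0 in simp)
    then show ?case by (intro exI [of _ "\<lambda>xs. xs ! 0"]) simp
  next
    case (Suc k)
    then obtain J where J: "op_of n J \<in> C" "\<And>xs ys. length xs = n \<Longrightarrow> length ys = n \<Longrightarrow> J xs = J ys
      \<Longrightarrow> take k xs = take k ys" by (meson Suc_leD)
    have "op_of n (\<lambda>xs. b' (map (\<lambda>G. G xs) [J, \<lambda>xs. xs ! k] ! 0) (map (\<lambda>G. G xs) [J, \<lambda>xs. xs ! k] ! 1)) \<in> C"
      by (rule clone_comp [OF C, of 2])
        (use b' J(1) clone_proj [OF C, of k n] Suc.prems in \<open>auto simp: binary_part_def\<close>)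
    then have "op_of n (\<lambda>xs. b' (J xs) (xs ! k)) \<in> C" by simp
    moreover have "take (Suc k) xs = take (Suc k) ys"
      if "length xs = n" "length ys = n" "b' (J xs) (xs ! k) = b' (J ys) (ys ! k)" for xs ys
    proof -
      have eq: "J xs = J ys \<and> xs ! k = ys ! k" by (rule u [OF that(3) [unfolded b'_def]])
      have "take k xs = take k ys" by (rule J(2) [OF that(1,2) conjunct1 [OF eq]])
      moreover note conjunct2 [OF eq]
      moreover have "take (Suc k) xs = take k xs @ [xs ! k]" "take (Suc k) ys = take k ys @ [ys ! k]"
        using that(1,2) Suc.prems(1) by (intro take_Suc_conv_app_nth, linarith)+
      ultimately show ?thesis by simp
    qed
    ultimately show ?case by (intro exI [of _ "\<lambda>xs. b' (J xs) (xs ! k)"] conjI allI impI)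
  qed
  show "all_ops \<subseteq> C"
  proof
    fix f :: "'a operation"
    assume "f \<in> all_ops"
    then obtain n F where nF: "n \<ge> 1" "f = op_of n F" by (rule all_ops_cases)
    then obtain J where J: "op_of n J \<in> C" "\<And>xs ys. length xs = n \<Longrightarrow> length ys = n \<Longrightarrow> J xs = J ys
      \<Longrightarrow> take n xs = take n ys" using inj [of n n] by blast
    have "inj_on J (tuples n)" by (rule inj_onI) (use J(2) in \<open>auto simp: tuples_def\<close>)
    define g where "g = (\<lambda>y. F (inv_into (tuples n) J y))"
    have "op_of n (\<lambda>xs. g (hd (map (\<lambda>G. G xs) [J]))) \<in> C"
    proof (rule clone_comp [OF C, of 1 "\<lambda>xs. g (hd xs)"])
      have "g \<in> unary_part C" using un by simp
      then show "op_of 1 (\<lambda>xs. g (hd xs)) \<in> C" by (simp add: unary_part_def)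
    qed (use J nF in auto)
    then have "op_of n (\<lambda>xs. g (J xs)) \<in> C" by simp
    moreover have "inv_into (tuples n) J (J xs) = xs" if "length xs = n" for xs
      by (rule inv_into_f_f [OF \<open>inj_on J (tuples n)\<close>]) (simp add: tuples_def that)
    then have "op_of n (\<lambda>xs. g (J xs)) = op_of n F"
      by (intro op_of_cong) (simp add: g_def)
    ultimately show "f \<in> C" using nF by simp
  qed
qed (rule clone_sub [OF C])

section \<open>Maximality, preserved sets of unary maps, and \<open>Pol\<close>\<close>

lemma precompleteD: "precomplete C \<Longrightarrow> is_clone D \<Longrightarrow> C \<subseteq> D \<Longrightarrow> D = C \<or> D = all_ops"
  unfolding precomplete_def using clone_sub by blast

lemma precomplete_clone: "precomplete C \<Longrightarrow> is_clone C"
  by (simp add: precomplete_def)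

lemma precompleteI:
  assumes "is_clone C" "C \<noteq> all_ops" "\<And>D. is_clone D \<Longrightarrow> C \<subseteq> D \<Longrightarrow> D \<noteq> C \<Longrightarrow> D = all_ops"
  shows "precomplete C"
  unfolding precomplete_def using assms clone_sub by blast

text \<open>With \<open>T\<close> read as a relation of arity \<open>X\<close>, this says that
  \<open>C\<close> preserves \<open>T\<close>; for a clone it means
  \<open>C \<subseteq> Pol T\<close>. \<open>T\<close> is an arbitrary set of maps, not a
  monoid.\<close>

definition closed_under :: "'a operation set \<Rightarrow> ('a \<Rightarrow> 'a) set \<Rightarrow> bool" where
  "closed_under C T \<longleftrightarrow> (\<forall>n F gs. op_of n F \<in> C \<longrightarrow> length gs = n \<longrightarrow> set gs \<subseteq> T
     \<longrightarrow> (\<lambda>x. F (map (\<lambda>g. g x) gs)) \<in> T)"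

lemma closed_underI:
  assumes "\<And>n F gs. op_of n F \<in> C \<Longrightarrow> length gs = n \<Longrightarrow> set gs \<subseteq> T
     \<Longrightarrow> (\<lambda>x. F (map (\<lambda>g. g x) gs)) \<in> T"
  shows "closed_under C T"
  unfolding closed_under_def using assms by blast

lemma closed_underD:
  "closed_under C T \<Longrightarrow> op_of n F \<in> C \<Longrightarrow> length gs = n \<Longrightarrow> set gs \<subseteq> T
     \<Longrightarrow> (\<lambda>x. F (map (\<lambda>g. g x) gs)) \<in> T"
  unfolding closed_under_def by blast

lemma op_of_Pol_iff:
  assumes "n \<ge> 1"
  shows "op_of n F \<in> Pol T \<longleftrightarrow>
    (\<forall>gs. length gs = n \<longrightarrow> set gs \<subseteq> T \<longrightarrow> (\<lambda>x. F (map (\<lambda>g. g x) gs)) \<in> T)"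
proof -
  have eq: "(\<lambda>x. snd (op_of n F) (map (\<lambda>g. g x) gs)) = (\<lambda>x. F (map (\<lambda>g. g x) gs))"
    if "length gs = n" for gs
    using that by (simp add: snd_op_of)
  have "(length gs = n \<and> set gs \<subseteq> T \<longrightarrow> (\<lambda>x. snd (op_of n F) (map (\<lambda>g. g x) gs)) \<in> T)
    \<longleftrightarrow> (length gs = n \<longrightarrow> set gs \<subseteq> T \<longrightarrow> (\<lambda>x. F (map (\<lambda>g. g x) gs)) \<in> T)" for gs
  proof (cases "length gs = n")
    case True
    show ?thesis by (simp only: eq [OF True] imp_conjL)
  qed simp
  then show ?thesis using op_of_all_ops [OF assms, of F] by (simp add: Pol_def)
qed

lemma Pol_sub: "Pol T \<subseteq> all_ops"
  by (auto simp: Pol_def)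

lemma closed_under_Pol: "closed_under (Pol T) T"
proof (rule closed_underI)
  fix n F and gs :: "('a \<Rightarrow> 'a) list"
  assume F: "op_of n F \<in> Pol T" and gs: "length gs = n" "set gs \<subseteq> T"
  have "op_of n F \<in> all_ops" using F Pol_sub by blast
  then have "n \<ge> 1" unfolding all_ops_def nary_ops_def op_of_def by auto
  then show "(\<lambda>x. F (map (\<lambda>g. g x) gs)) \<in> T" using F gs op_of_Pol_iff by blast
qed

lemma subset_PolI:
  assumes "is_clone C" "closed_under C T"
  shows "C \<subseteq> Pol T"
proof
  fix f :: "'a operation"
  assume f: "f \<in> C"
  then have "f \<in> all_ops" using clone_sub assms(1) by blast
  then obtain n F where "n \<ge> 1" "f = op_of n F" by (rule all_ops_cases)
  then show "f \<in> Pol T" using f op_of_Pol_iff closed_underD [OF assms(2)] by blast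
qed

lemma is_clone_Pol: "is_clone (Pol T)"
proof (rule is_cloneI [OF Pol_sub])
  fix n k :: nat
  assume k: "k < n"
  then have "n \<ge> 1" by simp
  moreover have "(\<lambda>x. map (\<lambda>g. g x) gs ! k) \<in> T" if "length gs = n" "set gs \<subseteq> T" for gs :: "('a \<Rightarrow> 'a) list"
  proof -
    have "gs ! k \<in> T" using k that by (auto simp: set_conv_nth)
    moreover have "(\<lambda>x. map (\<lambda>g. g x) gs ! k) = gs ! k" using k that by auto
    ultimately show ?thesis by simp
  qed
  ultimately show "op_of n (\<lambda>xs. xs ! k) \<in> Pol T" using op_of_Pol_iff by blast
next
  fix n m F and Gs :: "('a list \<Rightarrow> 'a) list"
  assume F: "op_of n F \<in> Pol T" and m: "m \<ge> 1" and len: "length Gs = n"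
    and Gs: "\<And>G. G \<in> set Gs \<Longrightarrow> op_of m G \<in> Pol T"
  have "(\<lambda>x. F (map (\<lambda>G. G (map (\<lambda>g. g x) gs)) Gs)) \<in> T"
    if gs: "length gs = m" "set gs \<subseteq> T" for gs :: "('a \<Rightarrow> 'a) list"
  proof -
    let ?hs = "map (\<lambda>G x. G (map (\<lambda>g. g x) gs)) Gs"
    have "set ?hs \<subseteq> T" using Gs closed_underD [OF closed_under_Pol _ gs] by auto
    then have "(\<lambda>x. F (map (\<lambda>h. h x) ?hs)) \<in> T"
      by (intro closed_underD [OF closed_under_Pol F]) (simp_all add: len)
    then show ?thesis by (simp add: comp_def)
  qed
  then show "op_of m (\<lambda>xs. F (map (\<lambda>G. G xs) Gs)) \<in> Pol T" using op_of_Pol_iff [OF m] by blast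
qed

lemma unary_part_Pol_iff: "h \<in> unary_part (Pol T) \<longleftrightarrow> (\<forall>t\<in>T. (\<lambda>x. h (t x)) \<in> T)"
proof -
  have "(\<forall>gs. length gs = 1 \<longrightarrow> set gs \<subseteq> T \<longrightarrow> (\<lambda>x. h (hd (map (\<lambda>g. g x) gs))) \<in> T)
    \<longleftrightarrow> (\<forall>t\<in>T. (\<lambda>x. h (t x)) \<in> T)" (is "?L \<longleftrightarrow> ?R")
  proof
    assume L: ?L
    show ?R using L [THEN spec, of "[t]" for t] by simp
  next
    assume R: ?R
    then show ?L by (auto simp: length_Suc_conv)
  qed
  then show ?thesis by (simp add: unary_part_def op_of_Pol_iff)
qed

lemma binary_part_Pol_iff:
  "b \<in> binary_part (Pol T) \<longleftrightarrow> (\<forall>s\<in>T. \<forall>t\<in>T. (\<lambda>x. b (s x) (t x)) \<in> T)"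
proof -
  have "(\<forall>gs. length gs = 2 \<longrightarrow> set gs \<subseteq> T \<longrightarrow> (\<lambda>x. b (map (\<lambda>g. g x) gs ! 0) (map (\<lambda>g. g x) gs ! 1)) \<in> T)
    \<longleftrightarrow> (\<forall>s\<in>T. \<forall>t\<in>T. (\<lambda>x. b (s x) (t x)) \<in> T)" (is "?L \<longleftrightarrow> ?R")
  proof
    assume L: ?L
    show ?R using L [THEN spec, of "[s, t]" for s t] by simp
  next
    assume R: ?R
    then show ?L by (auto simp: length_Suc_conv numeral_2_eq_2)
  qed
  then show ?thesis by (simp add: binary_part_def op_of_Pol_iff)
qed

lemma closed_under_unary_part: "is_clone C \<Longrightarrow> closed_under C (unary_part C)"
  by (rule closed_underI) (rule unary_part_comp)

lemma Pol_eq_precomplete: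
  assumes "precomplete C" "closed_under C T"
  shows "Pol T = C \<or> Pol T = all_ops"
  using precompleteD [OF assms(1) is_clone_Pol]
    subset_PolI [OF precomplete_clone [OF assms(1)] assms(2)] by blast

text \<open>\<open>p\<close> and \<open>q\<close> together name each point by a pair, so any
  \<open>g\<close> is some binary operation applied to \<open>p\<close> and
  \<open>q\<close>.\<close>

lemma Pol_all_ops_full:
  assumes "Pol T = all_ops" "p \<in> T" "q \<in> T" "\<And>x y. p x = p y \<Longrightarrow> q x = q y \<Longrightarrow> x = y"
  shows "T = UNIV"
proof -
  have "g \<in> T" for g
  proof -
    define b where "b u v = g (SOME x. p x = u \<and> q x = v)" for u v
    have bg: "b (p x) (q x) = g x" for x
    proof -
      have "p (SOME z. p z = p x \<and> q z = q x) = p x \<and> q (SOME z. p z = p x \<and> q z = q x) = q x"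
        by (rule someI [of _ x]) simp
      then have "(SOME z. p z = p x \<and> q z = q x) = x" using assms(4) by blast
      then show ?thesis by (simp add: b_def)
    qed
    moreover have "b \<in> binary_part (Pol T)"
      unfolding binary_part_def assms(1) by (simp add: op_of_all_ops)
    ultimately have "(\<lambda>x. b (p x) (q x)) \<in> T"
      using assms(2,3) unfolding binary_part_Pol_iff by blast
    with bg show ?thesis by simp
  qed
  then show ?thesis by blast
qed

text \<open>\<open>Pol T\<close> is a clone above \<open>C\<close> that also contains
  \<open>h\<close>, so by maximality it is everything; the separating pair \<open>p\<close>,
  \<open>q\<close> then puts all maps into \<open>T\<close>.\<close>

lemma precomplete_closed_full:
  assumes "precomplete C" "closed_under C T" "h \<notin> unary_part C" "\<And>t. t \<in> T \<Longrightarrow> (\<lambda>x. h (t x)) \<in> T"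
    and "p \<in> T" "q \<in> T" "\<And>x y. p x = p y \<Longrightarrow> q x = q y \<Longrightarrow> x = y"
  shows "T = UNIV"
proof -
  have "h \<in> unary_part (Pol T)" using assms(4) by (simp add: unary_part_Pol_iff)
  then have "Pol T \<noteq> C" using assms(3) by blast
  then have "Pol T = all_ops" using Pol_eq_precomplete [OF assms(1,2)] by blast
  then show ?thesis using assms(5-7) by (rule Pol_all_ops_full)
qed

section \<open>Conjugation by permutations\<close>

lemma conjugate_op_of:
  fixes \<gamma> :: "'a \<Rightarrow> 'a"
  shows "conjugate_op \<gamma> (op_of n F) = op_of n (\<lambda>xs. inv \<gamma> (F (map \<gamma> xs)))"
  unfolding conjugate_op_def op_of_def by (auto simp: tuples_def)

lemma symmetric_conj:
  assumes "symmetric_clone C" "op_of n F \<in> C" "bij \<gamma>"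
  shows "op_of n (\<lambda>xs. inv \<gamma> (F (map \<gamma> xs))) \<in> C"
proof -
  have "conjugate_op \<gamma> (op_of n F) \<in> C"
    using assms unfolding symmetric_clone_def by blast
  then show ?thesis by (simp add: conjugate_op_of)
qed

lemma conjugate_op_id: "f \<in> all_ops \<Longrightarrow> conjugate_op (\<lambda>x. x) f = f"
proof -
  assume "f \<in> all_ops"
  then obtain n F where "f = op_of n F" by (rule all_ops_cases)
  moreover have "inv (\<lambda>x. x) = (\<lambda>x :: 'a. x)" by (rule inv_equality) auto
  ultimately show ?thesis by (simp add: conjugate_op_of)
qed

lemma symmetric_cloneI:
  fixes C :: "'a operation set"
  assumes C: "is_clone C"
    and "\<And>n F \<gamma>. n \<ge> 1 \<Longrightarrow> op_of n F \<in> C \<Longrightarrow> bij \<gamma> \<Longrightarrow> op_of n (\<lambda>xs. inv \<gamma> (F (map \<gamma> xs))) \<in> C"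
  shows "symmetric_clone C"
proof -
  have "{conjugate_op \<gamma> f | f \<gamma>. f \<in> C \<and> bij \<gamma>} \<subseteq> C"
  proof
    fix g assume "g \<in> {conjugate_op \<gamma> f | f \<gamma>. f \<in> C \<and> bij \<gamma>}"
    then obtain f \<gamma> where g: "g = conjugate_op \<gamma> f" and f: "f \<in> C" and \<gamma>: "bij \<gamma>" by blast
    have "f \<in> all_ops" using f clone_sub C by blast
    then obtain n F where "n \<ge> 1" "f = op_of n F" by (rule all_ops_cases)
    then show "g \<in> C" using assms(2) f \<gamma> by (simp add: g conjugate_op_of)
  qed
  moreover have "C \<subseteq> {conjugate_op \<gamma> f | f \<gamma>. f \<in> C \<and> bij \<gamma>}"
  proof
    fix f assume f: "f \<in> C"
    then have "f = conjugate_op (\<lambda>x. x) f" using conjugate_op_id clone_sub C by (metis subsetD)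
    moreover have "bij (\<lambda>x :: 'a. x)" by (simp add: bij_def)
    ultimately show "f \<in> {conjugate_op \<gamma> f | f \<gamma>. f \<in> C \<and> bij \<gamma>}" using f by blast
  qed
  ultimately show ?thesis using C unfolding symmetric_clone_def by blast
qed

lemma symmetric_if_perms:
  assumes C: "is_clone C" and perms: "\<And>p. bij p \<Longrightarrow> p \<in> unary_part C"
  shows "symmetric_clone C"
proof (rule symmetric_cloneI [OF C])
  fix n F and \<gamma> :: "'a \<Rightarrow> 'a"
  assume n: "n \<ge> 1" and F: "op_of n F \<in> C" and \<gamma>: "bij \<gamma>"
  have g: "op_of 1 (\<lambda>xs. \<gamma> (hd xs)) \<in> C" using perms [OF \<gamma>] by (simp add: unary_part_def)
  have gi: "op_of 1 (\<lambda>xs. inv \<gamma> (hd xs)) \<in> C"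
    using perms [OF bij_imp_bij_inv [OF \<gamma>]] by (simp add: unary_part_def)
  have coord: "op_of n (\<lambda>xs. \<gamma> (xs ! i)) \<in> C" if "i < n" for i
    using clone_comp [OF C g n, of "[\<lambda>xs. xs ! i]"] clone_proj [OF C that] by simp
  have "op_of n (\<lambda>xs. F (map (\<lambda>G. G xs) (map (\<lambda>i xs. \<gamma> (xs ! i)) [0..<n]))) \<in> C"
    by (rule clone_comp [OF C F n]) (use coord in auto)
  moreover have "op_of n (\<lambda>xs. F (map (\<lambda>G. G xs) (map (\<lambda>i xs. \<gamma> (xs ! i)) [0..<n])))
    = op_of n (\<lambda>xs. F (map \<gamma> xs))"
  proof (rule op_of_cong)
    fix xs :: "'a list" assume "length xs = n"
    then have "map (\<lambda>G. G xs) (map (\<lambda>i xs. \<gamma> (xs ! i)) [0..<n]) = map \<gamma> xs"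
      by (intro nth_equalityI) auto
    then show "F (map (\<lambda>G. G xs) (map (\<lambda>i xs. \<gamma> (xs ! i)) [0..<n])) = F (map \<gamma> xs)" by simp
  qed
  ultimately have "op_of n (\<lambda>xs. F (map \<gamma> xs)) \<in> C" by simp
  then show "op_of n (\<lambda>xs. inv \<gamma> (F (map \<gamma> xs))) \<in> C"
    using clone_comp [OF C gi n, of "[\<lambda>xs. F (map \<gamma> xs)]"] by simp
qed

section \<open>Symmetric precomplete clones contain all permutations\<close>

lemma unary_conj:
  assumes "symmetric_clone C" "g \<in> unary_part C" "bij \<gamma>"
  shows "(\<lambda>x. inv \<gamma> (g (\<gamma> x))) \<in> unary_part C"
proof -
  have "op_of 1 (\<lambda>xs. inv \<gamma> (g (hd (map \<gamma> xs)))) \<in> C"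
    using assms(2) unfolding unary_part_def mem_Collect_eq
    by (rule symmetric_conj [OF assms(1) _ assms(3)])
  moreover have "op_of 1 (\<lambda>xs. inv \<gamma> (g (hd (map \<gamma> xs)))) = op_of 1 (\<lambda>xs. inv \<gamma> (g (\<gamma> (hd xs))))"
    by (rule op_of_cong) (auto simp: length_Suc_conv)
  ultimately show ?thesis by (simp add: unary_part_def)
qed

lemma unary_conj':
  assumes "symmetric_clone C" "g \<in> unary_part C" "bij \<gamma>"
  shows "(\<lambda>x. \<gamma> (g (inv \<gamma> x))) \<in> unary_part C"
  using unary_conj [OF assms(1,2) bij_imp_bij_inv [OF assms(3)]] assms(3) by (simp add: inv_inv_eq)

text \<open>By symmetry \<open>\<alpha>\<close> can be moved past \<open>F\<close>: applying
  \<open>\<alpha>\<close> after \<open>F\<close> is the same as applying the conjugate of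
  \<open>F\<close>, again a member of \<open>C\<close>, to the maps
  \<open>\<alpha> \<circ> g\<close>.\<close>

lemma closed_under_orbit:
  assumes sym: "symmetric_clone C" and S: "closed_under C S" and \<Gamma>: "\<And>\<alpha>. \<alpha> \<in> \<Gamma> \<Longrightarrow> bij \<alpha>"
  shows "closed_under C {r. \<forall>\<alpha>\<in>\<Gamma>. (\<lambda>x. \<alpha> (r x)) \<in> S}"
proof (rule closed_underI)
  fix n F and gs :: "('a \<Rightarrow> 'a) list"
  assume F: "op_of n F \<in> C" and len: "length gs = n"
    and gs: "set gs \<subseteq> {r. \<forall>\<alpha>\<in>\<Gamma>. (\<lambda>x. \<alpha> (r x)) \<in> S}"
  have "(\<lambda>x. \<alpha> (F (map (\<lambda>g. g x) gs))) \<in> S" if \<alpha>: "\<alpha> \<in> \<Gamma>" for \<alpha>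
  proof -
    have bij: "bij \<alpha>" using \<Gamma> \<alpha> .
    have "op_of n (\<lambda>xs. inv (inv \<alpha>) (F (map (inv \<alpha>) xs))) \<in> C"
      by (rule symmetric_conj [OF sym F bij_imp_bij_inv [OF bij]])
    then have F': "op_of n (\<lambda>xs. \<alpha> (F (map (inv \<alpha>) xs))) \<in> C" by (simp add: inv_inv_eq bij)
    have "set (map (\<lambda>g x. \<alpha> (g x)) gs) \<subseteq> S" using gs \<alpha> by auto
    then have "(\<lambda>x. \<alpha> (F (map (inv \<alpha>) (map (\<lambda>g. g x) (map (\<lambda>g x. \<alpha> (g x)) gs))))) \<in> S"
      by (intro closed_underD [OF S F']) (simp_all add: len)
    then show ?thesis using bij by (simp add: comp_def bij_is_inj)
  qed
  then show "(\<lambda>x. F (map (\<lambda>g. g x) gs)) \<in> {r. \<forall>\<alpha>\<in>\<Gamma>. (\<lambda>x. \<alpha> (r x)) \<in> S}" by blast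
qed

text \<open>\<open>S\<close> may fail to be closed under left multiplication by \<open>h\<close>.
  The set of all \<open>r\<close> with \<open>\<Gamma> \<circ> r\<close> inside \<open>S\<close> is
  closed under it, because \<open>\<Gamma>\<close> is a monoid containing \<open>h\<close>, and it
  is still preserved by \<open>C\<close>; so \<open>precomplete_closed_full\<close> applies to
  it.\<close>

lemma precomplete_orbit_full:
  assumes pre: "precomplete C" and sym: "symmetric_clone C" and S: "closed_under C S"
    and \<Gamma>: "\<And>\<alpha>. \<alpha> \<in> \<Gamma> \<Longrightarrow> bij \<alpha>" "\<And>\<alpha> \<beta>. \<alpha> \<in> \<Gamma> \<Longrightarrow> \<beta> \<in> \<Gamma> \<Longrightarrow> (\<lambda>x. \<alpha> (\<beta> x)) \<in> \<Gamma>" "(\<lambda>x. x) \<in> \<Gamma>"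
    and h: "h \<in> \<Gamma>" "h \<notin> unary_part C"
    and p: "\<And>\<alpha>. \<alpha> \<in> \<Gamma> \<Longrightarrow> (\<lambda>x. \<alpha> (p x)) \<in> S" and q: "\<And>\<alpha>. \<alpha> \<in> \<Gamma> \<Longrightarrow> (\<lambda>x. \<alpha> (q x)) \<in> S"
    and inj: "\<And>x y. p x = p y \<Longrightarrow> q x = q y \<Longrightarrow> x = y"
  shows "r \<in> S"
proof -
  let ?T = "{r. \<forall>\<alpha>\<in>\<Gamma>. (\<lambda>x. \<alpha> (r x)) \<in> S}"
  have "?T = UNIV"
  proof (rule precomplete_closed_full [OF pre closed_under_orbit [OF sym S \<Gamma>(1)] h(2) _ _ _ inj])
    fix t assume t: "t \<in> ?T"
    show "(\<lambda>x. h (t x)) \<in> ?T"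
    proof (intro CollectI ballI)
      fix \<alpha> assume "\<alpha> \<in> \<Gamma>"
      then have \<alpha>h: "(\<lambda>x. \<alpha> (h x)) \<in> \<Gamma>" using \<Gamma>(2) h(1) by simp
      from t have "\<forall>\<alpha>\<in>\<Gamma>. (\<lambda>x. \<alpha> (t x)) \<in> S" by simp
      from bspec [OF this \<alpha>h] show "(\<lambda>x. \<alpha> (h (t x))) \<in> S" .
    qed
  next
    show "p \<in> ?T" using p by simp
    show "q \<in> ?T" using q by simp
  qed simp_all
  then have "r \<in> ?T" by simp
  then have "\<forall>\<alpha>\<in>\<Gamma>. (\<lambda>x. \<alpha> (r x)) \<in> S" by simp
  from bspec [OF this \<Gamma>(3)] show ?thesis by simp
qed

definition fixing :: "'a set \<Rightarrow> ('a \<Rightarrow> 'a) set" where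
  "fixing A = {p. bij p \<and> (\<forall>x\<in>A. p x = x)}"

lemma fixing_comp: "p \<in> fixing A \<Longrightarrow> q \<in> fixing A \<Longrightarrow> (\<lambda>x. p (q x)) \<in> fixing A"
  unfolding fixing_def using bij_comp [of q p] by (auto simp: comp_def)

lemma fixing_id: "(\<lambda>x. x) \<in> fixing A"
  by (simp add: fixing_def bij_def)

context infinite_base
begin

text \<open>Take three large parts. If \<open>P1\<close> together with its image is not co-large,
  the image covers almost all of \<open>P2\<close>; the points of \<open>P1\<close> sent into
  \<open>P2\<close> then form \<open>B\<close>, and \<open>P3\<close> is left over.\<close>

lemma large_moved_apart:
  fixes \<sigma> :: "'a \<Rightarrow> 'a"
  assumes \<sigma>: "bij \<sigma>"
  obtains B where "large B" "large (- (B \<union> \<sigma> ` B))"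
proof -
  obtain P1 R where P1: "P1 \<union> R = (UNIV :: 'a set)" "P1 \<inter> R = {}" "large P1" "large R"
    using large_split [OF large_UNIV] by metis
  obtain P2 P3 where P2: "P2 \<union> P3 = R" "P2 \<inter> P3 = {}" "large P2" "large P3"
    using large_split [OF P1(4)] by metis
  show thesis
  proof (cases "large (- (P1 \<union> \<sigma> ` P1))")
    case True
    with P1(3) show thesis by (rule that)
  next
    case False
    let ?B = "{x \<in> P1. \<sigma> x \<in> P2}"
    have "small (P2 - \<sigma> ` P1)"
      by (rule small_mono [of "- (P1 \<union> \<sigma> ` P1)"]) (use False P1 P2 in \<open>auto simp: small_def\<close>)
    then have "large (P2 - (P2 - \<sigma> ` P1))" by (rule large_Diff_small [OF P2(3)])
    moreover have "P2 - (P2 - \<sigma> ` P1) = \<sigma> ` ?B" by auto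
    ultimately have "large ?B" using image_large_imp_large by metis
    moreover have "large (- (?B \<union> \<sigma> ` ?B))"
      by (rule large_mono [OF P2(4)]) (use P1 P2 in auto)
    ultimately show thesis by (rule that)
  qed
qed

text \<open>\<open>\<tau>\<close> imitates \<open>\<sigma>\<close> on \<open>B\<close> and fixes
  \<open>D\<close> pointwise; then \<open>\<sigma> \<circ> inv \<tau>\<close> fixes the image of
  \<open>B\<close>. The reserve \<open>D'\<close> leaves room to extend to permutations.\<close>

lemma bij_decompose:
  fixes \<sigma> :: "'a \<Rightarrow> 'a"
  assumes \<sigma>: "bij \<sigma>"
  obtains \<tau> \<rho> A B where "\<tau> \<in> fixing A" "\<rho> \<in> fixing B" "\<And>x. \<sigma> x = \<rho> (\<tau> x)"
    "large A" "large (- A)" "large B" "large (- B)"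
proof -
  obtain B where B: "large B" "large (- (B \<union> \<sigma> ` B))" by (rule large_moved_apart [OF \<sigma>])
  obtain D D' where D: "D \<union> D' = - (B \<union> \<sigma> ` B)" "D \<inter> D' = {}" "large D" "large D'"
    using large_split [OF B(2)] by metis
  have inj_\<sigma>: "inj \<sigma>" using \<sigma> by (rule bij_is_inj)
  let ?f = "\<lambda>x. if x \<in> B then \<sigma> x else x"
  have BD: "B \<inter> D = {}" "\<sigma> ` B \<inter> D = {}" "(B \<union> D) \<inter> D' = {}" "(\<sigma> ` B \<union> D) \<inter> D' = {}"
    using D(1,2) by blast+
  have img: "?f ` (B \<union> D) = \<sigma> ` B \<union> D" using BD(1) by auto
  have "inj_on ?f (B \<union> D)"
  proof (rule inj_onI)
    fix x y assume "x \<in> B \<union> D" "y \<in> B \<union> D" "?f x = ?f y"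
    then show "x = y" using BD(1,2) injD [OF inj_\<sigma>, of x y] by (auto split: if_splits)
  qed
  moreover have "large (- (B \<union> D))" by (rule large_mono [OF D(4)]) (use BD in blast)
  moreover have "large (- (?f ` (B \<union> D)))" unfolding img by (rule large_mono [OF D(4)]) (use BD in blast)
  ultimately obtain \<tau> where \<tau>: "bij \<tau>" "\<And>x. x \<in> B \<union> D \<Longrightarrow> \<tau> x = ?f x"
    by (rule bij_extend_large) blast
  have inv_\<tau>: "inv \<tau> (\<tau> x) = x" for x using \<tau>(1) by (simp add: bij_is_inj)
  show thesis
  proof (rule that)
    have "\<tau> x = x" if "x \<in> D" for x using \<tau>(2) [of x] that BD(1) by auto
    then show "\<tau> \<in> fixing D" using \<tau>(1) by (simp add: fixing_def)
    have "bij (\<sigma> \<circ> inv \<tau>)" using \<sigma> \<tau>(1) by (simp add: bij_comp bij_imp_bij_inv)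
    moreover have "\<sigma> (inv \<tau> (\<sigma> x)) = \<sigma> x" if "x \<in> B" for x
      using \<tau>(2) [of x] inv_\<tau> [of x] that by simp
    ultimately show "(\<lambda>x. \<sigma> (inv \<tau> x)) \<in> fixing (\<sigma> ` B)" by (auto simp: fixing_def comp_def)
    show "\<sigma> x = \<sigma> (inv \<tau> (\<tau> x))" for x by (simp add: inv_\<tau>)
    show "large D" by (rule D(3))
    show "large (- D)" by (rule large_mono [OF D(4)]) (use BD in blast)
    show "large (\<sigma> ` B)" using B(1) large_image [OF inj_on_subset [OF inj_\<sigma>, of B]] by simp
    show "large (- \<sigma> ` B)" by (rule large_mono [OF D(4)]) (use BD in blast)
  qed
qed

text \<open>All large co-large sets are images of each other under permutations, so by symmetry one
  pointwise stabiliser inside \<open>C\<close> brings all of them, and these generate every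
  permutation.\<close>

lemma perms_if_fixing:
  fixes A :: "'a set"
  assumes C: "is_clone C" and sym: "symmetric_clone C" and A: "large A" "large (- A)"
    and sub: "fixing A \<subseteq> unary_part C" and \<sigma>: "bij \<sigma>"
  shows "\<sigma> \<in> unary_part C"
proof -
  have fixing_in: "p \<in> unary_part C" if p: "p \<in> fixing B" and B: "large B" "large (- B)" for p B
  proof -
    obtain g where g: "bij_betw g A B" by (rule large_bij [OF A(1) B(1)])
    then have "inj_on g A" "g ` A = B" by (auto simp: bij_betw_def)
    then obtain \<gamma> where \<gamma>: "bij \<gamma>" "\<And>x. x \<in> A \<Longrightarrow> \<gamma> x = g x"
      using bij_extend_large [of g A] A(2) B(2) by metis
    have inv1: "inv \<gamma> (\<gamma> x) = x" "\<gamma> (inv \<gamma> x) = x" for x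
      using \<gamma>(1) by (simp_all add: bij_is_inj bij_is_surj surj_f_inv_f)
    have "bij (inv \<gamma> \<circ> (p \<circ> \<gamma>))"
      using p \<gamma>(1) by (intro bij_comp bij_imp_bij_inv) (auto simp: fixing_def)
    moreover have "p (\<gamma> x) = \<gamma> x" if "x \<in> A" for x
      using p that \<gamma>(2) \<open>g ` A = B\<close> by (auto simp: fixing_def)
    ultimately have "(\<lambda>x. inv \<gamma> (p (\<gamma> x))) \<in> fixing A" by (simp add: fixing_def comp_def inv1)
    then have "(\<lambda>x. inv \<gamma> (p (\<gamma> x))) \<in> unary_part C" using sub by blast
    from unary_conj' [OF sym this \<gamma>(1)] show ?thesis by (simp add: inv1)
  qed
  obtain \<tau> \<rho> A' B' where \<tau>: "\<tau> \<in> fixing A'" and \<rho>: "\<rho> \<in> fixing B'"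
    and eq: "\<And>x. \<sigma> x = \<rho> (\<tau> x)"
    and large: "large A'" "large (- A')" "large B'" "large (- B')"
    by (rule bij_decompose [OF \<sigma>]) (rule that)
  have "(\<lambda>x. \<rho> (\<tau> x)) \<in> unary_part C"
    by (rule unary_unary [OF C fixing_in [OF \<rho> large(3,4)] fixing_in [OF \<tau> large(1,2)]])
  moreover have "\<sigma> = (\<lambda>x. \<rho> (\<tau> x))" using eq by (rule ext)
  ultimately show ?thesis by simp
qed

text \<open>If a symmetric precomplete clone missed a permutation, it would contain no group
  \<open>fixing A\<close> with \<open>A\<close> large and co-large. Closing under such a group then shows successively that
  every map agrees on \<open>A\<close> with a unary member of the clone, that all \<open>r \<circ> s\<close> belong to the clone
  for some \<open>s\<close> collapsing one large set and fixing another pointwise, and finally that the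
  clone contains all unary maps.\<close>

theorem symmetric_precomplete_perms:
  fixes \<sigma> :: "'a \<Rightarrow> 'a"
  assumes pre: "precomplete C" and sym: "symmetric_clone C" and \<sigma>: "bij \<sigma>"
  shows "\<sigma> \<in> unary_part C"
proof (rule ccontr)
  assume \<sigma>_notin: "\<sigma> \<notin> unary_part C"
  note C = precomplete_clone [OF pre]
  let ?M = "unary_part C"
  have moved: "\<exists>h. h \<in> fixing A \<and> h \<notin> ?M" if A: "large A" "large (- A)" for A
    using perms_if_fixing [OF C sym A _ \<sigma>] \<sigma>_notin by blast
  have bij_fixing: "bij p" if "p \<in> fixing A" for p and A :: "'a set"
    using that by (simp add: fixing_def)
  have extend: "\<exists>m\<in>?M. \<forall>x\<in>A. r x = m x" if A: "large A" "large (- A)" for A r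
  proof -
    let ?S = "{r. \<exists>m\<in>?M. \<forall>x\<in>A. r x = m x}"
    obtain h where h: "h \<in> fixing A" "h \<notin> ?M" using moved A by blast
    have S: "closed_under C ?S"
    proof (rule closed_underI)
      fix n F and gs :: "('a \<Rightarrow> 'a) list"
      assume F: "op_of n F \<in> C" and len: "length gs = n" and gs: "set gs \<subseteq> ?S"
      then have "\<forall>g\<in>set gs. \<exists>m. m \<in> ?M \<and> (\<forall>x\<in>A. g x = m x)" by blast
      from bchoice [OF this]
      obtain m where m: "\<forall>g\<in>set gs. m g \<in> ?M \<and> (\<forall>x\<in>A. g x = m g x)" by blast
      have mF: "(\<lambda>x. F (map (\<lambda>g. g x) (map m gs))) \<in> ?M"
        by (rule unary_part_comp [OF C F]) (use m len in auto)
      have "F (map (\<lambda>g. g x) gs) = F (map (\<lambda>g. g x) (map m gs))" if "x \<in> A" for x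
      proof -
        have "map (\<lambda>g. g x) gs = map (\<lambda>g. g x) (map m gs)" using m that by simp
        then show ?thesis by (rule arg_cong)
      qed
      then have "\<forall>x\<in>A. F (map (\<lambda>g. g x) gs) = F (map (\<lambda>g. g x) (map m gs))" ..
      then show "(\<lambda>x. F (map (\<lambda>g. g x) gs)) \<in> ?S"
        by (intro CollectI bexI [OF _ mF])
    qed
    have p: "(\<lambda>x. \<alpha> x) \<in> ?S" if "\<alpha> \<in> fixing A" for \<alpha>
      by (intro CollectI bexI [OF _ id_unary_part [OF C]] ballI) (use that in \<open>simp add: fixing_def\<close>)
    have "r \<in> ?S"
    proof (rule precomplete_orbit_full [where \<Gamma> = "fixing A" and p = "\<lambda>x. x" and q = "\<lambda>x. x",
          OF pre sym S _ _ fixing_id h])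
      fix \<alpha> \<beta> assume "\<alpha> \<in> fixing A" "\<beta> \<in> fixing A"
      then show "(\<lambda>x. \<alpha> (\<beta> x)) \<in> fixing A" by (rule fixing_comp)
    qed (use p bij_fixing in simp_all)
    then show ?thesis by simp
  qed
  obtain A1 R where A1: "A1 \<union> R = (UNIV :: 'a set)" "A1 \<inter> R = {}" "large A1" "large R"
    using large_split [OF large_UNIV] by metis
  obtain A2 A3 where A2: "A2 \<union> A3 = R" "A2 \<inter> A3 = {}" "large A2" "large A3"
    using large_split [OF A1(4)] by metis
  have "large (A1 \<union> A2)" by (rule large_mono [OF A1(3)]) simp
  moreover have "large (- (A1 \<union> A2))" by (rule large_mono [OF A2(4)]) (use A1 A2 in blast)
  ultimately obtain s where s: "s \<in> ?M" "\<And>x. x \<in> A1 \<union> A2 \<Longrightarrow> (if x \<in> A1 then undefined else x) = s x"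
    using extend [of "A1 \<union> A2" "\<lambda>x. if x \<in> A1 then undefined else x"] by blast
  have s1: "s x = undefined" if "x \<in> A1" for x using s(2) [of x] that by simp
  have s2: "s x = x" if "x \<in> A2" for x
  proof -
    have "x \<notin> A1" using that A1(2) A2(1) by blast
    then show ?thesis using s(2) [of x] that by simp
  qed
  have rs: "(\<lambda>x. r (s x)) \<in> ?M" for r
  proof -
    let ?S = "{r. (\<lambda>x. r (s x)) \<in> ?M}"
    have S: "closed_under C ?S"
    proof (rule closed_underI)
      fix n F and gs :: "('a \<Rightarrow> 'a) list"
      assume F: "op_of n F \<in> C" and len: "length gs = n" and gs: "set gs \<subseteq> ?S"
      have "(\<lambda>x. F (map (\<lambda>g. g x) (map (\<lambda>g x. g (s x)) gs))) \<in> ?M"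
        by (rule unary_part_comp [OF C F]) (use gs len in auto)
      then show "(\<lambda>x. F (map (\<lambda>g. g x) gs)) \<in> ?S" by (simp add: comp_def)
    qed
    have "large (- A1)" by (rule large_mono [OF A1(4)]) (use A1 in blast)
    then obtain h where h: "h \<in> fixing (- A1)" "h \<notin> ?M" using moved [of "- A1"] A1(3) by auto
    \<comment> \<open>\<open>\<alpha>\<close> moves points only inside \<open>A1\<close>, where
      \<open>s\<close> is constant, so \<open>\<alpha> \<circ> s\<close> equals its conjugate
      \<open>\<alpha> \<circ> s \<circ> inv \<alpha>\<close>, which symmetry provides.\<close>
    have p: "(\<lambda>x. \<alpha> x) \<in> ?S" if \<alpha>: "\<alpha> \<in> fixing (- A1)" for \<alpha>
    proof -
      have bij: "bij \<alpha>" using \<alpha> by (simp add: fixing_def)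
      have "s (inv \<alpha> x) = s x" for x
      proof (cases "x \<in> A1")
        case True
        have "inv \<alpha> x \<in> A1"
        proof (rule ccontr)
          assume "inv \<alpha> x \<notin> A1"
          then have "\<alpha> (inv \<alpha> x) = inv \<alpha> x" using \<alpha> by (simp add: fixing_def)
          then show False using \<open>inv \<alpha> x \<notin> A1\<close> True bij by (simp add: bij_is_surj surj_f_inv_f)
        qed
        then show ?thesis using s1 True by simp
      next
        case False
        then have "\<alpha> x = x" using \<alpha> by (simp add: fixing_def)
        then have "inv \<alpha> x = x" using bij by (metis bij_is_inj inv_f_f)
        then show ?thesis by simp
      qed
      then show ?thesis using unary_conj' [OF sym s(1) bij] by simp
    qed
    have "r \<in> ?S"
    proof (rule precomplete_orbit_full [where \<Gamma> = "fixing (- A1)" and p = "\<lambda>x. x" and q = "\<lambda>x. x",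
          OF pre sym S _ _ fixing_id h])
      fix \<alpha> \<beta> assume "\<alpha> \<in> fixing (- A1)" "\<beta> \<in> fixing (- A1)"
      then show "(\<lambda>x. \<alpha> (\<beta> x)) \<in> fixing (- A1)" by (rule fixing_comp)
    qed (use p bij_fixing in simp_all)
    then show ?thesis by simp
  qed
  obtain pair :: "'a \<times> 'a \<Rightarrow> 'a" where pair: "bij pair" by (rule pairing_exists)
  have inv_pair: "inv pair (pair x) = x" "pair (inv pair y) = y" for x y
    using pair by (simp_all add: bij_is_inj bij_is_surj surj_f_inv_f)
  obtain \<psi> :: "'a \<Rightarrow> 'a" where \<psi>: "bij_betw \<psi> A2 UNIV" by (rule large_bij [OF A2(3) large_UNIV])
  \<comment> \<open>\<open>A2\<close> is read as a set of pairs, and the first entry is kept; since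
    \<open>s\<close> is the identity there, the fibres are large.\<close>
  define u where "u x = fst (inv pair (\<psi> (s x)))" for x
  have ru: "(\<lambda>x. r (u x)) \<in> ?M" for r
    unfolding u_def by (rule rs)
  have large_u: "large (u -` {y})" for y
  proof -
    have inj: "inj (\<lambda>b. inv_into A2 \<psi> (pair (y, b)))"
    proof (rule inj_on_inverseI)
      fix b
      show "snd (inv pair (\<psi> (inv_into A2 \<psi> (pair (y, b))))) = b"
        using \<psi> by (simp add: bij_betw_def f_inv_into_f inv_pair)
    qed
    have "inv_into A2 \<psi> (pair (y, b)) \<in> u -` {y}" for b
    proof -
      have "inv_into A2 \<psi> (pair (y, b)) \<in> A2"
        using \<psi> by (simp add: bij_betw_def inv_into_into)
      then show ?thesis
        using \<psi> by (simp add: u_def s2 bij_betw_def f_inv_into_f inv_pair)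
    qed
    then have "range (\<lambda>b. inv_into A2 \<psi> (pair (y, b))) \<subseteq> u -` {y}" by blast
    with inj show ?thesis unfolding large_iff_inj by blast
  qed
  have rp: "(\<lambda>x. r (p x)) \<in> ?M" if p: "\<And>y. large (p -` {y})" for r and p :: "'a \<Rightarrow> 'a"
  proof -
    have "|u -` {y}| =o |p -` {y}|" for y
      using large_u [of y] p [of y] ordIso_symmetric ordIso_transitive unfolding large_def by blast
    then obtain \<pi> where \<pi>: "bij \<pi>" "\<And>x. u (\<pi> x) = p x" by (rule same_fibres_bij) blast
    \<comment> \<open>\<open>ru\<close> is used for \<open>\<pi> \<circ> r\<close>, so that
      conjugation by \<open>\<pi>\<close> cancels the outer factor and leaves
      \<open>r \<circ> p\<close>.\<close>
    have "(\<lambda>x. inv \<pi> (\<pi> (r (u (\<pi> x))))) \<in> ?M" by (rule unary_conj [OF sym ru \<pi>(1)])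
    then show ?thesis using \<pi> by (simp add: bij_is_inj)
  qed
  \<comment> \<open>Both coordinates of the pairing have large fibres, so all
    \<open>\<alpha> \<circ> p0\<close> and \<open>\<alpha> \<circ> q0\<close> are in the clone, and
    together they separate points.\<close>
  define p0 where "p0 x = fst (inv pair x)" for x
  define q0 where "q0 x = snd (inv pair x)" for x
  have "large (p0 -` {y})" for y
    unfolding large_iff_inj
    by (intro exI [of _ "\<lambda>b. pair (y, b)"] conjI inj_on_inverseI [of _ "\<lambda>z. snd (inv pair z)"])
      (auto simp: inv_pair p0_def)
  note p0 = rp [OF this]
  have "large (q0 -` {y})" for y
    unfolding large_iff_inj
    by (intro exI [of _ "\<lambda>b. pair (b, y)"] conjI inj_on_inverseI [of _ "\<lambda>z. fst (inv pair z)"])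
      (auto simp: inv_pair q0_def)
  note q0 = rp [OF this]
  have inj: "x = y" if "p0 x = p0 y" "q0 x = q0 y" for x y
  proof -
    have "inv pair x = inv pair y" using that by (simp add: p0_def q0_def prod_eq_iff)
    then show ?thesis by (metis inv_pair(2))
  qed
  have comp: "(\<lambda>x. \<alpha> (\<beta> x)) \<in> Collect bij" if "\<alpha> \<in> Collect bij" "\<beta> \<in> Collect bij" for \<alpha> \<beta> :: "'a \<Rightarrow> 'a"
    using that bij_comp [of \<beta> \<alpha>] by (simp add: comp_def)
  have "\<sigma> \<in> ?M"
  proof (rule precomplete_orbit_full [where \<Gamma> = "Collect bij" and p = p0 and q = q0,
        OF pre sym closed_under_unary_part [OF C] _ _ _ _ \<sigma>_notin])
    fix \<alpha> \<beta> :: "'a \<Rightarrow> 'a" assume "\<alpha> \<in> Collect bij" "\<beta> \<in> Collect bij"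
    then show "(\<lambda>x. \<alpha> (\<beta> x)) \<in> Collect bij" by (rule comp)
  next
    fix x y assume "p0 x = p0 y" "q0 x = q0 y"
    then show "x = y" by (rule inj)
  next
    fix \<alpha> :: "'a \<Rightarrow> 'a"
    show "(\<lambda>x. \<alpha> (p0 x)) \<in> ?M" by (rule p0)
    show "(\<lambda>x. \<alpha> (q0 x)) \<in> ?M" by (rule q0)
  qed (use \<sigma> in \<open>simp_all add: bij_def\<close>)
  with \<sigma>_notin show False by simp
qed

end

section \<open>Precompleteness of the listed clones\<close>

lemma almost_all_iff: "almost_all P \<longleftrightarrow> small {x. \<not> P x}"
proof
  assume "almost_all P"
  then obtain S where S: "small (- S)" "\<forall>x\<in>S. P x" unfolding almost_all_def co_small_def by blast
  show "small {x. \<not> P x}" by (rule small_mono [OF S(1)]) (use S(2) in auto)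
next
  assume "small {x. \<not> P x}"
  moreover have "- {x. P x} = {x. \<not> P x}" by auto
  ultimately show "almost_all P"
    unfolding almost_all_def co_small_def by (intro exI [of _ "{x. P x}"]) simp
qed

lemma monoid_A_eq: "monoid_A = {f. small {y. large (f -` {y})}}"
  by (simp add: monoid_A_def almost_all_iff) (simp add: small_def)

lemma monoid_E_eq: "monoid_E = {f. small (- range f)}"
proof -
  have "{x. x \<notin> range f} = - range f" for f :: "'a \<Rightarrow> 'a" by auto
  then show ?thesis by (simp add: monoid_E_def almost_surjective_def almost_all_iff)
qed

lemma monoid_F_eq: "monoid_F = monoid_E \<union> {f. \<exists>c. f = (\<lambda>x. c)}"
  by (auto simp: monoid_F_def monoid_E_def)

lemma monoid_E_I: "small (- range f) \<Longrightarrow> f \<in> monoid_E"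
  by (simp add: monoid_E_eq)

definition comp_closed :: "('a \<Rightarrow> 'a) set \<Rightarrow> bool" where
  "comp_closed G \<longleftrightarrow> (\<forall>f\<in>G. \<forall>g\<in>G. (\<lambda>x. f (g x)) \<in> G)"

lemma comp_closedI:
  "(\<And>f g. f \<in> G \<Longrightarrow> g \<in> G \<Longrightarrow> (\<lambda>x. f (g x)) \<in> G) \<Longrightarrow> comp_closed G"
  by (simp add: comp_closed_def)

lemma unary_part_Pol_monoid:
  assumes "(\<lambda>x. x) \<in> G" "comp_closed G"
  shows "unary_part (Pol G) = G"
proof
  show "unary_part (Pol G) \<subseteq> G"
  proof
    fix h assume "h \<in> unary_part (Pol G)"
    then have "(\<lambda>x. h ((\<lambda>x. x) x)) \<in> G" using assms(1) unfolding unary_part_Pol_iff by (rule bspec)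
    then show "h \<in> G" by simp
  qed
  show "G \<subseteq> unary_part (Pol G)"
    using assms(2) by (intro subsetI) (simp add: unary_part_Pol_iff comp_closed_def)
qed

lemma Pol_not_all_ops:
  assumes "(\<lambda>x. x) \<in> G" "comp_closed G" "G \<noteq> UNIV"
  shows "Pol G \<noteq> all_ops" "\<not> nary_ops 1 \<subseteq> Pol G"
proof -
  show "\<not> nary_ops 1 \<subseteq> Pol G"
    unfolding nary_ops_1_subset_iff unary_part_Pol_monoid [OF assms(1,2)] by (rule assms(3))
  then show "Pol G \<noteq> all_ops" by (auto simp: all_ops_def)
qed

text \<open>Common frame for all listed monoids. Substituting members of \<open>G\<close> into an
  operation outside \<open>Pol G\<close> gives a unary map outside \<open>G\<close>;
  \<open>full\<close> turns it into all unary maps, and \<open>b\<close> these into all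
  operations.\<close>

lemma Pol_symmetric_precomplete:
  fixes G :: "('a \<Rightarrow> 'a) set"
  assumes id: "(\<lambda>x. x) \<in> G" and comp: "comp_closed G"
    and perms: "\<And>p. bij p \<Longrightarrow> p \<in> G" and proper: "G \<noteq> UNIV"
    and full: "\<And>D h g. is_clone D \<Longrightarrow> Pol G \<subseteq> D \<Longrightarrow> h \<in> unary_part D \<Longrightarrow> h \<notin> G
      \<Longrightarrow> g \<in> unary_part D"
    and b: "b \<in> binary_part (Pol G)"
    and u: "\<And>x y x' y'. b (u x) (u y) = b (u x') (u y') \<Longrightarrow> x = x' \<and> y = (y' :: 'a)"
  shows "symmetric_clone (Pol G) \<and> precomplete (Pol G) \<and> \<not> nary_ops 1 \<subseteq> Pol G"
proof (intro conjI)
  note un = unary_part_Pol_monoid [OF id comp]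
  show "symmetric_clone (Pol G)"
    by (rule symmetric_if_perms [OF is_clone_Pol]) (simp add: un perms)
  show "precomplete (Pol G)"
  proof (rule precompleteI [OF is_clone_Pol Pol_not_all_ops(1) [OF id comp proper]])
    fix D assume D: "is_clone D" "Pol G \<subseteq> D" "D \<noteq> Pol G"
    then obtain f where f: "f \<in> D" "f \<notin> Pol G" by blast
    then have "f \<in> all_ops" using clone_sub [OF D(1)] by blast
    then obtain n F where nF: "n \<ge> 1" "f = op_of n F" by (rule all_ops_cases)
    with f(2) obtain gs where gs: "length gs = n" "set gs \<subseteq> G"
      and h: "(\<lambda>x. F (map (\<lambda>g. g x) gs)) \<notin> G" using op_of_Pol_iff by blast
    have GD: "G \<subseteq> unary_part D" using D(2) un unfolding unary_part_def by blast
    have "op_of n F \<in> D" "set gs \<subseteq> unary_part D" using f(1) nF gs(2) GD by auto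
    from unary_part_comp [OF D(1) this(1) gs(1) this(2)]
    have "unary_part D = UNIV" using full [OF D(1,2) _ h] by blast
    moreover have "b \<in> binary_part D" using b D(2) unfolding binary_part_def by blast
    ultimately show "D = all_ops" using u by (rule clone_full [OF D(1)])
  qed
  show "\<not> nary_ops 1 \<subseteq> Pol G" by (rule Pol_not_all_ops(2) [OF id comp proper])
qed

text \<open>\<open>range e\<close> misses little of \<open>S\<close>, so its image under
  \<open>\<sigma>\<close> misses little of \<open>X\<close>. This is how binary operations that
  apply such a \<open>\<sigma>\<close> to one argument are seen to give almost surjective
  maps.\<close>

lemma small_compl_onto_image:
  fixes \<sigma> e :: "'a \<Rightarrow> 'a"
  assumes "\<sigma> ` S = UNIV" "small (- range e)"
  shows "small (- (\<sigma> ` (range e \<inter> S)))"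
proof (rule small_mono [OF small_image [OF assms(2)]])
  show "- (\<sigma> ` (range e \<inter> S)) \<subseteq> \<sigma> ` (- range e)"
  proof
    fix y assume y: "y \<in> - (\<sigma> ` (range e \<inter> S))"
    have "y \<in> \<sigma> ` S" using assms(1) by simp
    then show "y \<in> \<sigma> ` (- range e)" using y by auto
  qed
qed

lemma large_onto:
  fixes S :: "'a set"
  assumes "large S"
  obtains \<sigma> :: "'a \<Rightarrow> 'a" where "\<sigma> ` S = UNIV"
proof -
  obtain \<sigma> :: "'a \<Rightarrow> 'a" where "bij_betw \<sigma> S UNIV" by (rule large_bij [OF assms large_UNIV])
  then have "\<sigma> ` S = UNIV" by (simp add: bij_betw_def)
  then show thesis by (rule that)
qed

section \<open>Almost surjective maps: \<open>monoid_E\<close> and \<open>monoid_F\<close>\<close>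

context infinite_base
begin

lemma split_base:
  obtains P Q :: "'a set" where "large P" "large Q" "Q = - P"
proof -
  obtain P Q where "P \<union> Q = (UNIV :: 'a set)" "P \<inter> Q = {}" "large P" "large Q"
    by (rule large_split [OF large_UNIV])
  then show thesis by (intro that [of P Q]) auto
qed

lemma generous_surjection:
  obtains s :: "'a \<Rightarrow> 'a" where "\<And>y. large (s -` {y})"
proof -
  obtain s :: "'a \<Rightarrow> 'a" where "\<And>y. large {x \<in> UNIV. s x = y}"
    using fibred_map [of "UNIV :: 'a set" "UNIV :: 'a set"] by (metis UNIV_I UNIV_not_empty card_of_refl large_UNIV ordIso_imp_ordLeq)
  then have "large (s -` {y})" for y by (simp add: vimage_def)
  then show thesis by (rule that)
qed

lemma monoid_E_id: "(\<lambda>x :: 'a. x) \<in> monoid_E"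
  by (rule monoid_E_I) simp

lemma monoid_E_comp:
  fixes f g :: "'a \<Rightarrow> 'a"
  assumes "f \<in> monoid_E" "g \<in> monoid_E"
  shows "(\<lambda>x. f (g x)) \<in> monoid_E"
proof (rule monoid_E_I, rule small_mono)
  show "small (- range f \<union> f ` (- range g))"
    using assms unfolding monoid_E_eq by (intro small_Un small_image) auto
  show "- range (\<lambda>x. f (g x)) \<subseteq> - range f \<union> f ` (- range g)" by blast
qed

lemma monoid_E_surj: "surj f \<Longrightarrow> (f :: 'a \<Rightarrow> 'a) \<in> monoid_E"
  by (rule monoid_E_I) simp

lemma const_notin_monoid_E: "(\<lambda>x :: 'a. c :: 'a) \<notin> monoid_E"
proof
  assume "(\<lambda>x :: 'a. c :: 'a) \<in> monoid_E"
  then have "small (- {c})" by (auto simp: monoid_E_eq image_def)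
  then have "small (- {c} \<union> {c})" by (rule small_Un) (simp add: finite_small)
  moreover have "- {c} \<union> {c} = UNIV" by auto
  ultimately show False by (simp add: small_def)
qed

text \<open>A pairing does not preserve almost surjectivity, as the diagonal shows. So
  \<open>b\<close> pairs only on \<open>R \<times> R\<close> and elsewhere is onto in one argument.
  The second argument has priority; the first takes over when the second is a constant in
  \<open>R\<close>.\<close>

lemma binary_E_F:
  obtains b u where "b \<in> binary_part (Pol (monoid_E :: ('a \<Rightarrow> 'a) set))"
    "b \<in> binary_part (Pol monoid_F)"
    "\<And>x y x' y'. b (u x) (u y) = b (u x') (u y') \<Longrightarrow> x = x' \<and> y = (y' :: 'a)"
proof -
  obtain R R' :: "'a set" where R: "large R" "large R'" "R' = - R" by (rule split_base)
  obtain \<sigma> :: "'a \<Rightarrow> 'a" where \<sigma>: "\<sigma> ` R' = UNIV" by (rule large_onto [OF R(2)])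
  obtain pair :: "'a \<times> 'a \<Rightarrow> 'a" where pair: "bij pair" by (rule pairing_exists)
  obtain u :: "'a \<Rightarrow> 'a" where u: "bij_betw u UNIV R" by (rule large_bij [OF large_UNIV R(1)])
  define b where "b x y = (if y \<in> R' then \<sigma> y else if x \<in> R' then \<sigma> x else pair (x, y))" for x y
  have right: "(\<lambda>x. b (s x) (t x)) \<in> monoid_E" if "t \<in> monoid_E" for s t
  proof (rule monoid_E_I, rule small_mono)
    show "small (- (\<sigma> ` (range t \<inter> R')))"
      by (rule small_compl_onto_image [OF \<sigma>]) (use that in \<open>simp add: monoid_E_eq\<close>)
    show "- range (\<lambda>x. b (s x) (t x)) \<subseteq> - (\<sigma> ` (range t \<inter> R'))" by (auto simp: b_def)
  qed
  have left: "(\<lambda>x. b (s x) c) \<in> monoid_E" if "s \<in> monoid_E" "c \<notin> R'" for s c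
  proof (rule monoid_E_I, rule small_mono)
    show "small (- (\<sigma> ` (range s \<inter> R')))"
      by (rule small_compl_onto_image [OF \<sigma>]) (use that in \<open>simp add: monoid_E_eq\<close>)
    show "- range (\<lambda>x. b (s x) c) \<subseteq> - (\<sigma> ` (range s \<inter> R'))" using that(2) by (auto simp: b_def)
  qed
  show thesis
  proof (rule that)
    show "b \<in> binary_part (Pol monoid_E)" unfolding binary_part_Pol_iff using right by blast
    have "(\<lambda>x. b (s x) (t x)) \<in> monoid_F" if s: "s \<in> monoid_F" and t: "t \<in> monoid_F" for s t
    proof (cases "t \<in> monoid_E")
      case True
      then show ?thesis using right unfolding monoid_F_eq by blast
    next
      case False
      then obtain c where c: "t = (\<lambda>x. c)" using t unfolding monoid_F_eq by blast
      show ?thesis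
      proof (cases "s \<in> monoid_E \<and> c \<notin> R'")
        case True
        then show ?thesis using left unfolding monoid_F_eq c by blast
      next
        case False
        then have "\<exists>d. (\<lambda>x. b (s x) (t x)) = (\<lambda>x. d)"
          using s unfolding monoid_F_eq c by (auto simp: b_def)
        then show ?thesis unfolding monoid_F_eq by blast
      qed
    qed
    then show "b \<in> binary_part (Pol monoid_F)" unfolding binary_part_Pol_iff by blast
    fix x y x' y' assume "b (u x) (u y) = b (u x') (u y')"
    moreover have "u z \<notin> R'" for z using u R(3) by (auto simp: bij_betw_def)
    ultimately have "(u x, u y) = (u x', u y')"
      using bij_is_inj [OF pair] by (simp add: b_def inj_eq)
    then show "x = x' \<and> y = y'" using u by (simp add: bij_betw_def inj_eq)
  qed
qed

theorem Pol_E: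
  "symmetric_clone (Pol (monoid_E :: ('a \<Rightarrow> 'a) set)) \<and> precomplete (Pol (monoid_E :: ('a \<Rightarrow> 'a) set))
    \<and> \<not> nary_ops 1 \<subseteq> Pol (monoid_E :: ('a \<Rightarrow> 'a) set)"
proof -
  obtain b u where b: "b \<in> binary_part (Pol (monoid_E :: ('a \<Rightarrow> 'a) set))"
    "\<And>x y x' y'. b (u x) (u y) = b (u x') (u y') \<Longrightarrow> x = x' \<and> y = (y' :: 'a)"
    by (rule binary_E_F) (rule that)
  show ?thesis
  proof (rule Pol_symmetric_precomplete [where b = b and u = u, OF monoid_E_id _ _ _ _ b(1)])
    show "comp_closed (monoid_E :: ('a \<Rightarrow> 'a) set)" by (rule comp_closedI) (rule monoid_E_comp)
    show "x = x' \<and> y = y'" if "b (u x) (u y) = b (u x') (u y')" for x y x' y' by (rule b(2) [OF that])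
    show "(monoid_E :: ('a \<Rightarrow> 'a) set) \<noteq> UNIV" using const_notin_monoid_E by blast
    fix D and h g :: "'a \<Rightarrow> 'a"
    assume D: "is_clone D" "Pol monoid_E \<subseteq> D" and h: "h \<in> unary_part D" "h \<notin> monoid_E"
    have "large (- range h)" using h(2) by (simp add: monoid_E_eq small_def)
    then obtain \<sigma> :: "'a \<Rightarrow> 'a" where \<sigma>: "\<sigma> ` (- range h) = UNIV" by (rule large_onto)
    \<comment> \<open>At \<open>y = h x\<close> the value is \<open>g x\<close>; off the range of
      \<open>h\<close>, a large set, \<open>f\<close> is onto in \<open>y\<close>.\<close>
    define f where "f x y = (if y \<in> range h then g x else \<sigma> y)" for x y
    have "(\<lambda>x. f (s x) (t x)) \<in> monoid_E" if "t \<in> monoid_E" for s t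
    proof (rule monoid_E_I, rule small_mono)
      show "small (- (\<sigma> ` (range t \<inter> - range h)))"
        by (rule small_compl_onto_image [OF \<sigma>]) (use that in \<open>simp add: monoid_E_eq\<close>)
      show "- range (\<lambda>x. f (s x) (t x)) \<subseteq> - (\<sigma> ` (range t \<inter> - range h))" by (auto simp: f_def)
    qed
    then have "f \<in> binary_part (Pol monoid_E)" unfolding binary_part_Pol_iff by blast
    then have "f \<in> binary_part D" using D(2) unfolding binary_part_def by blast
    from binary_unary [OF D(1) this id_unary_part [OF D(1)] h(1)]
    show "g \<in> unary_part D" by (simp add: f_def)
  qed (rule monoid_E_surj, rule bij_is_surj)
qed

theorem Pol_F:
  "symmetric_clone (Pol (monoid_F :: ('a \<Rightarrow> 'a) set)) \<and> precomplete (Pol (monoid_F :: ('a \<Rightarrow> 'a) set))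
    \<and> \<not> nary_ops 1 \<subseteq> Pol (monoid_F :: ('a \<Rightarrow> 'a) set)"
proof -
  obtain b u where b: "b \<in> binary_part (Pol (monoid_F :: ('a \<Rightarrow> 'a) set))"
    "\<And>x y x' y'. b (u x) (u y) = b (u x') (u y') \<Longrightarrow> x = x' \<and> y = (y' :: 'a)"
    by (rule binary_E_F) (rule that)
  show ?thesis
  proof (rule Pol_symmetric_precomplete [where b = b and u = u, OF _ _ _ _ _ b(1)])
    show "x = x' \<and> y = y'" if "b (u x) (u y) = b (u x') (u y')" for x y x' y' by (rule b(2) [OF that])
    show "(\<lambda>x :: 'a. x) \<in> monoid_F" unfolding monoid_F_eq using monoid_E_id by blast
    show "comp_closed (monoid_F :: ('a \<Rightarrow> 'a) set)"
    proof (rule comp_closedI)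
      fix f g :: "'a \<Rightarrow> 'a"
      assume fg: "f \<in> monoid_F" "g \<in> monoid_F"
      show "(\<lambda>x. f (g x)) \<in> monoid_F"
      proof (cases "f \<in> monoid_E \<and> g \<in> monoid_E")
        case True
        then show ?thesis using monoid_E_comp unfolding monoid_F_eq by blast
      next
        case False
        then have "\<exists>c. (\<lambda>x. f (g x)) = (\<lambda>x. c)" using fg unfolding monoid_F_eq by auto
        then show ?thesis unfolding monoid_F_eq by blast
      qed
    qed
    show "p \<in> monoid_F" if "bij p" for p :: "'a \<Rightarrow> 'a"
      using monoid_E_surj bij_is_surj [OF that] unfolding monoid_F_eq by blast
    obtain R R' :: "'a set" where R: "large R" "large R'" "R' = - R" by (rule split_base)
    obtain a0 b0 where ab: "a0 \<in> R" "b0 \<in> R'" using large_nonempty R by blast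
    define w where "w x = (if x \<in> R then a0 else b0)" for x
    have "w \<notin> monoid_F"
    proof
      assume "w \<in> monoid_F"
      moreover have "w a0 \<noteq> w b0" using ab R(3) by (auto simp: w_def)
      then have "\<nexists>c. w = (\<lambda>x. c)" by auto
      ultimately have small: "small (- range w)" by (auto simp: monoid_F_eq monoid_E_eq)
      have "finite (range w)"
        by (rule finite_subset [of _ "{a0, b0}"]) (auto simp: w_def)
      from small_Un [OF small finite_small [OF this]] show False by (simp add: small_def Compl_partition2)
    qed
    then show "(monoid_F :: ('a \<Rightarrow> 'a) set) \<noteq> UNIV" by blast
    fix D and h g :: "'a \<Rightarrow> 'a"
    assume D: "is_clone D" "Pol monoid_F \<subseteq> D" and h: "h \<in> unary_part D" "h \<notin> monoid_F"
    obtain s :: "'a \<Rightarrow> 'a" where s: "\<And>y. large (s -` {y})" by (rule generous_surjection) (rule that)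
    have "\<exists>x. y = s x" for y using large_nonempty [OF s [of y]] by auto
    then have surj_s: "surj s" unfolding surj_def by blast
    have "s \<in> unary_part (Pol monoid_F)"
      unfolding unary_part_Pol_iff
    proof
      fix t :: "'a \<Rightarrow> 'a" assume "t \<in> monoid_F"
      then show "(\<lambda>x. s (t x)) \<in> monoid_F"
        using monoid_E_comp [OF monoid_E_surj [OF surj_s]] unfolding monoid_F_eq by auto
    qed
    then have "s \<in> unary_part D" using D(2) unfolding unary_part_def by blast
    \<comment> \<open>\<open>h\<close> is not constant, so precomposing with a surjection with large
      fibres makes every \<open>{x. h' x \<noteq> y}\<close> large, which is the room for the
      surjections \<open>\<tau> y\<close>.\<close>
    define h' where "h' x = h (s x)" for x
    have h'_in: "h' \<in> unary_part D"
      unfolding h'_def by (rule unary_unary [OF D(1) h(1) \<open>s \<in> unary_part D\<close>])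
    have ran: "range h' \<subseteq> range h" by (auto simp: h'_def)
    have "large (- range h)" using h(2) by (simp add: monoid_F_eq monoid_E_eq small_def)
    then have "large (- range h')" by (rule large_mono) (use ran in blast)
    then obtain \<sigma> :: "'a \<Rightarrow> 'a" where \<sigma>: "\<sigma> ` (- range h') = UNIV" by (rule large_onto)
    have "large {x. h' x \<noteq> y}" for y
    proof -
      have "\<exists>z. h z \<noteq> y"
      proof (rule ccontr)
        assume "\<not> (\<exists>z. h z \<noteq> y)"
        then have "h = (\<lambda>x. y)" by auto
        then show False using h(2) by (auto simp: monoid_F_eq)
      qed
      then obtain z where "h z \<noteq> y" by blast
      then show ?thesis by (intro large_mono [OF s [of z]]) (auto simp: h'_def)
    qed
    then have "\<exists>\<tau> :: 'a \<Rightarrow> 'a. \<tau> ` {x. h' x \<noteq> y} = UNIV" for y by (meson large_onto)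
    then obtain \<tau> :: "'a \<Rightarrow> 'a \<Rightarrow> 'a" where \<tau>: "\<And>y. \<tau> y ` {x. h' x \<noteq> y} = UNIV" by metis
    \<comment> \<open>A constant second argument must also give an almost surjective or constant
      map. Hence \<open>g x\<close> appears only on the graph \<open>y = h' x\<close>, and
      \<open>\<tau> y\<close> fills the rest of each line with \<open>y\<close> in the range of
      \<open>h'\<close>.\<close>
    define f where "f x y = (if y \<notin> range h' then \<sigma> y else if h' x = y then g x else \<tau> y x)" for x y
    have right: "(\<lambda>x. f (s x) (t x)) \<in> monoid_E" if "t \<in> monoid_E" for s t
    proof (rule monoid_E_I, rule small_mono)
      show "small (- (\<sigma> ` (range t \<inter> - range h')))"
        by (rule small_compl_onto_image [OF \<sigma>]) (use that in \<open>simp add: monoid_E_eq\<close>)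
      show "- range (\<lambda>x. f (s x) (t x)) \<subseteq> - (\<sigma> ` (range t \<inter> - range h'))" by (auto simp: f_def)
    qed
    have left: "(\<lambda>x. f (s x) c) \<in> monoid_E" if "s \<in> monoid_E" "c \<in> range h'" for s c
    proof (rule monoid_E_I, rule small_mono)
      show "small (- (\<tau> c ` (range s \<inter> {x. h' x \<noteq> c})))"
        by (rule small_compl_onto_image [OF \<tau>]) (use that in \<open>simp add: monoid_E_eq\<close>)
      show "- range (\<lambda>x. f (s x) c) \<subseteq> - (\<tau> c ` (range s \<inter> {x. h' x \<noteq> c}))"
        using that(2) by (auto simp: f_def)
    qed
    have "(\<lambda>x. f (s x) (t x)) \<in> monoid_F" if s: "s \<in> monoid_F" and t: "t \<in> monoid_F" for s t
    proof (cases "t \<in> monoid_E")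
      case True
      then show ?thesis using right unfolding monoid_F_eq by blast
    next
      case False
      then obtain c where c: "t = (\<lambda>x. c)" using t unfolding monoid_F_eq by blast
      show ?thesis
      proof (cases "s \<in> monoid_E \<and> c \<in> range h'")
        case True
        then show ?thesis using left unfolding monoid_F_eq c by blast
      next
        case False
        then have "\<exists>d. (\<lambda>x. f (s x) (t x)) = (\<lambda>x. d)"
          using s unfolding monoid_F_eq c by (auto simp: f_def)
        then show ?thesis unfolding monoid_F_eq by blast
      qed
    qed
    then have "f \<in> binary_part (Pol monoid_F)" unfolding binary_part_Pol_iff by blast
    then have "f \<in> binary_part D" using D(2) unfolding binary_part_def by blast
    from binary_unary [OF D(1) this id_unary_part [OF D(1)] h'_in]
    show "g \<in> unary_part D" by (simp add: f_def)
  qed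
qed

section \<open>Maps omitting many points: the monoids \<open>monoid_G r\<close>\<close>

lemma subset_of_card:
  fixes N :: "'a set" and r :: "'a rel"
  assumes "Card_order r" "r \<le>o |N|"
  obtains A where "A \<subseteq> N" "|A| =o r"
proof -
  have "|Field r| =o r" using assms(1) by (rule card_of_Field_ordIso)
  then have "|Field r| \<le>o |N|" using assms(2) by (rule ordIso_ordLeq_trans)
  then obtain f where f: "inj_on f (Field r)" "f ` Field r \<subseteq> N" unfolding card_of_ordLeq [symmetric] by blast
  have "|Field r| =o |f ` Field r|"
    unfolding card_of_ordIso [symmetric] using f(1) inj_on_imp_bij_betw by blast
  then have "|f ` Field r| =o r"
    using \<open>|Field r| =o r\<close> ordIso_symmetric ordIso_transitive by blast
  with f(2) show thesis by (rule that)
qed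

lemma monoid_G_I:
  assumes "r \<le>o |- range f|"
  shows "f \<in> monoid_G r"
proof -
  have "r \<le>o |- (f ` (- A))|" for A
    by (rule ordLeq_transitive [OF assms card_of_mono1]) blast
  then show ?thesis by (simp add: monoid_G_def)
qed

lemma large_ordLeq:
  fixes S :: "'a set"
  assumes "r \<le>o |UNIV :: 'a set|" "large S"
  shows "r \<le>o |S|"
  using assms ordLeq_transitive unfolding large_iff_ordLeq by blast

theorem Pol_G:
  fixes r :: "'a rel"
  assumes r: "Card_order r" "cone \<le>o r" "r \<le>o |UNIV :: 'a set|"
  shows "symmetric_clone (Pol (monoid_G r)) \<and> precomplete (Pol (monoid_G r))
    \<and> \<not> nary_ops 1 \<subseteq> Pol (monoid_G r)"
proof -
  obtain L L' :: "'a set" where L: "large L" "large L'" "L' = - L" by (rule split_base)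
  obtain pair :: "'a \<times> 'a \<Rightarrow> 'a" where pair: "bij pair" by (rule pairing_exists)
  have pair_eq: "pair p = pair q \<longleftrightarrow> p = q" for p q using pair by (simp add: bij_is_inj inj_eq)
  have pair_inv: "pair (inv pair y) = y" for y using pair by (simp add: bij_is_surj surj_f_inv_f)
  obtain d where d: "bij_betw d (UNIV :: 'a set) L" by (rule large_bij [OF large_UNIV L(1)])
  have d_eq: "d x = d y \<longleftrightarrow> x = y" for x y using d by (simp add: bij_betw_def inj_eq)
  \<comment> \<open>The range avoids \<open>L'\<close>, so every composite omits a large set and is
    in \<open>monoid_G r\<close>.\<close>
  have b: "(\<lambda>x y. d (pair (x, y))) \<in> binary_part (Pol (monoid_G r))"
    unfolding binary_part_Pol_iff
  proof (intro ballI monoid_G_I large_ordLeq [OF r(3)] large_mono [OF L(2)])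
    fix s t :: "'a \<Rightarrow> 'a"
    show "L' \<subseteq> - range (\<lambda>x. d (pair (s x, t x)))" using d L(3) by (auto simp: bij_betw_def)
  qed
  have nonempty: "\<not> r \<le>o |{} :: 'a set|"
  proof
    assume "r \<le>o |{} :: 'a set|"
    then have "cone \<le>o |{} :: 'a set|" using r(2) ordLeq_transitive by blast
    then show False unfolding cone_def using card_of_empty3 by blast
  qed
  show ?thesis
  proof (rule Pol_symmetric_precomplete [where u = "\<lambda>x. x", OF _ _ _ _ _ b])
    show "(\<lambda>x. x) \<in> monoid_G r"
      unfolding monoid_G_def by (auto intro: ordIso_imp_ordLeq ordIso_symmetric)
    show "comp_closed (monoid_G r)"
    proof (rule comp_closedI, unfold monoid_G_def, intro CollectI allI impI)
      fix f g :: "'a \<Rightarrow> 'a" and A :: "'a set"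
      assume "f \<in> {f. \<forall>A. |A| =o r \<longrightarrow> r \<le>o |- f ` (- A)|}" "g \<in> {f. \<forall>A. |A| =o r \<longrightarrow> r \<le>o |- f ` (- A)|}"
      then have f: "f \<in> monoid_G r" and g: "g \<in> monoid_G r" by (simp_all add: monoid_G_def)
      assume "|A| =o r"
      then have "r \<le>o |- (g ` (- A))|" using g by (simp add: monoid_G_def)
      then obtain A' where A': "A' \<subseteq> - (g ` (- A))" "|A'| =o r" by (rule subset_of_card [OF r(1)])
      then have "r \<le>o |- (f ` (- A'))|" using f by (simp add: monoid_G_def)
      then show "r \<le>o |- ((\<lambda>x. f (g x)) ` (- A))|"
        by (rule ordLeq_transitive [OF _ card_of_mono1]) (use A'(1) in blast)
    qed
    show "p \<in> monoid_G r" if p: "bij p" for p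
      unfolding monoid_G_def
    proof (intro CollectI allI impI)
      fix A :: "'a set" assume A: "|A| =o r"
      have "- (p ` (- A)) = p ` A" using bij_image_Compl_eq [OF p, of A] by simp
      moreover have "|A| =o |p ` A|"
        unfolding card_of_ordIso [symmetric]
        using p inj_on_imp_bij_betw inj_on_subset [OF bij_is_inj [OF p]] by blast
      ultimately show "r \<le>o |- (p ` (- A))|"
        using A ordIso_imp_ordLeq ordIso_symmetric ordIso_transitive by metis
    qed
    obtain \<sigma> :: "'a \<Rightarrow> 'a" where \<sigma>: "\<sigma> ` L' = UNIV" by (rule large_onto [OF L(2)])
    obtain A where A: "A \<subseteq> L" "|A| =o r" by (rule subset_of_card [OF r(1) large_ordLeq [OF r(3) L(1)]])
    have "\<sigma> \<notin> monoid_G r"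
    proof
      assume "\<sigma> \<in> monoid_G r"
      then have "r \<le>o |- (\<sigma> ` (- A))|" using A(2) by (simp add: monoid_G_def)
      moreover have "L' \<subseteq> - A" using A(1) L(3) by blast
      then have "- (\<sigma> ` (- A)) = {}" using \<sigma> by blast
      ultimately show False using nonempty by simp
    qed
    then show "monoid_G r \<noteq> UNIV" by blast
    fix D and h g :: "'a \<Rightarrow> 'a"
    assume D: "is_clone D" "Pol (monoid_G r) \<subseteq> D" and h: "h \<in> unary_part D" "h \<notin> monoid_G r"
    then obtain A where A: "|A| =o r" "\<not> r \<le>o |- (h ` (- A))|" by (auto simp: monoid_G_def)
    define Q where "Q = - (h ` (- A))"
    \<comment> \<open>Such a \<open>k\<close> lifts through \<open>h\<close> to a map that omits
      \<open>A\<close>; as \<open>A\<close> has size \<open>r\<close>, all composites of this lift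
      with maps on the right are in \<open>monoid_G r\<close>.\<close>
    have k: "k \<in> unary_part D" if k: "range k \<subseteq> - Q" for k
    proof -
      have "\<exists>z. z \<notin> A \<and> h z = k x" for x
      proof -
        have "k x \<in> h ` (- A)" using k unfolding Q_def by blast
        then show ?thesis by auto
      qed
      then obtain k' where k': "\<And>x. k' x \<notin> A" "\<And>x. h (k' x) = k x" by metis
      have "r \<le>o |- range (\<lambda>x. k' (t x))|" for t
        by (rule ordLeq_transitive [OF ordIso_imp_ordLeq [OF ordIso_symmetric [OF A(1)]] card_of_mono1])
          (use k' in auto)
      then have "k' \<in> unary_part (Pol (monoid_G r))"
        unfolding unary_part_Pol_iff by (intro ballI monoid_G_I)
      then have "k' \<in> unary_part D" using D(2) unfolding unary_part_def by blast
      from unary_unary [OF D(1) h(1) this] show ?thesis by (simp add: k')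
    qed
    have "large (- Q)"
    proof (rule ccontr)
      assume "\<not> large (- Q)"
      then have "large (UNIV - - Q)" by (intro large_Diff_small large_UNIV) (simp add: small_def)
      then have "large Q" by (simp add: Compl_eq_Diff_UNIV [symmetric])
      then show False using large_ordLeq [OF r(3)] A(2) unfolding Q_def by blast
    qed
    then obtain e where e: "bij_betw e (- Q) (UNIV :: 'a set)" by (rule large_bij [OF _ large_UNIV])
    then have e_inj: "e x = e y \<Longrightarrow> x = y" if "x \<notin> Q" "y \<notin> Q" for x y
      using that by (auto simp: bij_betw_def inj_on_def)
    \<comment> \<open>\<open>Q\<close> has fewer than \<open>r\<close> elements, so \<open>s\<close>
      in \<open>monoid_G r\<close> omits off \<open>B\<close> some \<open>v\<close> outside
      \<open>Q\<close>; there the composite omits almost all of the large set of codes with first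
      entry \<open>e v\<close>.\<close>
    define f where "f x y = (if x \<notin> Q \<and> y \<notin> Q then pair (e x, e y) else undefined)" for x y
    have "f \<in> binary_part (Pol (monoid_G r))"
      unfolding binary_part_Pol_iff monoid_G_def
    proof (intro ballI CollectI allI impI)
      fix s t :: "'a \<Rightarrow> 'a" and B :: "'a set"
      assume s: "s \<in> {f. \<forall>A. |A| =o r \<longrightarrow> r \<le>o |- (f ` (- A))|}" and B: "|B| =o r"
      then have rB: "r \<le>o |- (s ` (- B))|" by blast
      have "\<not> - (s ` (- B)) \<subseteq> Q"
      proof
        assume "- (s ` (- B)) \<subseteq> Q"
        then have "r \<le>o |Q|" by (rule ordLeq_transitive [OF rB card_of_mono1])
        then show False using A(2) by (simp add: Q_def)
      qed
      then obtain v where v: "v \<notin> s ` (- B)" "v \<notin> Q" by blast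
      have "large (range (\<lambda>z. pair (e v, z)))"
        by (subst large_image) (auto simp: inj_on_def pair_eq)
      then have "large (range (\<lambda>z. pair (e v, z)) - {undefined})"
        by (rule large_Diff_small) (simp add: finite_small)
      then show "r \<le>o |- ((\<lambda>x. f (s x) (t x)) ` (- B))|"
      proof (intro large_ordLeq [OF r(3)], elim large_mono, intro subsetI ComplI)
        fix y assume y: "y \<in> range (\<lambda>z. pair (e v, z)) - {undefined}"
          "y \<in> (\<lambda>x. f (s x) (t x)) ` (- B)"
        then obtain z x where zx: "y = pair (e v, z)" "x \<notin> B" "y = f (s x) (t x)" by auto
        then have "s x \<notin> Q" "pair (e (s x), e (t x)) = pair (e v, z)"
          using y(1) by (auto simp: f_def split: if_splits)
        then have "s x = v" using e_inj v(2) by (simp add: pair_eq)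
        then show False using v(1) zx(2) by blast
      qed
    qed
    then have f: "f \<in> binary_part D" using D(2) unfolding binary_part_def by blast
    \<comment> \<open>\<open>k1\<close> and \<open>k2\<close> decode \<open>g\<close> through
      \<open>f\<close>; their values avoid \<open>Q\<close>, so \<open>k\<close> applies to
      them.\<close>
    define k1 where "k1 x = inv_into (- Q) e (fst (inv pair (g x)))" for x
    define k2 where "k2 x = inv_into (- Q) e (snd (inv pair (g x)))" for x
    have inv_e: "inv_into (- Q) e y \<in> - Q" "e (inv_into (- Q) e y) = y" for y
    proof -
      have "y \<in> e ` (- Q)" using e by (simp add: bij_betw_def)
      then show "inv_into (- Q) e y \<in> - Q" "e (inv_into (- Q) e y) = y"
        by (rule inv_into_into, rule f_inv_into_f)
    qed
    have "k1 \<in> unary_part D" "k2 \<in> unary_part D"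
      by (rule k, use inv_e(1) in \<open>auto simp: k1_def k2_def\<close>)+
    from binary_unary [OF D(1) f this] have "(\<lambda>x. f (k1 x) (k2 x)) \<in> unary_part D" .
    moreover have "f (k1 x) (k2 x) = g x" for x
      using inv_e(1) by (simp add: f_def k1_def k2_def inv_e(2) pair_inv)
    ultimately show "g \<in> unary_part D" by simp
  qed (auto simp: d_eq pair_eq)
qed

end

section \<open>Maps with small fibres: \<open>monoid_B\<close> and \<open>monoid_A\<close>\<close>

context regular_base
begin

text \<open>A fibre of the paired map lies in a fibre of \<open>s\<close> and in one of
  \<open>t\<close>, so a large one sits over a pair of exceptional values, and such pairs are
  few.\<close>

lemma binary_AB:
  fixes pair :: "'a \<times> 'a \<Rightarrow> 'a"
  assumes "bij pair"
  shows "(\<lambda>x y. pair (x, y)) \<in> binary_part (Pol monoid_A)"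
    "(\<lambda>x y. pair (x, y)) \<in> binary_part (Pol monoid_B)"
proof -
  have pair_inv: "pair (inv pair y) = y" for y using assms by (simp add: bij_is_surj surj_f_inv_f)
  have pair_eq: "pair p = pair q \<longleftrightarrow> p = q" for p q using assms by (simp add: bij_is_inj inj_eq)
  have fib: "(\<lambda>x. pair (s x, t x)) -` {y} \<subseteq> s -` {fst (inv pair y)}"
    "(\<lambda>x. pair (s x, t x)) -` {y} \<subseteq> t -` {snd (inv pair y)}" for s t y
  proof -
    have "inv pair y = (s x, t x)" if "pair (s x, t x) = y" for x
      using that pair_eq pair_inv by metis
    then show "(\<lambda>x. pair (s x, t x)) -` {y} \<subseteq> s -` {fst (inv pair y)}"
      "(\<lambda>x. pair (s x, t x)) -` {y} \<subseteq> t -` {snd (inv pair y)}" by auto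
  qed
  show "(\<lambda>x y. pair (x, y)) \<in> binary_part (Pol monoid_B)"
    unfolding binary_part_Pol_iff monoid_B_def using small_mono [OF _ fib(1)] by auto
  show "(\<lambda>x y. pair (x, y)) \<in> binary_part (Pol monoid_A)"
    unfolding binary_part_Pol_iff
  proof (intro ballI)
    fix s t :: "'a \<Rightarrow> 'a" assume st: "s \<in> monoid_A" "t \<in> monoid_A"
    have "{y. large ((\<lambda>x. pair (s x, t x)) -` {y})}
      \<subseteq> {pair (a, b) | a b. a \<in> {y. large (s -` {y})} \<and> b \<in> {y. large (t -` {y})}}"
    proof
      fix y assume "y \<in> {y. large ((\<lambda>x. pair (s x, t x)) -` {y})}"
      then have "large (s -` {fst (inv pair y)})" "large (t -` {snd (inv pair y)})"
        using large_mono [OF _ fib(1)] large_mono [OF _ fib(2)] by auto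
      moreover have "y = pair (fst (inv pair y), snd (inv pair y))" by (simp add: pair_inv)
      ultimately show "y \<in> {pair (a, b) | a b. a \<in> {y. large (s -` {y})} \<and> b \<in> {y. large (t -` {y})}}"
        by blast
    qed
    moreover have "small {pair (a, b) | a b. a \<in> {y. large (s -` {y})} \<and> b \<in> {y. large (t -` {y})}}"
      using small_image2 [of "{y. large (s -` {y})}" "{y. large (t -` {y})}" "\<lambda>a b. pair (a, b)"] st
      by (simp add: monoid_A_eq)
    ultimately show "(\<lambda>x. pair (s x, t x)) \<in> monoid_A"
      unfolding monoid_A_eq using small_mono by blast
  qed
qed

lemma bij_small_fibre: "bij (p :: 'a \<Rightarrow> 'a) \<Longrightarrow> small (p -` {y})"
  by (rule finite_small) (simp add: bij_is_inj finite_vimageI)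

theorem Pol_B:
  "symmetric_clone (Pol (monoid_B :: ('a \<Rightarrow> 'a) set)) \<and> precomplete (Pol (monoid_B :: ('a \<Rightarrow> 'a) set))
    \<and> \<not> nary_ops 1 \<subseteq> Pol (monoid_B :: ('a \<Rightarrow> 'a) set)"
proof -
  obtain pair :: "'a \<times> 'a \<Rightarrow> 'a" where pair: "bij pair" by (rule pairing_exists)
  have pair_eq: "pair p = pair q \<longleftrightarrow> p = q" for p q using pair by (simp add: bij_is_inj inj_eq)
  have comp: "small ((\<lambda>x. f (g x)) -` {y})"
    if "\<And>y. small (f -` {y})" "\<And>y. small (g -` {y})" for f g :: "'a \<Rightarrow> 'a" and y
  proof -
    have "small (\<Union>z\<in>f -` {y}. g -` {z})" using that by (intro small_UN)
    then show ?thesis by (rule small_mono) auto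
  qed
  show ?thesis
  proof (rule Pol_symmetric_precomplete [where u = "\<lambda>x. x", OF _ _ _ _ _ binary_AB(2) [OF pair]])
    show "(\<lambda>x :: 'a. x) \<in> monoid_B" using bij_small_fibre bij_id unfolding monoid_B_def id_def by blast
    show "comp_closed (monoid_B :: ('a \<Rightarrow> 'a) set)"
      using comp unfolding monoid_B_def by (intro comp_closedI) simp
    show "p \<in> monoid_B" if "bij p" for p :: "'a \<Rightarrow> 'a" using bij_small_fibre [OF that] by (simp add: monoid_B_def)
    have "(\<lambda>x. undefined) \<notin> (monoid_B :: ('a \<Rightarrow> 'a) set)"
    proof
      assume "(\<lambda>x. undefined) \<in> (monoid_B :: ('a \<Rightarrow> 'a) set)"
      then have "small ((\<lambda>x :: 'a. undefined :: 'a) -` {undefined})" unfolding monoid_B_def by blast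
      then show False by (simp add: small_def)
    qed
    then show "(monoid_B :: ('a \<Rightarrow> 'a) set) \<noteq> UNIV" by blast
    fix D and h g :: "'a \<Rightarrow> 'a"
    assume D: "is_clone D" "Pol monoid_B \<subseteq> D" and h: "h \<in> unary_part D" "h \<notin> monoid_B"
    obtain c where "large (h -` {c})" using h(2) by (auto simp: monoid_B_def small_def)
    then obtain j where j: "bij_betw j (UNIV :: 'a set) (h -` {c})" by (rule large_bij [OF large_UNIV])
    then have inj_j: "inj j" and hj: "h (j x) = c" for x by (auto simp: bij_betw_def)
    have "small (j -` {y})" for y by (rule finite_small) (simp add: inj_j finite_vimageI)
    then have "j \<in> unary_part (Pol monoid_B)"
      unfolding unary_part_Pol_iff monoid_B_def using comp by simp
    then have "j \<in> unary_part D" using D(2) unfolding unary_part_def by blast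
    from unary_unary [OF D(1) h(1) this] have c: "(\<lambda>x. c) \<in> unary_part D" by (simp add: hj)
    \<comment> \<open>Changing the pairing on the line \<open>y = c\<close> is harmless: for
      \<open>t\<close> in \<open>monoid_B\<close> few \<open>x\<close> satisfy
      \<open>t x = c\<close>.\<close>
    define f where "f x y = (if y = c then g x else pair (x, y))" for x y
    have "(\<lambda>x. f (s x) (t x)) \<in> monoid_B" if s: "s \<in> monoid_B" and t: "t \<in> monoid_B" for s t
    proof -
      have "small ((\<lambda>x. f (s x) (t x)) -` {y})" for y
      proof (rule small_mono)
        show "small (t -` {c} \<union> (\<lambda>x. pair (s x, t x)) -` {y})"
          using binary_AB(2) [OF pair] s t unfolding binary_part_Pol_iff monoid_B_def
          by (intro small_Un) auto
      qed (auto simp: f_def)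
      then show ?thesis by (simp add: monoid_B_def)
    qed
    then have "f \<in> binary_part (Pol monoid_B)" unfolding binary_part_Pol_iff by blast
    then have "f \<in> binary_part D" using D(2) unfolding binary_part_def by blast
    from binary_unary [OF D(1) this id_unary_part [OF D(1)] c]
    show "g \<in> unary_part D" by (simp add: f_def)
  qed (auto simp: pair_eq)
qed

theorem Pol_A:
  "symmetric_clone (Pol (monoid_A :: ('a \<Rightarrow> 'a) set)) \<and> precomplete (Pol (monoid_A :: ('a \<Rightarrow> 'a) set))
    \<and> \<not> nary_ops 1 \<subseteq> Pol (monoid_A :: ('a \<Rightarrow> 'a) set)"
proof -
  obtain pair :: "'a \<times> 'a \<Rightarrow> 'a" where pair: "bij pair" by (rule pairing_exists)
  have pair_eq: "pair p = pair q \<longleftrightarrow> p = q" for p q using pair by (simp add: bij_is_inj inj_eq)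
  have in_A: "f \<in> monoid_A" if "\<And>y. y \<noteq> c \<Longrightarrow> small (f -` {y})" for f :: "'a \<Rightarrow> 'a" and c
  proof -
    have "{y. large (f -` {y})} \<subseteq> {c}" using that unfolding small_def by blast
    then have "small {y. large (f -` {y})}" by (rule small_mono [rotated]) (simp add: finite_small)
    then show ?thesis by (simp add: monoid_A_eq)
  qed
  have comp: "(\<lambda>x. f (g x)) \<in> monoid_A" if f: "f \<in> monoid_A" and g: "g \<in> monoid_A" for f g :: "'a \<Rightarrow> 'a"
  proof -
    have "{y. large ((\<lambda>x. f (g x)) -` {y})} \<subseteq> {y. large (f -` {y})} \<union> f ` {z. large (g -` {z})}"
    proof (intro subsetI, rule ccontr)
      fix y assume y: "y \<in> {y. large ((\<lambda>x. f (g x)) -` {y})}"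
        "y \<notin> {y. large (f -` {y})} \<union> f ` {z. large (g -` {z})}"
      then have "small (\<Union>z\<in>f -` {y}. g -` {z})" by (intro small_UN) (auto simp: small_def)
      then have "small ((\<lambda>x. f (g x)) -` {y})" by (rule small_mono) auto
      then show False using y(1) by (simp add: small_def)
    qed
    moreover have "small ({y. large (f -` {y})} \<union> f ` {z. large (g -` {z})})"
      using f g by (intro small_Un small_image) (simp_all add: monoid_A_eq)
    ultimately show ?thesis unfolding monoid_A_eq using small_mono by blast
  qed
  show ?thesis
  proof (rule Pol_symmetric_precomplete [where u = "\<lambda>x. x", OF _ comp_closedI _ _ _ binary_AB(1) [OF pair]])
    show "(\<lambda>x. f (g x)) \<in> monoid_A" if "f \<in> monoid_A" "g \<in> monoid_A" for f g :: "'a \<Rightarrow> 'a"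
      by (rule comp [OF that])
    show "(\<lambda>x :: 'a. x) \<in> monoid_A" by (rule in_A) (simp add: vimage_def finite_small)
    show "p \<in> monoid_A" if "bij p" for p :: "'a \<Rightarrow> 'a" by (rule in_A) (rule bij_small_fibre [OF that])
    obtain s :: "'a \<Rightarrow> 'a" where s: "\<And>y. large (s -` {y})" by (rule generous_surjection) (rule that)
    have "s \<notin> monoid_A" using s by (simp add: monoid_A_eq small_def)
    then show "(monoid_A :: ('a \<Rightarrow> 'a) set) \<noteq> UNIV" by blast
    fix D and h g :: "'a \<Rightarrow> 'a"
    assume D: "is_clone D" "Pol monoid_A \<subseteq> D" and h: "h \<in> unary_part D" "h \<notin> monoid_A"
    have "large {y. large (h -` {y})}" using h(2) by (simp add: monoid_A_eq small_def)
    then obtain \<eta> where \<eta>: "bij_betw \<eta> (UNIV :: 'a set) {y. large (h -` {y})}"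
      by (rule large_bij [OF large_UNIV])
    then have inj_\<eta>: "inj \<eta>" and "\<And>y. large (h -` {\<eta> y})" by (auto simp: bij_betw_def)
    then have "\<exists>e. bij_betw e (UNIV :: 'a set) (h -` {\<eta> y})" for y by (meson large_bij large_UNIV)
    then obtain e where e: "\<And>y. bij_betw (e y) (UNIV :: 'a set) (h -` {\<eta> y})" by metis
    \<comment> \<open>\<open>j x\<close> lies in the large fibre of \<open>h\<close> over the code
      \<open>\<eta> (g x)\<close>, and the position within the fibre encodes \<open>x\<close>, so
      \<open>j\<close> is injective. \<open>\<psi>\<close> later undoes the coding, at the cost of
      at most one large fibre, over \<open>undefined\<close>.\<close>
    define j where "j x = e (g x) x" for x
    have hj: "h (j x) = \<eta> (g x)" for x using e [of "g x"] by (auto simp: j_def bij_betw_def)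
    have "inj j"
    proof (rule injI)
      fix x x' assume eq: "j x = j x'"
      then have "\<eta> (g x) = \<eta> (g x')" using hj by metis
      then have "g x = g x'" using inj_\<eta> by (simp add: inj_eq)
      then show "x = x'" using eq e [of "g x"] by (simp add: j_def bij_betw_def inj_eq)
    qed
    then have "small (j -` {y})" for y by (intro finite_small) (simp add: finite_vimageI)
    then have j: "j \<in> monoid_A" by (intro in_A)
    define \<psi> where "\<psi> y = (if y \<in> range \<eta> then inv \<eta> y else undefined)" for y
    have "\<psi> \<in> monoid_A"
    proof (rule in_A)
      fix y :: 'a assume "y \<noteq> undefined"
      then have "\<psi> -` {y} \<subseteq> {\<eta> y}" by (auto simp: \<psi>_def f_inv_into_f split: if_splits)
      then show "small (\<psi> -` {y})" by (rule small_mono [rotated]) (simp add: finite_small)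
    qed
    with j have "j \<in> unary_part (Pol monoid_A)" "\<psi> \<in> unary_part (Pol monoid_A)"
      unfolding unary_part_Pol_iff using comp by blast+
    then have "j \<in> unary_part D" "\<psi> \<in> unary_part D" using D(2) unfolding unary_part_def by blast+
    from unary_unary [OF D(1) this(2) unary_unary [OF D(1) h(1) this(1)]]
    show "g \<in> unary_part D" by (simp add: hj \<psi>_def inj_\<eta>)
  qed (auto simp: pair_eq)
qed

end

section \<open>Clones that contain all permutations\<close>

definition tup :: "nat \<Rightarrow> (nat \<Rightarrow> 'a \<Rightarrow> 'a) \<Rightarrow> 'a \<Rightarrow> 'a list" where
  "tup n g x = map (\<lambda>i. g i x) [0..<n]"

lemma length_tup [simp]: "length (tup n g x) = n"
  by (simp add: tup_def)

lemma nth_tup [simp]: "i < n \<Longrightarrow> tup n g x ! i = g i x"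
  by (simp add: tup_def)

lemma tup_eqI: "(\<And>i. i < n \<Longrightarrow> g i x = h i y) \<Longrightarrow> tup n g x = tup n h y"
  by (simp add: tup_def)

lemma tup_eq_listI: "length xs = n \<Longrightarrow> (\<And>i. i < n \<Longrightarrow> g i x = xs ! i) \<Longrightarrow> tup n g x = xs"
  by (intro nth_equalityI) simp_all

lemma tup_comp_unary_part:
  assumes "is_clone C" "op_of n F \<in> C" "\<And>i. i < n \<Longrightarrow> g i \<in> unary_part C"
  shows "(\<lambda>x. F (tup n g x)) \<in> unary_part C"
proof -
  have "(\<lambda>x. F (map (\<lambda>g. g x) (map g [0..<n]))) \<in> unary_part C"
    by (rule unary_part_comp [OF assms(1,2)]) (use assms(3) in auto)
  then show ?thesis by (simp add: tup_def comp_def)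
qed

lemma not_subset_Pol:
  assumes "is_clone C" "\<not> C \<subseteq> Pol G"
  obtains n F g where "op_of n F \<in> C" "n \<ge> 1" "\<And>i. i < n \<Longrightarrow> g i \<in> G"
    "(\<lambda>x. F (tup n g x)) \<notin> G"
proof -
  from assms(2) obtain f where f: "f \<in> C" "f \<notin> Pol G" by blast
  then have "f \<in> all_ops" using clone_sub [OF assms(1)] by blast
  then obtain n F where nF: "n \<ge> 1" "f = op_of n F" by (rule all_ops_cases)
  with f(2) obtain gs where gs: "length gs = n" "set gs \<subseteq> G"
    and h: "(\<lambda>x. F (map (\<lambda>g. g x) gs)) \<notin> G" using op_of_Pol_iff by blast
  have "map (\<lambda>g. g x) gs = tup n (\<lambda>i. gs ! i) x" for x
    using gs(1) by (intro nth_equalityI) simp_all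
  then have "(\<lambda>x. F (tup n (\<lambda>i. gs ! i) x)) \<notin> G" using h by simp
  moreover have "gs ! i \<in> G" if "i < n" for i using gs that by auto
  ultimately show thesis using f(1) nF that [of n F "\<lambda>i. gs ! i"] by simp
qed

lemma bij_moving:
  obtains \<sigma> :: "'a \<Rightarrow> 'a" where "bij \<sigma>" "\<sigma> c = k"
proof -
  let ?\<sigma> = "\<lambda>x. if x = c then k else if x = k then c else x"
  have "bij ?\<sigma>" by (rule involuntory_imp_bij) auto
  then show thesis using that [of ?\<sigma>] by simp
qed

context infinite_base
begin

lemma fibred_onto:
  assumes "large (D :: 'a set)"
  obtains s :: "'a \<Rightarrow> 'a" where "\<And>y. large {x \<in> D. s x = y}"
proof -
  obtain s :: "'a \<Rightarrow> 'a" where "\<And>y. y \<in> UNIV \<Longrightarrow> large {x \<in> D. s x = y}"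
    by (rule fibred_map [OF assms card_of_mono1 [OF subset_UNIV] UNIV_not_empty]) (rule that)
  then show thesis by (intro that [of s]) simp
qed

end

context regular_base
begin

text \<open>Smallness is a notion for subsets of \<open>X\<close>, so the size of the
  \<open>n\<close>-th power of \<open>V\<close> is expressed through its images in
  \<open>X\<close>.\<close>

lemma small_list_image:
  fixes F :: "'a list \<Rightarrow> 'a"
  assumes "small V"
  shows "small (F ` {xs. length xs = n \<and> set xs \<subseteq> V})"
proof (induction n arbitrary: F)
  case 0
  have "{xs. length xs = 0 \<and> set xs \<subseteq> V} = {[]}" by auto
  then show ?case by (simp add: finite_small)
next
  case (Suc n)
  have "small (\<Union>a\<in>V. (\<lambda>xs. F (a # xs)) ` {xs. length xs = n \<and> set xs \<subseteq> V})"
    by (rule small_UN [OF assms Suc.IH])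
  then show ?case by (rule small_mono) (auto simp: length_Suc_conv)
qed

text \<open>An earlier choice forbids only itself and the points where one of finitely many
  \<open>q i\<close> repeats its value; these are few by hypothesis.\<close>

lemma inj_selection:
  fixes W :: "'a \<Rightarrow> 'a set" and q :: "'i \<Rightarrow> 'a \<Rightarrow> 'a"
  assumes W: "\<And>t. large (W t)" and I: "finite I"
    and small: "\<And>t i z. i \<in> I \<Longrightarrow> small {y \<in> W t. q i y = z}"
  obtains c where "\<And>t. c t \<in> W t" "inj c" "\<And>i. i \<in> I \<Longrightarrow> inj (\<lambda>t. q i (c t))"
proof -
  let ?conf = "\<lambda>x y. x = y \<or> (\<exists>i\<in>I. q i y = q i x)"
  have "small {y \<in> W t. ?conf x y}" for t x
  proof (rule small_mono)
    show "small ({x} \<union> (\<Union>i\<in>I. {y \<in> W t. q i y = q i x}))"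
      by (intro small_Un small_finite_UN I small) (simp_all add: finite_small)
  qed auto
  note small_conf = this
  obtain c where c: "\<And>t. c t \<in> W t" "\<And>s t. prec s t \<Longrightarrow> \<not> ?conf (c s) (c t)"
    by (rule selection [where conf = ?conf and W = W, OF W small_conf]) (rule that)
  have prec_ne: "c s \<noteq> c t \<and> (\<forall>i\<in>I. q i (c s) \<noteq> q i (c t))" if "prec s t" for s t
    using c(2) [OF that] by metis
  have ne: "c s \<noteq> c t \<and> (\<forall>i\<in>I. q i (c s) \<noteq> q i (c t))" if "s \<noteq> t" for s t
    using prec_total [OF that] prec_ne [of s t] prec_ne [of t s] by metis
  have "inj c" by (rule injI) (use ne in blast)
  moreover have "inj (\<lambda>t. q i (c t))" if "i \<in> I" for i by (rule injI) (use ne that in blast)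
  ultimately show thesis by (rule that [OF c(1)])
qed

end

text \<open>These assumptions are contradictory: the context collects members of \<open>M\<close>
  until all unary maps are there, against \<open>not_full\<close>.\<close>

locale permutation_clone = regular_base base for base :: "'a itself" +
  fixes C :: "'a operation set"
  assumes pre: "precomplete C"
    and perms: "\<And>p. bij p \<Longrightarrow> p \<in> unary_part C"
    and not_full: "unary_part C \<noteq> UNIV"
    and not_listed: "\<And>G. G \<in> listed_monoids \<Longrightarrow> \<not> C \<subseteq> Pol G"
begin

abbreviation "M \<equiv> unary_part C"

lemma C: "is_clone C"
  using pre by (rule precomplete_clone)

lemma comp_in: "g \<in> M \<Longrightarrow> h \<in> M \<Longrightarrow> (\<lambda>x. g (h x)) \<in> M"
  by (rule unary_unary [OF C])

lemma same_fibres_in: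
  assumes "e \<in> M" "\<And>y. |e -` {y}| =o |e' -` {y}|"
  shows "e' \<in> M"
proof -
  obtain p where p: "bij p" "\<And>x. e (p x) = e' x" using same_fibres_bij [OF assms(2)] by blast
  from comp_in [OF assms(1) perms [OF p(1)]] show ?thesis by (simp add: p(2))
qed

lemma large_large_ordIso: "large (A :: 'a set) \<Longrightarrow> large (B :: 'a set) \<Longrightarrow> |A| =o |B|"
  unfolding large_def by (rule ordIso_transitive [OF _ ordIso_symmetric])

text \<open>Half of the domain is given up to make the complements of domain and image large.\<close>

lemma inj_halves:
  fixes q c :: "'a \<Rightarrow> 'a"
  assumes c: "inj c" and q: "inj (\<lambda>t. q (c t))" and P: "large (- P)"
  obtains p where "bij p" "\<And>t. t \<in> P \<Longrightarrow> p (c t) = q (c t)"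
proof -
  have "inj_on q (c ` P)"
  proof (rule inj_onI)
    fix x y assume "x \<in> c ` P" "y \<in> c ` P" "q x = q y"
    moreover from this obtain s t where "x = c s" "y = c t" by blast
    ultimately show "x = y" using injD [OF q, of s t] by simp
  qed
  moreover have "large (- (c ` P))"
  proof (rule large_mono)
    show "large (c ` (- P))" using P large_image [OF inj_on_subset [OF c]] by simp
  qed (use injD [OF c] in blast)
  moreover have "large (- (q ` c ` P))"
  proof (rule large_mono)
    show "large ((\<lambda>t. q (c t)) ` (- P))" using P large_image [OF inj_on_subset [OF q]] by simp
  qed (use injD [OF q] in blast)
  ultimately obtain p where "bij p" "\<And>x. x \<in> c ` P \<Longrightarrow> p x = q x"
    by (rule bij_extend_large) blast
  then show thesis by (intro that [of p]) auto
qed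

text \<open>The failure on \<open>monoid_B\<close> makes a composite constant on a large set
  although every \<open>b i\<close> has small fibres. On selected points all \<open>b i\<close> are
  injective, and on half of these they can be replaced by permutations.\<close>

lemma partially_constant:
  obtains m V c where "m \<in> M" "large V" "large (- V)" "\<And>x. x \<in> V \<Longrightarrow> m x = c"
proof -
  have "monoid_B \<in> listed_monoids" by (simp add: listed_monoids_def)
  then obtain n F b where F: "op_of n F \<in> C" and b: "\<And>i. i < n \<Longrightarrow> b i \<in> monoid_B"
    and h: "(\<lambda>x. F (tup n b x)) \<notin> monoid_B"
    using not_subset_Pol [OF C not_listed] by metis
  then obtain k where W: "large ((\<lambda>x. F (tup n b x)) -` {k})" by (auto simp: monoid_B_def small_def)
  let ?W = "(\<lambda>x. F (tup n b x)) -` {k}"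
  have "small {y \<in> ?W. b i y = z}" if "i \<in> {..<n}" for i z
    by (rule small_mono [of "b i -` {z}"]) (use b [of i] that in \<open>auto simp: monoid_B_def\<close>)
  note small = this
  obtain c :: "'a \<Rightarrow> 'a" where c: "\<And>t. c t \<in> ?W" "inj c" "\<And>i. i \<in> {..<n} \<Longrightarrow> inj (\<lambda>t. b i (c t))"
  proof (rule inj_selection [of "\<lambda>t. ?W" "{..<n}" b, OF W finite_lessThan])
    fix c assume "\<And>t :: 'a. c t \<in> ?W" "inj c" "\<And>i. i \<in> {..<n} \<Longrightarrow> inj (\<lambda>t. b i (c t))"
    then show thesis by (rule that)
  qed (rule small)
  obtain P Q :: "'a set" where P: "large P" "large Q" "Q = - P" by (rule split_base)
  have "\<exists>p. bij p \<and> (\<forall>t\<in>P. p (c t) = b i (c t))" if "i < n" for i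
  proof -
    have "inj (\<lambda>t. b i (c t))" by (rule c(3)) (use that in simp)
    moreover have "large (- P)" using P by simp
    ultimately obtain p where "bij p" "\<And>t. t \<in> P \<Longrightarrow> p (c t) = b i (c t)"
      by (rule inj_halves [OF c(2)]) (rule that)
    then show ?thesis by blast
  qed
  then obtain p where p: "\<And>i. i < n \<Longrightarrow> bij (p i)" "\<And>i t. i < n \<Longrightarrow> t \<in> P \<Longrightarrow> p i (c t) = b i (c t)"
    by metis
  show thesis
  proof (rule that)
    show "(\<lambda>x. F (tup n p x)) \<in> M" by (rule tup_comp_unary_part [OF C F]) (rule perms [OF p(1)])
    show "large (c ` P)" using P(1) large_image [OF inj_on_subset [OF c(2)]] by simp
    show "large (- (c ` P))"
    proof (rule large_mono)
      show "large (c ` Q)" using P(2) large_image [OF inj_on_subset [OF c(2)]] by simp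
    qed (use injD [OF c(2)] P(3) in blast)
    fix x assume "x \<in> c ` P"
    then obtain t where t: "t \<in> P" "x = c t" by blast
    have "tup n p x = tup n b x" by (rule tup_eqI) (use p(2) t in simp)
    then show "F (tup n p x) = k" using c(1) [of t] t by simp
  qed
qed

text \<open>For use in a proof by contradiction, where the extension property is available first. A
  partial map on half of \<open>X\<close> can already have large fibres over all points, and its
  extensions keep them.\<close>

lemma generous_if_extends:
  fixes e :: "'a \<Rightarrow> 'a"
  assumes ext: "\<And>A h. large (- A) \<Longrightarrow> \<exists>m\<in>M. \<forall>x\<in>A. m x = h x"
    and e: "\<And>y. large (e -` {y})"
  shows "e \<in> M"
proof -
  obtain P Q :: "'a set" where P: "large P" "large Q" "Q = - P" by (rule split_base)
  obtain s :: "'a \<Rightarrow> 'a" where s: "\<And>y. large {x \<in> P. s x = y}"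
    by (rule fibred_onto [OF P(1)]) (rule that)
  obtain m where m: "m \<in> M" "\<forall>x\<in>P. m x = s x" using ext [of P s] P by blast
  have "large (m -` {y})" for y
    by (rule large_mono [OF s [of y]]) (use m(2) in auto)
  then have "|m -` {y}| =o |e -` {y}|" for y using e large_large_ordIso by blast
  then show ?thesis by (rule same_fibres_in [OF m(1)])
qed

text \<open>If the range of \<open>F(e\<^sub>1, \<dots>, e\<^sub>n)\<close> is not almost everything, the \<open>e\<^sub>i\<close> may be replaced by
  surjections with large fibres: the few values missed by \<open>e\<^sub>i\<close> are taken on another large set,
  where \<open>F\<close> then has few values.\<close>

lemma fill:
  assumes F: "op_of n F \<in> C"
    and e: "\<And>i. i < n \<Longrightarrow> e i \<in> monoid_E \<or> e i \<in> M \<and> (\<exists>c. e i = (\<lambda>x. c))"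
    and gen: "\<And>g. (\<And>y. large (g -` {y})) \<Longrightarrow> g \<in> M"
    and ran: "large (- range (\<lambda>x. F (tup n e x)))"
  obtains m where "m \<in> M" "large (- range m)" "\<And>x. large (m -` {F (tup n e x)})"
proof -
  obtain P Q :: "'a set" where P: "large P" "large Q" "Q = - P" by (rule split_base)
  obtain s :: "'a \<Rightarrow> 'a" where s: "\<And>y. large {x \<in> P. s x = y}"
    by (rule fibred_onto [OF P(1)]) (rule that)
  \<comment> \<open>The few values that \<open>e i\<close> omits, or its only value if it is
    constant; \<open>undefined\<close> merely keeps the set nonempty.\<close>
  define N where "N i = (if e i \<in> monoid_E then insert undefined (- range (e i)) else range (e i))" for i
  have small_N: "small (N i)" if i: "i < n" for i
  proof (cases "e i \<in> monoid_E")
    case True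
    then have "small ({undefined} \<union> - range (e i))"
      by (intro small_Un) (simp_all add: finite_small monoid_E_eq)
    then show ?thesis using True by (simp add: N_def)
  next
    case False
    then obtain c where "e i = (\<lambda>x. c)" using e [OF i] by blast
    then show ?thesis using False by (simp add: N_def finite_small)
  qed
  have "\<exists>\<nu> :: 'a \<Rightarrow> 'a. (\<forall>x. \<nu> x \<in> N i) \<and> (\<forall>y\<in>N i. large {x \<in> Q. \<nu> x = y})" for i
  proof -
    have "N i \<noteq> {}" by (simp add: N_def)
    then obtain \<nu> :: "'a \<Rightarrow> 'a" where "\<And>x. \<nu> x \<in> N i" "\<And>y. y \<in> N i \<Longrightarrow> large {x \<in> Q. \<nu> x = y}"
      using fibred_map [OF P(2) card_of_mono1 [OF subset_UNIV], of "N i"] by metis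
    then show ?thesis by blast
  qed
  then obtain \<nu> :: "nat \<Rightarrow> 'a \<Rightarrow> 'a" where \<nu>: "\<And>i x. \<nu> i x \<in> N i"
    "\<And>i y. y \<in> N i \<Longrightarrow> large {x \<in> Q. \<nu> i x = y}" by metis
  define e' where "e' i x = (if e i \<in> monoid_E then if x \<in> P then e i (s x) else \<nu> i x else e i x)" for i x
  have e'_in: "e' i \<in> M" if "i < n" for i
  proof (cases "e i \<in> monoid_E")
    case True
    show ?thesis
    proof (rule gen)
      fix y
      show "large (e' i -` {y})"
      proof (cases "y \<in> range (e i)")
        case True
        then obtain z where "y = e i z" by blast
        then show ?thesis using \<open>e i \<in> monoid_E\<close>
          by (intro large_mono [OF s [of z]]) (auto simp: e'_def)
      next
        case False
        then have "y \<in> N i" using \<open>e i \<in> monoid_E\<close> by (simp add: N_def)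
        then show ?thesis using \<open>e i \<in> monoid_E\<close> P(3)
          by (intro large_mono [OF \<nu>(2)]) (auto simp: e'_def)
      qed
    qed
  next
    case False
    then have "e' i = e i" by (auto simp: e'_def)
    then show ?thesis using False e [OF that] by simp
  qed
  let ?m = "\<lambda>x. F (tup n e' x)"
  have on_P: "?m x = F (tup n e (s x))" if "x \<in> P" for x
  proof -
    have "tup n e' x = tup n e (s x)"
    proof (rule tup_eqI)
      fix i assume "i < n"
      from e [OF this] show "e' i x = e i (s x)" using that by (auto simp: e'_def)
    qed
    then show ?thesis by simp
  qed
  let ?V = "\<Union>i\<in>{..<n}. N i"
  have on_Q: "?m x \<in> F ` {xs. length xs = n \<and> set xs \<subseteq> ?V}" if "x \<in> Q" for x
  proof -
    have "e' i x \<in> N i" if "i < n" for i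
    proof (cases "e i \<in> monoid_E")
      case True
      then have "e' i x = \<nu> i x" using \<open>x \<in> Q\<close> P(3) by (simp add: e'_def)
      then show ?thesis using \<nu>(1) by simp
    qed (simp add: e'_def N_def)
    then have "set (tup n e' x) \<subseteq> ?V" by (auto simp: tup_def)
    then show ?thesis by simp
  qed
  have small_V: "small (F ` {xs. length xs = n \<and> set xs \<subseteq> ?V})"
    by (intro small_list_image small_finite_UN) (simp_all add: small_N)
  show thesis
  proof (rule that)
    show "?m \<in> M" by (rule tup_comp_unary_part [OF C F e'_in])
    show "large (- range ?m)"
    proof (rule large_mono [OF large_Diff_small [OF ran small_V]])
      have "range ?m \<subseteq> range (\<lambda>x. F (tup n e x)) \<union> F ` {xs. length xs = n \<and> set xs \<subseteq> ?V}"
      proof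
        fix y assume "y \<in> range ?m"
        then obtain x where "y = ?m x" by blast
        then show "y \<in> range (\<lambda>x. F (tup n e x)) \<union> F ` {xs. length xs = n \<and> set xs \<subseteq> ?V}"
          using on_P [of x] on_Q [of x] P(3) by (cases "x \<in> P") auto
      qed
      then show "- range (\<lambda>x. F (tup n e x)) - F ` {xs. length xs = n \<and> set xs \<subseteq> ?V} \<subseteq> - range ?m"
        by blast
    qed
    show "large (?m -` {F (tup n e x)})" for x
      by (rule large_mono [OF s [of x]]) (use on_P in auto)
  qed
qed

text \<open>Without constants, the sections \<open>f(\<cdot>, k)\<close> of binary members of
  \<open>C\<close> form a preserved set closed under left multiplication by the constant
  \<open>k\<close>, so every map is such a section. A member constant on a large set stands in for
  \<open>k\<close>, so partial maps extend; hence every member of \<open>M\<close> is almost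
  surjective, as otherwise a constant would arise. The failure on \<open>monoid_E\<close>
  contradicts this.\<close>

lemma const_in: "(\<lambda>x. k) \<in> M"
proof (rule ccontr)
  assume "(\<lambda>x. k) \<notin> M"
  have no_const: "(\<lambda>x. c) \<notin> M" for c
  proof
    assume c: "(\<lambda>x. c) \<in> M"
    obtain \<sigma> where \<sigma>: "bij \<sigma>" "\<sigma> c = k" by (rule bij_moving)
    from comp_in [OF perms [OF \<sigma>(1)] c] have "(\<lambda>x. k) \<in> M" by (simp add: \<sigma>(2))
    with \<open>(\<lambda>x. k) \<notin> M\<close> show False by simp
  qed
  let ?R = "(\<lambda>f x. f x k) ` binary_part C"
  have "closed_under C ?R"
  proof (rule closed_underI)
    fix n F and gs :: "('a \<Rightarrow> 'a) list"
    assume F: "op_of n F \<in> C" and gs: "length gs = n" "set gs \<subseteq> ?R"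
    then have "\<forall>g\<in>set gs. \<exists>f. f \<in> binary_part C \<and> g = (\<lambda>x. f x k)" by blast
    from bchoice [OF this] obtain f
      where f: "\<forall>g\<in>set gs. f g \<in> binary_part C \<and> g = (\<lambda>x. f g x k)" by blast
    have "(\<lambda>x y. F (map (\<lambda>b. b x y) (map f gs))) \<in> binary_part C"
      by (rule binary_part_comp [OF C F]) (use f gs in auto)
    then have "(\<lambda>f x. f x k) (\<lambda>x y. F (map (\<lambda>b. b x y) (map f gs))) \<in> ?R" by (rule imageI)
    moreover have "map (\<lambda>b. b x k) (map f gs) = map (\<lambda>g. g x) gs" for x
    proof -
      have "f g x k = g x" if "g \<in> set gs" for g using f that by metis
      then show ?thesis by simp
    qed
    ultimately show "(\<lambda>x. F (map (\<lambda>g. g x) gs)) \<in> ?R" by (simp only:)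
  qed
  moreover have k: "(\<lambda>x. k) \<in> ?R" using snd_binary_part [OF C] by (auto simp: image_iff)
  moreover have "(\<lambda>x. x) \<in> ?R" using fst_binary_part [OF C] by (auto simp: image_iff)
  ultimately have R: "?R = UNIV"
    using no_const [of k] by (intro precomplete_closed_full [OF pre, of ?R "\<lambda>x. k" "\<lambda>x. x" "\<lambda>x. x"])
  obtain m V c where m: "m \<in> M" "large V" "large (- V)" "\<And>x. x \<in> V \<Longrightarrow> m x = c"
    by (rule partially_constant) (rule that)
  have ext: "\<exists>m\<in>M. \<forall>x\<in>A. m x = h x" if A: "large (- A)" for A h
  proof -
    have "h \<in> ?R" using R by simp
    then obtain f where f: "f \<in> binary_part C" "h = (\<lambda>x. f x k)" by blast
    \<comment> \<open>\<open>\<pi>\<close> moves \<open>A\<close> into \<open>V\<close>, where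
      \<open>m\<close> is constant, and \<open>\<sigma>\<close> adjusts this constant to
      \<open>k\<close>.\<close>
    obtain i :: "'a \<Rightarrow> 'a" where i: "bij_betw i UNIV V" by (rule large_bij [OF large_UNIV m(2)])
    then have inj_i: "inj i" by (simp add: bij_betw_def)
    have "large (- (i ` A))"
    proof (rule large_mono)
      show "large (i ` (- A))" using A large_image [OF inj_on_subset [OF inj_i]] by simp
    qed (use injD [OF inj_i] in blast)
    then obtain \<pi> where \<pi>: "bij \<pi>" "\<And>x. x \<in> A \<Longrightarrow> \<pi> x = i x"
      by (rule bij_extend_large [OF inj_on_subset [OF inj_i subset_UNIV] A]) (rule that)
    obtain \<sigma> where \<sigma>: "bij \<sigma>" "\<sigma> c = k" by (rule bij_moving)
    have "(\<lambda>x. f x (\<sigma> (m (\<pi> x)))) \<in> M"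
      by (rule binary_unary [OF C f(1) id_unary_part [OF C]
            comp_in [OF perms [OF \<sigma>(1)] comp_in [OF m(1) perms [OF \<pi>(1)]]]])
    moreover have "f x (\<sigma> (m (\<pi> x))) = h x" if "x \<in> A" for x
    proof -
      have "\<pi> x \<in> V" using \<pi>(2) [OF that] i by (auto simp: bij_betw_def)
      then show ?thesis by (simp add: m(4) \<sigma>(2) f(2))
    qed
    ultimately show ?thesis by (rule_tac bexI) auto
  qed
  have M_E: "small (- range m)" if "m \<in> M" for m
  proof (rule ccontr)
    assume "\<not> small (- range m)"
    then obtain m' where m': "m' \<in> M" "\<forall>x\<in>range m. m' x = k"
      using ext [of "range m" "\<lambda>x. k"] by (auto simp: small_def)
    from comp_in [OF m'(1) that] have "(\<lambda>x. k) \<in> M" using m'(2) by simp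
    with no_const show False by blast
  qed
  have "monoid_E \<in> listed_monoids" by (simp add: listed_monoids_def)
  then obtain n F e where F: "op_of n F \<in> C" and e: "\<And>i. i < n \<Longrightarrow> e i \<in> monoid_E"
    and h: "(\<lambda>x. F (tup n e x)) \<notin> monoid_E"
    using not_subset_Pol [OF C not_listed] by metis
  have "large (- range (\<lambda>x. F (tup n e x)))" using h by (simp add: monoid_E_eq small_def)
  moreover have gen: "g \<in> M" if "\<And>y. large (g -` {y})" for g
    by (rule generous_if_extends [OF ext that])
  ultimately obtain m where "m \<in> M" "large (- range m)"
    using fill [OF F, of e] e by metis
  with M_E show False unfolding small_def by blast
qed

text \<open>Take a failing tuple with the fewest nonconstant coordinates. If one of them were
  constant on large parts of too many fibres of the composite, regularity would give a common value,
  and restriction to its fibre would make the coordinate constant. So the nonconstant coordinates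
  can be made injective on selected points that still realise a large set of large fibres, and be
  replaced there by permutations.\<close>

lemma not_in_A:
  obtains m where "m \<in> M" "m \<notin> monoid_A"
proof -
  have "monoid_A \<in> listed_monoids" by (simp add: listed_monoids_def)
  then obtain n F a0 where F: "op_of n F \<in> C" and a0: "\<And>i. i < n \<Longrightarrow> a0 i \<in> monoid_A"
    and h0: "(\<lambda>x. F (tup n a0 x)) \<notin> monoid_A"
    using not_subset_Pol [OF C not_listed] by metis
  let ?bad = "\<lambda>a. (\<forall>i<n. a i \<in> monoid_A) \<and> (\<lambda>x. F (tup n a x)) \<notin> monoid_A"
  let ?I = "\<lambda>a :: nat \<Rightarrow> 'a \<Rightarrow> 'a. {i. i < n \<and> \<not> (\<exists>c. a i = (\<lambda>x. c))}"
  have "?bad a0" using a0 h0 by blast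
  then obtain a where a: "?bad a" "\<And>b. ?bad b \<Longrightarrow> card (?I a) \<le> card (?I b)"
    using ex_has_least_nat [of ?bad a0 "\<lambda>a. card (?I a)"] by blast
  define h where "h x = F (tup n a x)" for x
  define Y where "Y = {y. large (h -` {y})}"
  have h_eq: "h = (\<lambda>x. F (tup n a x))" by (rule ext) (rule h_def)
  have Y: "large Y" unfolding Y_def h_eq using a(1) by (simp add: monoid_A_eq small_def)
  have fin: "finite (?I a)" by simp
  \<comment> \<open>Values whose fibre contains a large part on which \<open>a i\<close> is
    constant: the obstruction to making \<open>a i\<close> injective.\<close>
  define Yi where "Yi i = {y \<in> Y. \<exists>z. large {x. h x = y \<and> a i x = z}}" for i
  have small_Yi: "small (Yi i)" if i: "i \<in> ?I a" for i
  proof (rule ccontr)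
    assume "\<not> small (Yi i)"
    then have large_Yi: "large (Yi i)" by (simp add: small_def)
    have "\<forall>y\<in>Yi i. \<exists>z. large {x. h x = y \<and> a i x = z}" by (simp add: Yi_def)
    from bchoice [OF this]
    obtain \<zeta> where \<zeta>: "\<And>y. y \<in> Yi i \<Longrightarrow> large {x. h x = y \<and> a i x = \<zeta> y}" by blast
    have "\<zeta> ` Yi i \<subseteq> {z. large (a i -` {z})}"
    proof (intro image_subsetI CollectI)
      fix y assume "y \<in> Yi i"
      then show "large (a i -` {\<zeta> y})" by (rule large_mono [OF \<zeta>]) auto
    qed
    moreover have "small {z. large (a i -` {z})}" using a(1) i by (simp add: monoid_A_eq)
    ultimately have "small (\<zeta> ` Yi i)" by (rule small_mono [rotated])
    then obtain z where z: "z \<in> \<zeta> ` Yi i" "large {y \<in> Yi i. \<zeta> y = z}"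
      using large_fibre [OF large_Yi] by metis
    then have "large (a i -` {z})" using \<open>\<zeta> ` Yi i \<subseteq> {z. large (a i -` {z})}\<close> by blast
    then obtain j where j: "bij_betw j (UNIV :: 'a set) (a i -` {z})" by (rule large_bij [OF large_UNIV])
    then have inj_j: "inj j" and aj: "a i (j x) = z" for x by (auto simp: bij_betw_def)
    \<comment> \<open>Restriction to the fibre of \<open>a i\<close> over \<open>z\<close>,
      transported to \<open>X\<close>; coordinate \<open>i\<close> becomes constant and constant
      ones remain so.\<close>
    let ?a' = "\<lambda>l x. a l (j x)"
    have "?a' l \<in> monoid_A" if "l < n" for l
    proof -
      have "large (a l -` {y})" if "large (?a' l -` {y})" for y
      proof (rule large_mono)
        show "large (j ` (?a' l -` {y}))"
          using that large_image [OF inj_on_subset [OF inj_j]] by simp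
      qed auto
      then have "{y. large (?a' l -` {y})} \<subseteq> {y. large (a l -` {y})}" by blast
      then show ?thesis using a(1) that unfolding monoid_A_eq by (auto intro: small_mono)
    qed
    moreover have "(\<lambda>x. F (tup n ?a' x)) \<notin> monoid_A"
    proof
      assume "(\<lambda>x. F (tup n ?a' x)) \<in> monoid_A"
      moreover have "tup n ?a' x = tup n a (j x)" for x by (simp add: tup_def)
      ultimately have "small {y. large ((\<lambda>x. h (j x)) -` {y})}" by (simp add: monoid_A_eq h_def)
      moreover have "{y \<in> Yi i. \<zeta> y = z} \<subseteq> {y. large ((\<lambda>x. h (j x)) -` {y})}"
      proof clarify
        fix y assume y: "y \<in> Yi i" "z = \<zeta> y"
        have "{x. h x = y \<and> a i x = \<zeta> y} \<subseteq> j ` ((\<lambda>x. h (j x)) -` {y})"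
        proof
          fix x assume x: "x \<in> {x. h x = y \<and> a i x = \<zeta> y}"
          then have "x \<in> j ` UNIV" using j y(2) by (auto simp: bij_betw_def)
          then show "x \<in> j ` ((\<lambda>x. h (j x)) -` {y})" using x by auto
        qed
        then have "large (j ` ((\<lambda>x. h (j x)) -` {y}))" by (rule large_mono [OF \<zeta> [OF y(1)]])
        then show "large ((\<lambda>x. h (j x)) -` {y})" by (rule image_large_imp_large)
      qed
      ultimately show False using z(2) small_mono unfolding small_def by blast
    qed
    ultimately have "card (?I a) \<le> card (?I ?a')" by (intro a(2)) blast
    moreover have "?I ?a' \<subset> ?I a"
    proof
      have "l \<in> ?I a" if l: "l \<in> ?I ?a'" for l
      proof -
        have "a l \<noteq> (\<lambda>x. c)" for c using l by auto
        then show ?thesis using l by blast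
      qed
      then show "?I ?a' \<subseteq> ?I a" by blast
      have "i \<notin> ?I ?a'" using aj by auto
      then show "?I ?a' \<noteq> ?I a" using i by blast
    qed
    ultimately show False using psubset_card_mono [OF fin, of "?I ?a'"] by simp
  qed
  define Y0 where "Y0 = Y - (\<Union>i\<in>?I a. Yi i)"
  have Y0: "large Y0" unfolding Y0_def
    by (rule large_Diff_small [OF Y small_finite_UN [OF fin small_Yi]])
  obtain P Q :: "'a set" where P: "large P" "large Q" "Q = - P" by (rule split_base)
  obtain \<tau> :: "'a \<Rightarrow> 'a" where \<tau>: "\<And>x. \<tau> x \<in> Y0" "\<And>y. y \<in> Y0 \<Longrightarrow> large {x \<in> P. \<tau> x = y}"
    using fibred_map [OF P(1) card_of_mono1 [OF subset_UNIV] large_nonempty [OF Y0]] by metis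
  have W: "large (h -` {\<tau> t})" for t using \<tau>(1) [of t] by (simp add: Y0_def Y_def)
  have "small {y \<in> h -` {\<tau> t}. a i y = z}" if "i \<in> ?I a" for t i z
  proof -
    have "\<tau> t \<notin> Yi i" "\<tau> t \<in> Y" using \<tau>(1) [of t] that unfolding Y0_def by blast+
    then have "small {x. h x = \<tau> t \<and> a i x = z}" unfolding Yi_def small_def by blast
    then show ?thesis by (simp add: vimage_def)
  qed
  note small = this
  obtain c where c: "\<And>t. c t \<in> h -` {\<tau> t}" "inj c" "\<And>i. i \<in> ?I a \<Longrightarrow> inj (\<lambda>t. a i (c t))"
  proof (rule inj_selection [of "\<lambda>t. h -` {\<tau> t}" "?I a" a, OF W fin])
    fix c assume "\<And>t. c t \<in> h -` {\<tau> t}" "inj c" "\<And>i. i \<in> ?I a \<Longrightarrow> inj (\<lambda>t. a i (c t))"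
    then show thesis by (rule that)
  qed (rule small)
  have "\<exists>p. p \<in> M \<and> (\<forall>t\<in>P. p (c t) = a i (c t))" if i: "i < n" for i
  proof (cases "i \<in> ?I a")
    case True
    have "large (- P)" using P by simp
    then obtain p where "bij p" "\<And>t. t \<in> P \<Longrightarrow> p (c t) = a i (c t)"
      by (rule inj_halves [OF c(2) c(3) [OF True]]) (rule that)
    then show ?thesis using perms by blast
  next
    case False
    then obtain d where "a i = (\<lambda>x. d)" using i by blast
    then show ?thesis using const_in [of d] by auto
  qed
  then obtain p where p: "\<And>i. i < n \<Longrightarrow> p i \<in> M" "\<And>i t. i < n \<Longrightarrow> t \<in> P \<Longrightarrow> p i (c t) = a i (c t)"
    by metis
  show thesis
  proof (rule that)
    show "(\<lambda>x. F (tup n p x)) \<in> M" by (rule tup_comp_unary_part [OF C F p(1)])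
    have "large ((\<lambda>x. F (tup n p x)) -` {y})" if "y \<in> Y0" for y
    proof (rule large_mono)
      show "large (c ` {x \<in> P. \<tau> x = y})"
        using \<tau>(2) [OF that] large_image [OF inj_on_subset [OF c(2)]] by simp
      show "c ` {x \<in> P. \<tau> x = y} \<subseteq> (\<lambda>x. F (tup n p x)) -` {y}"
      proof
        fix x assume "x \<in> c ` {x \<in> P. \<tau> x = y}"
        then obtain t where t: "t \<in> P" "\<tau> t = y" "x = c t" by blast
        have "tup n p x = tup n a x" by (rule tup_eqI) (use p(2) t in simp)
        then show "x \<in> (\<lambda>x. F (tup n p x)) -` {y}" using c(1) [of t] t by (simp add: h_def)
      qed
    qed
    then have "Y0 \<subseteq> {y. large ((\<lambda>x. F (tup n p x)) -` {y})}" by blast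
    then have "large {y. large ((\<lambda>x. F (tup n p x)) -` {y})}" by (rule large_mono [OF Y0])
    then show "(\<lambda>x. F (tup n p x)) \<notin> monoid_A" by (simp add: monoid_A_eq small_def)
  qed
qed

end

context infinite_base
begin

lemma subset_of_card_co_large:
  fixes N :: "'a set" and r :: "'a rel"
  assumes r: "Card_order r" "r \<le>o |UNIV :: 'a set|" and N: "r \<le>o |N|"
  obtains A where "A \<subseteq> N" "|A| =o r" "large (- A)"
proof (cases "large N")
  case True
  obtain U V where UV: "U \<union> V = N" "U \<inter> V = {}" "large U" "large V" by (rule large_split [OF True])
  obtain A where A: "A \<subseteq> U" "|A| =o r" by (rule subset_of_card [OF r(1) large_ordLeq [OF r(2) UV(3)]])
  have "large (- A)" by (rule large_mono [OF UV(4)]) (use A(1) UV(2) in blast)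
  with A UV(1) show thesis by (intro that [of A]) auto
next
  case False
  obtain A where A: "A \<subseteq> N" "|A| =o r" by (rule subset_of_card [OF r(1) N])
  have "large (UNIV - N)" by (rule large_Diff_small) (use False in \<open>simp_all add: small_def\<close>)
  then have "large (- A)" by (rule large_mono) (use A(1) in blast)
  with A show thesis by (rule that)
qed

end

section \<open>Surjections with large fibres and extension of partial maps\<close>

context permutation_clone
begin

text \<open>In \<open>m \<circ> \<pi> \<circ> m\<close> the permutation \<open>\<pi>\<close> carries
  half of the values with large fibres onto a transversal of the fibres of \<open>m\<close>, so
  every value of \<open>m\<close> gets a large fibre. The transversal is co-large since it contains
  just one point of a large fibre.\<close>

lemma generous_version:
  assumes m: "m \<in> M" "m \<notin> monoid_A"
  obtains g where "g \<in> M" "range g = range m" "\<And>y. y \<in> range g \<Longrightarrow> large (g -` {y})"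
proof -
  define Y where "Y = {y. large (m -` {y})}"
  have Y: "large Y" using m(2) by (simp add: Y_def monoid_A_eq small_def)
  have YR: "Y \<subseteq> range m"
  proof
    fix y assume "y \<in> Y"
    then have "m -` {y} \<noteq> {}" using large_nonempty by (simp add: Y_def)
    then show "y \<in> range m" by auto
  qed
  obtain Y0 Y1 where Y01: "Y0 \<union> Y1 = Y" "Y0 \<inter> Y1 = {}" "large Y0" "large Y1" by (rule large_split [OF Y])
  define T where "T = inv m ` range m"
  have m_inv: "m (inv m y) = y" if "y \<in> range m" for y using that by (rule f_inv_into_f)
  have "large (range m)" by (rule large_mono [OF Y YR])
  then have T: "large T" unfolding T_def
    by (subst large_image) (auto intro: inj_on_inverseI [of _ m] simp: f_inv_into_f)
  obtain y0 where y0: "y0 \<in> Y" using large_nonempty [OF Y] by blast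
  have "large (- T)"
  proof (rule large_mono)
    show "large (m -` {y0} - {inv m y0})"
      by (rule large_Diff_small) (use y0 in \<open>simp_all add: Y_def finite_small\<close>)
    show "m -` {y0} - {inv m y0} \<subseteq> - T"
    proof
      fix x assume x: "x \<in> m -` {y0} - {inv m y0}"
      have "m x \<in> range m" by simp
      then have "x \<noteq> inv m y" if "y \<in> range m" for y
        using x m_inv [OF that] by auto
      then show "x \<in> - T" unfolding T_def by blast
    qed
  qed
  obtain b where b: "bij_betw b Y0 T" by (rule large_bij [OF Y01(3) T])
  then have bT: "inj_on b Y0" "b ` Y0 = T" by (auto simp: bij_betw_def)
  have "large (- Y0)" by (rule large_mono [OF Y01(4)]) (use Y01(2) in blast)
  moreover have "large (- (b ` Y0))" using \<open>large (- T)\<close> bT by simp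
  ultimately obtain \<pi> where \<pi>: "bij \<pi>" "\<And>x. x \<in> Y0 \<Longrightarrow> \<pi> x = b x"
    by (rule bij_extend_large [OF bT(1)]) (rule that)
  have large_g: "large ((\<lambda>x. m (\<pi> (m x))) -` {z})" if z: "z \<in> range m" for z
  proof -
    have "inv m z \<in> b ` Y0" using z bT(2) by (simp add: T_def)
    then obtain y where y: "y \<in> Y0" "b y = inv m z" by auto
    then have "large (m -` {y})" using Y01(1) by (auto simp: Y_def)
    then show ?thesis by (rule large_mono) (use y \<pi>(2) m_inv [OF z] in auto)
  qed
  have "range (\<lambda>x. m (\<pi> (m x))) = range m"
  proof
    show "range m \<subseteq> range (\<lambda>x. m (\<pi> (m x)))"
    proof
      fix z assume "z \<in> range m"
      from large_nonempty [OF large_g [OF this]] show "z \<in> range (\<lambda>x. m (\<pi> (m x)))" by auto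
    qed
  qed auto
  with large_g show thesis
    using that [of "\<lambda>x. m (\<pi> (m x))"] comp_in [OF m(1) comp_in [OF perms [OF \<pi>(1)] m(1)]] by simp
qed

text \<open>Up to permutations on both sides, a map with large fibres and large range is determined
  by the number of values it omits.\<close>

lemma generous_in:
  assumes g: "g \<in> M" "\<And>y. y \<in> range g \<Longrightarrow> large (g -` {y})" "large (range g)"
    and g': "\<And>y. y \<in> range g' \<Longrightarrow> large (g' -` {y})" "large (range g')"
    and eq: "|- range g| =o |- range g'|"
  shows "g' \<in> M"
proof -
  obtain b where b: "bij_betw b (range g) (range g')" by (rule large_bij [OF g(3) g'(2)])
  then have b': "inj_on b (range g)" "b ` range g = range g'" by (auto simp: bij_betw_def)
  obtain \<sigma> where \<sigma>: "bij \<sigma>" "\<And>x. x \<in> range g \<Longrightarrow> \<sigma> x = b x"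
    by (rule bij_extend [OF b'(1)]) (use eq b'(2) in auto)
  have inj_\<sigma>: "inj \<sigma>" using \<sigma>(1) by (rule bij_is_inj)
  have "\<sigma> ` range g = range g'" using \<sigma>(2) b'(2) by (metis image_cong)
  have "|(\<lambda>x. \<sigma> (g x)) -` {y}| =o |g' -` {y}|" for y
  proof (cases "y \<in> range g'")
    case True
    then obtain z where z: "z \<in> range g" "y = \<sigma> z" using \<open>\<sigma> ` range g = range g'\<close> by blast
    have "(\<lambda>x. \<sigma> (g x)) -` {y} = g -` {z}" using z inj_\<sigma> by (auto simp: inj_eq)
    then show ?thesis using g(2) [OF z(1)] g'(1) [OF True] large_large_ordIso by simp
  next
    case False
    then have "(\<lambda>x. \<sigma> (g x)) -` {y} = {}" "g' -` {y} = {}"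
      using \<open>\<sigma> ` range g = range g'\<close> by auto
    then show ?thesis by (simp add: card_of_refl)
  qed
  then show ?thesis by (rule same_fibres_in [OF comp_in [OF perms [OF \<sigma>(1)] g(1)]])
qed

lemma large_range_not_A: "(m :: 'a \<Rightarrow> 'a) \<notin> monoid_A \<Longrightarrow> large (range m)"
proof -
  assume "m \<notin> monoid_A"
  then have "large {y. large (m -` {y})}" by (simp add: monoid_A_eq small_def)
  then show ?thesis
  proof (rule large_mono)
    show "{y. large (m -` {y})} \<subseteq> range m"
    proof
      fix y assume "y \<in> {y. large (m -` {y})}"
      then have "m -` {y} \<noteq> {}" using large_nonempty [of "m -` {y}"] by simp
      then show "y \<in> range m" by auto
    qed
  qed
qed

text \<open>Choose \<open>m0\<close> in the clone but outside \<open>monoid_A\<close> with the complement of its range of least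
  cardinality \<open>r\<close>. If \<open>r\<close> were not zero, an operation of the clone that does not preserve
  \<open>monoid_G r\<close> would yield such a map with a smaller complement.\<close>

lemma generous_surjections_in:
  assumes e: "\<And>y. large (e -` {y})"
  shows "e \<in> M"
proof -
  let ?K = "(\<lambda>m. |- range m| ) ` {m \<in> M. m \<notin> monoid_A}"
  have "?K \<noteq> {}" using not_in_A by blast
  moreover have "\<forall>r\<in>?K. Card_order r" by (auto intro: card_of_Card_order)
  ultimately have "\<exists>r\<in>?K. \<forall>r'\<in>?K. r \<le>o r'" by (rule exists_minim_Card_order)
  then obtain m0 where m0: "m0 \<in> M" "m0 \<notin> monoid_A" and "\<forall>r'\<in>?K. |- range m0| \<le>o r'" by auto
  then have min: "|- range m0| \<le>o |- range m|" if "m \<in> M" "m \<notin> monoid_A" for m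
    using that by simp
  obtain g0 where g0: "g0 \<in> M" "range g0 = range m0" "\<And>y. y \<in> range g0 \<Longrightarrow> large (g0 -` {y})"
    by (rule generous_version [OF m0]) (rule that)
  have large_g0: "large (range g0)" unfolding g0(2) by (rule large_range_not_A [OF m0(2)])
  have "- range m0 = {}"
  proof (rule ccontr)
    assume ne: "- range m0 \<noteq> {}"
    define r where "r = |- range m0|"
    have r: "Card_order r" "r \<le>o |UNIV :: 'a set|"
      unfolding r_def using card_of_Card_order card_of_mono1 [OF subset_UNIV] by simp_all
    have r1: "cone \<le>o r" unfolding cone_def r_def by (rule card_of_singl_ordLeq [OF ne])
    have "monoid_G r \<in> listed_monoids" unfolding listed_monoids_def using r r1 by blast
    then obtain n F g where F: "op_of n F \<in> C" and g: "\<And>i. i < n \<Longrightarrow> g i \<in> monoid_G r"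
      and h: "(\<lambda>x. F (tup n g x)) \<notin> monoid_G r"
      using not_subset_Pol [OF C not_listed] by metis
    define h where "h x = F (tup n g x)" for x
    have "h \<notin> monoid_G r" using h by (simp add: h_def [abs_def])
    then obtain A where A: "|A| =o r" "\<not> r \<le>o |- (h ` (- A))|" by (auto simp: monoid_G_def)
    have less: "|- (h ` (- A))| <o r"
      using A(2) not_ordLeq_iff_ordLess [OF card_of_Well_order card_order_on_well_order_on [OF r(1)]] by blast
    have "small (- (h ` (- A)))"
      unfolding small_iff_ordLess by (rule ordLess_ordLeq_trans [OF less r(2)])
    then have large_hA: "large (h ` (- A))"
      using large_Diff_small [OF large_UNIV, of "- (h ` (- A))"] by (simp add: Diff_eq)
    then have large_A: "large (- A)" by (rule image_large_imp_large)
    \<comment> \<open>By \<open>generous_in\<close>, maps with large fibres and large range that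
      omit exactly \<open>r\<close> values are in \<open>M\<close>. So \<open>N i\<close> of exactly
      this size is chosen among the values that \<open>g i\<close> omits off \<open>A\<close>, and
      \<open>e i\<close> will attain everything else.\<close>
    have "\<exists>N. N \<subseteq> - (g i ` (- A)) \<and> |N| =o r \<and> large (- N)" if "i < n" for i
    proof -
      have "r \<le>o |- (g i ` (- A))|" using g [OF that] A(1) by (simp add: monoid_G_def)
      then show ?thesis using subset_of_card_co_large [OF r] by metis
    qed
    then obtain N where N: "\<And>i. i < n \<Longrightarrow> N i \<subseteq> - (g i ` (- A))"
      "\<And>i. i < n \<Longrightarrow> |N i| =o r" "\<And>i. i < n \<Longrightarrow> large (- N i)" by metis
    obtain P Q :: "'a set" where P: "large P" "large Q" "Q = - P" by (rule split_base)
    obtain s :: "'a \<Rightarrow> 'a" where s: "\<And>x. s x \<in> - A" "\<And>y. y \<in> - A \<Longrightarrow> large {x \<in> P. s x = y}"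
      by (rule fibred_map [OF P(1) card_of_mono1 [OF subset_UNIV] large_nonempty [OF large_A]])
        (rule that)
    have "\<exists>\<nu> :: 'a \<Rightarrow> 'a. (\<forall>x. \<nu> x \<in> - N i) \<and> (\<forall>y\<in>- N i. large {x \<in> Q. \<nu> x = y})" if i: "i < n" for i
    proof -
      obtain \<nu> :: "'a \<Rightarrow> 'a" where "\<And>x. \<nu> x \<in> - N i" "\<And>y. y \<in> - N i \<Longrightarrow> large {x \<in> Q. \<nu> x = y}"
        by (rule fibred_map [OF P(2) card_of_mono1 [OF subset_UNIV] large_nonempty [OF N(3) [OF i]]])
          (rule that)
      then show ?thesis by blast
    qed
    then obtain \<nu> :: "nat \<Rightarrow> 'a \<Rightarrow> 'a" where \<nu>: "\<And>i x. i < n \<Longrightarrow> \<nu> i x \<in> - N i"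
      "\<And>i y. i < n \<Longrightarrow> y \<in> - N i \<Longrightarrow> large {x \<in> Q. \<nu> i x = y}" by metis
    define e where "e i x = (if x \<in> P then g i (s x) else \<nu> i x)" for i x
    have e_in: "e i \<in> M" if i: "i < n" for i
    proof -
      have fibre: "large (e i -` {y})" if "y \<in> - N i" for y
        by (rule large_mono [OF \<nu>(2) [OF i that]]) (use P(3) in \<open>auto simp: e_def\<close>)
      have sub: "e i x \<in> - N i" for x
      proof (cases "x \<in> P")
        case True
        have "g i (s x) \<in> g i ` (- A)" using s(1) by blast
        then show ?thesis using True N(1) [OF i] by (auto simp: e_def)
      next
        case False
        then show ?thesis using \<nu>(1) [OF i] by (simp add: e_def)
      qed
      have ran: "range (e i) = - N i"
      proof
        show "range (e i) \<subseteq> - N i" using sub by blast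
        show "- N i \<subseteq> range (e i)"
        proof
          fix y assume "y \<in> - N i"
          from large_nonempty [OF fibre [OF this]] show "y \<in> range (e i)" by auto
        qed
      qed
      show ?thesis
      proof (rule generous_in [OF g0(1,3) large_g0])
        show "large (e i -` {y})" if "y \<in> range (e i)" for y using fibre that ran by blast
        show "large (range (e i))" unfolding ran by (rule N(3) [OF i])
        have "r =o |N i|" by (rule ordIso_symmetric [OF N(2) [OF i]])
        then show "|- range g0| =o |- range (e i)|" unfolding ran g0(2) r_def by simp
      qed
    qed
    have large_m: "large ((\<lambda>x. F (tup n e x)) -` {y})" if y: "y \<in> h ` (- A)" for y
    proof -
      obtain x where x: "x \<in> - A" "y = h x" using y by blast
      show ?thesis
      proof (rule large_mono [OF s(2) [OF x(1)]])
        have "tup n e t = tup n g x" if "t \<in> P" "s t = x" for t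
          by (rule tup_eqI) (use that in \<open>simp add: e_def\<close>)
        then show "{t \<in> P. s t = x} \<subseteq> (\<lambda>x. F (tup n e x)) -` {y}" using x(2) by (auto simp: h_def)
      qed
    qed
    have m_in: "(\<lambda>x. F (tup n e x)) \<in> M" by (rule tup_comp_unary_part [OF C F e_in])
    moreover have "large {y. large ((\<lambda>x. F (tup n e x)) -` {y})}"
      by (rule large_mono [OF large_hA]) (use large_m in blast)
    then have "(\<lambda>x. F (tup n e x)) \<notin> monoid_A" by (simp add: monoid_A_eq small_def)
    ultimately have "r \<le>o |- range (\<lambda>x. F (tup n e x))|" unfolding r_def by (rule min)
    moreover have "- range (\<lambda>x. F (tup n e x)) \<subseteq> - (h ` (- A))"
    proof (intro subsetI ComplI)
      fix y assume y: "y \<in> - range (\<lambda>x. F (tup n e x))" "y \<in> h ` (- A)"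
      obtain x where "F (tup n e x) = y" using large_nonempty [OF large_m [OF y(2)]] by auto
      then have "y \<in> range (\<lambda>x. F (tup n e x))" by blast
      then show False using y(1) by blast
    qed
    ultimately have "r \<le>o |- (h ` (- A))|" using card_of_mono1 ordLeq_transitive by blast
    then show False using A(2) by blast
  qed
  then have ran: "range g0 = UNIV" using g0(2) by auto
  have "large (g0 -` {y})" for y using g0(3) [of y] ran by simp
  then have "|g0 -` {y}| =o |e -` {y}|" for y using e large_large_ordIso by blast
  then show ?thesis by (rule same_fibres_in [OF g0(1)])
qed

text \<open>Off \<open>A\<close> there is room to take every value on a large set, so the extension
  can be a surjection with large fibres.\<close>

lemma extends:
  assumes A: "large (- A)"
  shows "\<exists>m\<in>M. \<forall>x\<in>A. m x = h x"
proof -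
  obtain s :: "'a \<Rightarrow> 'a" where s: "\<And>y. large {x \<in> - A. s x = y}"
    by (rule fibred_onto [OF A]) (rule that)
  let ?e = "\<lambda>x. if x \<in> A then h x else s x"
  have "?e \<in> M"
  proof (rule generous_surjections_in)
    fix y show "large (?e -` {y})" by (rule large_mono [OF s [of y]]) auto
  qed
  then show ?thesis by (rule rev_bexI) simp
qed

text \<open>The failure on \<open>monoid_F\<close> gives a composite neither constant nor almost
  surjective; \<open>fill\<close> turns it into a member with two large fibres that omits a large
  set, so a two-valued map can be prescribed on its range. Maps with the same two values and large
  fibres differ by a permutation.\<close>

lemma two_valued_in:
  assumes P: "large P" "large (- P)" and ab: "a \<noteq> b"
  shows "(\<lambda>x. if x \<in> P then a else b) \<in> M"
proof -
  have "monoid_F \<in> listed_monoids" by (simp add: listed_monoids_def)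
  then obtain n F e where F: "op_of n F \<in> C" and e: "\<And>i. i < n \<Longrightarrow> e i \<in> monoid_F"
    and h: "(\<lambda>x. F (tup n e x)) \<notin> monoid_F"
    using not_subset_Pol [OF C not_listed] by metis
  have e': "e i \<in> monoid_E \<or> e i \<in> M \<and> (\<exists>c. e i = (\<lambda>x. c))" if "i < n" for i
    using e [OF that] const_in by (auto simp: monoid_F_eq)
  have ran: "large (- range (\<lambda>x. F (tup n e x)))"
    using h by (simp add: monoid_F_eq monoid_E_eq small_def)
  obtain m where m: "m \<in> M" "large (- range m)" "\<And>x. large (m -` {F (tup n e x)})"
  proof (rule fill [OF F _ _ ran])
    show "e i \<in> monoid_E \<or> e i \<in> M \<and> (\<exists>c. e i = (\<lambda>x. c))" if "i < n" for i by (rule e' [OF that])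
    show "g \<in> M" if "\<And>y. large (g -` {y})" for g by (rule generous_surjections_in [OF that])
    fix m assume "m \<in> M" "large (- range m)" "\<And>x. large (m -` {F (tup n e x)})"
    then show thesis by (rule that)
  qed
  have "\<exists>x0 x1. F (tup n e x0) \<noteq> F (tup n e x1)"
  proof (rule ccontr)
    assume "\<not> ?thesis"
    then have "(\<lambda>x. F (tup n e x)) = (\<lambda>x. F (tup n e undefined))" by blast
    then show False using h by (auto simp: monoid_F_eq)
  qed
  then obtain x0 x1 where x01: "F (tup n e x0) \<noteq> F (tup n e x1)" by blast
  obtain k where k: "k \<in> M" "\<forall>y\<in>range m. k y = (if y = F (tup n e x0) then a else b)"
    using extends [OF m(2), of "\<lambda>y. if y = F (tup n e x0) then a else b"] by blast
  have km: "k (m x) = (if m x = F (tup n e x0) then a else b)" for x using k(2) by blast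
  have "|(\<lambda>x. k (m x)) -` {y}| =o |(\<lambda>x. if x \<in> P then a else b) -` {y}|" for y
  proof -
    consider "y = a" | "y = b" | "y \<noteq> a" "y \<noteq> b" by blast
    then show ?thesis
    proof cases
      case 1
      have "large ((\<lambda>x. k (m x)) -` {y})"
        by (rule large_mono [OF m(3) [of x0]]) (use 1 km in auto)
      moreover have "large ((\<lambda>x. if x \<in> P then a else b) -` {y})"
        by (rule large_mono [OF P(1)]) (use 1 in auto)
      ultimately show ?thesis by (rule large_large_ordIso)
    next
      case 2
      have "large ((\<lambda>x. k (m x)) -` {y})"
        by (rule large_mono [OF m(3) [of x1]]) (use 2 km x01 in auto)
      moreover have "large ((\<lambda>x. if x \<in> P then a else b) -` {y})"
        by (rule large_mono [OF P(2)]) (use 2 in auto)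
      ultimately show ?thesis by (rule large_large_ordIso)
    next
      case 3
      then have "(\<lambda>x. k (m x)) -` {y} = {}" "(\<lambda>x. if x \<in> P then a else b) -` {y} = {}"
        using km by (auto split: if_splits)
      then show ?thesis by (simp add: card_of_refl)
    qed
  qed
  then show ?thesis by (rule same_fibres_in [OF comp_in [OF k(1) m(1)]])
qed

text \<open>\<open>t\<close> recognises the points of \<open>P\<close> and omits a large set, so any
  decoding on its range extends to a member of \<open>M\<close>. Moving the complement of the large
  fibre of \<open>r\<close> into \<open>P\<close> lets a decoding recover \<open>r\<close>.\<close>

lemma large_fibre_in:
  assumes t: "t \<in> M" "inj_on t P" "t ` P \<inter> t ` (- P) = {}" "large (- range t)" "large P" "large (- P)"
    and r: "large (r -` {z})"
  shows "r \<in> M"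
proof -
  let ?G = "r -` {z}"
  obtain i :: "'a \<Rightarrow> 'a" where i: "bij_betw i UNIV P" by (rule large_bij [OF large_UNIV t(5)])
  then have inj_i: "inj i" and iP: "\<And>x. i x \<in> P" by (auto simp: bij_betw_def)
  have "large (- (- ?G))" using r by simp
  moreover have "large (- (i ` (- ?G)))" by (rule large_mono [OF t(6)]) (use iP in blast)
  ultimately obtain \<pi> where \<pi>: "bij \<pi>" "\<And>x. x \<in> - ?G \<Longrightarrow> \<pi> x = i x"
    "\<And>x. x \<notin> - ?G \<Longrightarrow> \<pi> x \<notin> i ` (- ?G)"
    by (rule bij_extend_large [OF inj_on_subset [OF inj_i subset_UNIV]]) (rule that)
  \<comment> \<open>The default \<open>z\<close> is the value on the large fibre. Points of that
    fibre may also be moved into \<open>P\<close>, but never onto the representatives of other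
    points.\<close>
  define k where "k y = (if \<exists>x\<in>- ?G. y = t (i x) then r (SOME x. x \<in> - ?G \<and> y = t (i x)) else z)" for y
  have ti: "x = x'" if "t (i x) = t (i x')" for x x'
    using inj_onD [OF t(2) that iP iP] inj_i by (simp add: inj_eq)
  have krt: "k (t (\<pi> x)) = r x" for x
  proof (cases "x \<in> ?G")
    case False
    then have eq: "t (\<pi> x) = t (i x)" using \<pi>(2) by simp
    have "(SOME x'. x' \<in> - ?G \<and> t (i x) = t (i x')) = x"
      by (rule some_equality) (use False ti in auto)
    then show ?thesis using False eq by (auto simp: k_def)
  next
    case True
    have "t (\<pi> x) \<noteq> t (i x')" if "x' \<in> - ?G" for x'
    proof
      assume eq: "t (\<pi> x) = t (i x')"
      have "\<pi> x \<noteq> i x'" using \<pi>(3) [of x] True that by auto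
      show False
      proof (cases "\<pi> x \<in> P")
        case True
        with eq \<open>\<pi> x \<noteq> i x'\<close> show False using inj_onD [OF t(2) eq True iP] by simp
      next
        case False
        then have "t (\<pi> x) \<in> t ` (- P)" by blast
        moreover have "t (\<pi> x) \<in> t ` P" using eq iP by simp
        ultimately show False using t(3) by blast
      qed
    qed
    then show ?thesis using True by (auto simp: k_def)
  qed
  obtain k' where k': "k' \<in> M" "\<forall>y\<in>range t. k' y = k y" using extends [OF t(4)] by metis
  have "k' (t (\<pi> x)) = r x" for x using k'(2) krt by simp
  then show ?thesis using comp_in [OF k'(1) comp_in [OF t(1) perms [OF \<pi>(1)]]] by simp
qed

end

section \<open>Almost unary operations and the final contradiction\<close>

definition hyperplane :: "nat \<Rightarrow> nat \<Rightarrow> 'a \<Rightarrow> 'a list set" where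
  "hyperplane n j c = {xs. length xs = n \<and> xs ! j = c}"

definition almost_unary_ops :: "'a operation set" where
  "almost_unary_ops = {op_of n F | n F. \<exists>j<n. \<forall>c. small (F ` hyperplane n j c)}"

lemma op_of_almost_unary_iff:
  "op_of n F \<in> almost_unary_ops \<longleftrightarrow> (\<exists>j<n. \<forall>c. small (F ` hyperplane n j c))"
proof
  assume "op_of n F \<in> almost_unary_ops"
  then obtain n' F' j where eq: "op_of n F = op_of n' F'" and j: "j < n'"
    and F': "\<And>c. small (F' ` hyperplane n' j c)" unfolding almost_unary_ops_def by blast
  then have "n = n'" by (metis fst_op_of)
  moreover have "F ` hyperplane n j c = F' ` hyperplane n' j c" for c
    using \<open>n = n'\<close> op_of_eqD [OF eq [unfolded \<open>n = n'\<close> [symmetric]]]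
    by (intro image_cong) (auto simp: hyperplane_def)
  ultimately show "\<exists>j<n. \<forall>c. small (F ` hyperplane n j c)" using j F' by auto
next
  assume "\<exists>j<n. \<forall>c. small (F ` hyperplane n j c)"
  then show "op_of n F \<in> almost_unary_ops" unfolding almost_unary_ops_def by blast
qed

context regular_base
begin

text \<open>Fixing a suitable coordinate leaves few values of the decisive inner operation, and each
  of these leaves few values of the outer one; regularity bounds the union.\<close>

lemma is_clone_almost_unary: "is_clone (almost_unary_ops :: 'a operation set)"
proof (rule is_cloneI)
  show "(almost_unary_ops :: 'a operation set) \<subseteq> all_ops"
  proof
    fix f :: "'a operation" assume "f \<in> almost_unary_ops"
    then obtain n F j where f: "f = op_of n F" and "j < n" unfolding almost_unary_ops_def by blast
    then have "n \<ge> 1" by simp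
    then show "f \<in> all_ops" unfolding f by (rule op_of_all_ops)
  qed
  fix n k :: nat assume k: "k < n"
  have "small ((\<lambda>xs :: 'a list. xs ! k) ` hyperplane n k c)" for c
    by (rule small_mono [of "{c}"]) (auto simp: hyperplane_def finite_small)
  then show "op_of n (\<lambda>xs :: 'a list. xs ! k) \<in> almost_unary_ops"
    unfolding op_of_almost_unary_iff using k by blast
next
  fix n m and F :: "'a list \<Rightarrow> 'a" and Gs :: "('a list \<Rightarrow> 'a) list"
  assume "op_of n F \<in> almost_unary_ops" and len: "length Gs = n"
    and Gs: "\<And>G. G \<in> set Gs \<Longrightarrow> op_of m G \<in> almost_unary_ops"
  then obtain j where j: "j < n" "\<And>c. small (F ` hyperplane n j c)"
    unfolding op_of_almost_unary_iff by blast
  have "op_of m (Gs ! j) \<in> almost_unary_ops" using Gs j(1) len by simp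
  then obtain l where l: "l < m" "\<And>c. small ((Gs ! j) ` hyperplane m l c)"
    unfolding op_of_almost_unary_iff by blast
  have "small ((\<lambda>xs. F (map (\<lambda>G. G xs) Gs)) ` hyperplane m l c)" for c
  proof (rule small_mono [OF small_UN [OF l(2) [of c] j(2)]])
    show "(\<lambda>xs. F (map (\<lambda>G. G xs) Gs)) ` hyperplane m l c
      \<subseteq> (\<Union>d\<in>(Gs ! j) ` hyperplane m l c. F ` hyperplane n j d)"
    proof
      fix y assume "y \<in> (\<lambda>xs. F (map (\<lambda>G. G xs) Gs)) ` hyperplane m l c"
      then obtain xs where xs: "xs \<in> hyperplane m l c" "y = F (map (\<lambda>G. G xs) Gs)" by blast
      have "map (\<lambda>G. G xs) Gs \<in> hyperplane n j ((Gs ! j) xs)"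
        using len j(1) by (simp add: hyperplane_def)
      then show "y \<in> (\<Union>d\<in>(Gs ! j) ` hyperplane m l c. F ` hyperplane n j d)" using xs by blast
    qed
  qed
  then show "op_of m (\<lambda>xs. F (map (\<lambda>G. G xs) Gs)) \<in> almost_unary_ops"
    unfolding op_of_almost_unary_iff using l(1) by blast
qed

lemma unary_almost_unary: "unary_part (almost_unary_ops :: 'a operation set) = UNIV"
proof -
  have "small ((\<lambda>xs :: 'a list. g (hd xs)) ` hyperplane 1 0 c)" for c and g :: "'a \<Rightarrow> 'a"
    by (rule small_mono [of "{g c}"]) (auto simp: hyperplane_def finite_small length_Suc_conv)
  then show ?thesis by (auto simp: unary_part_def op_of_almost_unary_iff)
qed

lemma almost_unary_proper: "(almost_unary_ops :: 'a operation set) \<noteq> all_ops"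
proof
  assume all: "(almost_unary_ops :: 'a operation set) = all_ops"
  obtain pair :: "'a \<times> 'a \<Rightarrow> 'a" where pair: "bij pair" by (rule pairing_exists)
  have pair_eq: "pair p = pair q \<longleftrightarrow> p = q" for p q using pair by (simp add: bij_is_inj inj_eq)
  let ?F = "\<lambda>xs :: 'a list. pair (xs ! 0, xs ! 1)"
  have "op_of 2 ?F \<in> almost_unary_ops" unfolding all by (rule op_of_all_ops) simp
  then obtain j where j: "j < 2" "small (?F ` hyperplane 2 j undefined)"
    unfolding op_of_almost_unary_iff by blast
  have "large (range (\<lambda>y. ?F (if j = 0 then [undefined, y] else [y, undefined])))"
    by (subst large_image) (auto simp: inj_on_def pair_eq)
  then have "large (?F ` hyperplane 2 j undefined)"
    by (rule large_mono) (use j(1) in \<open>auto simp: hyperplane_def less_2_cases_iff\<close>)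
  then show False using j(2) by (simp add: small_def)
qed

end

context permutation_clone
begin

text \<open>Otherwise maximality would identify \<open>C\<close> with the clone of almost unary
  operations, which contains every unary map.\<close>

lemma not_almost_unary:
  obtains n F c where "op_of n F \<in> C" "n \<ge> 1" "\<And>j. j < n \<Longrightarrow> large (F ` hyperplane n j (c j))"
proof -
  have "\<not> C \<subseteq> almost_unary_ops"
  proof
    assume "C \<subseteq> almost_unary_ops"
    then have "almost_unary_ops = C"
      using precompleteD [OF pre is_clone_almost_unary] almost_unary_proper by blast
    then show False using not_full unary_almost_unary by simp
  qed
  then obtain f where f: "f \<in> C" "f \<notin> almost_unary_ops" by blast
  then have "f \<in> all_ops" using clone_sub [OF C] by blast
  then obtain n F where nF: "n \<ge> 1" "f = op_of n F" by (rule all_ops_cases)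
  then have "\<forall>j<n. \<exists>c. large (F ` hyperplane n j c)"
    using f(2) by (auto simp: op_of_almost_unary_iff small_def)
  then obtain c where "\<And>j. j < n \<Longrightarrow> large (F ` hyperplane n j (c j))" by metis
  then show thesis using that f(1) nF by blast
qed

text \<open>Coordinate \<open>j\<close> is \<open>u\<close> on \<open>P\<close> and \<open>v\<close>
  off \<open>P\<close>, a two-valued map, and the others extend partial maps; values from the
  difference then occur on \<open>P\<close> only. Half of the difference is set aside to keep the
  range co-large.\<close>

lemma separating_case_a:
  assumes F: "op_of n F \<in> C" and j: "j < n"
    and diff: "large (F ` hyperplane n j u - F ` hyperplane n j v)"
    and r: "large (r -` {z})"
  shows "r \<in> M"
proof -
  obtain S0 S1 where S: "S0 \<union> S1 = F ` hyperplane n j u - F ` hyperplane n j v" "S0 \<inter> S1 = {}"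
    "large S0" "large S1" by (rule large_split [OF diff])
  have "u \<noteq> v" using diff large_nonempty by auto
  obtain P Q :: "'a set" where P: "large P" "large Q" "Q = - P" by (rule split_base)
  obtain b where b: "bij_betw b P S0" by (rule large_bij [OF P(1) S(3)])
  have "\<exists>xs. xs \<in> hyperplane n j u \<and> F xs = b x" if "x \<in> P" for x
  proof -
    have "b x \<in> F ` hyperplane n j u" using b that S(1) by (auto simp: bij_betw_def)
    then show ?thesis by auto
  qed
  then obtain xs where xs: "\<And>x. x \<in> P \<Longrightarrow> xs x \<in> hyperplane n j u" "\<And>x. x \<in> P \<Longrightarrow> F (xs x) = b x"
    by metis
  have "\<exists>p\<in>M. \<forall>x\<in>P. p x = xs x ! i" for i using extends [of P] P by simp
  then obtain p where p: "\<And>i. p i \<in> M" "\<And>i x. x \<in> P \<Longrightarrow> p i x = xs x ! i" by metis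
  define p' where "p' = p (j := \<lambda>x. if x \<in> P then u else v)"
  have p'_in: "p' i \<in> M" for i
    using p(1) two_valued_in [OF P(1) _ \<open>u \<noteq> v\<close>] P by (simp add: p'_def)
  have on_P: "F (tup n p' x) = b x" if "x \<in> P" for x
  proof -
    have "tup n p' x = xs x"
    proof (rule tup_eq_listI)
      show "length (xs x) = n" using xs(1) [OF that] by (simp add: hyperplane_def)
      show "p' i x = xs x ! i" if "i < n" for i
        using p(2) [OF \<open>x \<in> P\<close>] xs(1) [OF \<open>x \<in> P\<close>] \<open>x \<in> P\<close> by (simp add: p'_def hyperplane_def)
    qed
    then show ?thesis using xs(2) [OF that] by simp
  qed
  have on_Q: "F (tup n p' x) \<in> F ` hyperplane n j v" if "x \<notin> P" for x
    using that j by (intro imageI) (simp add: hyperplane_def p'_def)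
  have S0: "b x \<in> S0" if "x \<in> P" for x using b that by (auto simp: bij_betw_def)
  show ?thesis
  proof (rule large_fibre_in [OF _ _ _ _ P(1) _ r])
    show "(\<lambda>x. F (tup n p' x)) \<in> M" by (rule tup_comp_unary_part [OF C F p'_in])
    show "inj_on (\<lambda>x. F (tup n p' x)) P"
      using b on_P by (simp add: bij_betw_def inj_on_def)
    show "(\<lambda>x. F (tup n p' x)) ` P \<inter> (\<lambda>x. F (tup n p' x)) ` (- P) = {}"
    proof (rule equals0I)
      fix y assume "y \<in> (\<lambda>x. F (tup n p' x)) ` P \<inter> (\<lambda>x. F (tup n p' x)) ` (- P)"
      then have "y \<in> S0" "y \<in> F ` hyperplane n j v" using on_P S0 on_Q by auto
      then show False using S(1) by blast
    qed
    show "large (- range (\<lambda>x. F (tup n p' x)))"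
    proof (rule large_mono [OF S(4)], intro subsetI ComplI)
      fix y assume y: "y \<in> S1" "y \<in> range (\<lambda>x. F (tup n p' x))"
      then obtain x where x: "y = F (tup n p' x)" by blast
      show False
        using on_P [of x] S0 [of x] on_Q [of x] S(1,2) y(1) x by (cases "x \<in> P") auto
    qed
    show "large (- P)" using P by simp
  qed
qed

text \<open>Here \<open>F\<close> takes almost the same values on parallel hyperplanes. A set \<open>T\<close> of values can therefore
  be avoided on tuples that exhaust every coordinate: on \<open>Q\<close> the arguments are surjections with
  large fibres although the values stay outside \<open>T\<close>, and on \<open>P\<close> the values are distinct in \<open>T\<close>.\<close>

lemma separating_case_b:
  assumes F: "op_of n F \<in> C" "n \<ge> 1" and c: "\<And>j. j < n \<Longrightarrow> large (F ` hyperplane n j (c j))"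
    and diff: "\<And>j u v. j < n \<Longrightarrow> small (F ` hyperplane n j u - F ` hyperplane n j v)"
    and r: "large (r -` {z})"
  shows "r \<in> M"
proof -
  define L where "L i = F ` hyperplane n i (c i)" for i
  have n0: "0 < n" using F(2) by simp
  have large_L0: "large (L 0)" unfolding L_def by (rule c [OF n0])
  obtain T where T: "T \<subseteq> L 0" "large T" "\<And>i. i < n \<Longrightarrow> large (L i - T)"
  proof (rule large_subset_avoiding [of "L ` {..<n}" "L 0"])
    show "large (L 0)" by (rule large_L0)
    show "large S" if "S \<in> L ` {..<n}" for S using that c by (auto simp: L_def)
  qed (use that in auto)
  obtain S0 S1 where S: "S0 \<union> S1 = T" "S0 \<inter> S1 = {}" "large S0" "large S1" by (rule large_split [OF T(2)])
  \<comment> \<open>\<open>L i\<close> lies almost entirely among the values on every parallel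
    hyperplane, while a large part of it avoids \<open>T\<close>.\<close>
  have "\<exists>ys. ys \<in> hyperplane n i x \<and> F ys \<notin> T" if i: "i < n" for i x
  proof -
    have "small (L i - F ` hyperplane n i x)" unfolding L_def by (rule diff [OF i])
    with T(3) [OF i] obtain y where "y \<in> L i - T" "y \<notin> L i - F ` hyperplane n i x"
      by (rule large_obtain)
    then show ?thesis by blast
  qed
  then obtain \<rho> where \<rho>: "\<And>i x. i < n \<Longrightarrow> \<rho> i x \<in> hyperplane n i x"
    "\<And>i x. i < n \<Longrightarrow> F (\<rho> i x) \<notin> T" by metis
  have "|{..<n}| \<le>o |UNIV :: 'a set|"
    by (rule ordLess_imp_ordLeq [OF finite_card_ordLess]) (simp_all add: infinite_base)
  moreover have "{..<n} \<noteq> {}" using n0 by auto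
  ultimately obtain tag :: "'a \<Rightarrow> nat" where tag: "\<And>x. tag x \<in> {..<n}"
    "\<And>i. i \<in> {..<n} \<Longrightarrow> large {x \<in> UNIV. tag x = i}"
    by (rule fibred_map [OF large_UNIV]) (rule that)
  obtain P Q :: "'a set" where P: "large P" "large Q" "Q = - P" by (rule split_base)
  obtain s :: "'a \<Rightarrow> 'a" where s: "\<And>y. large {x \<in> Q. s x = y}"
    by (rule fibred_onto [OF P(2)]) (rule that)
  obtain pair :: "'a \<times> 'a \<Rightarrow> 'a" where pair: "bij pair" by (rule pairing_exists)
  have inv_pair: "inv pair (pair p) = p" for p using pair by (simp add: bij_is_inj)
  obtain b where b: "bij_betw b P S0" by (rule large_bij [OF P(1) S(3)])
  have S0: "b x \<in> S0" if "x \<in> P" for x using b that by (auto simp: bij_betw_def)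
  have "\<exists>xs. length xs = n \<and> F xs = b x" if "x \<in> P" for x
  proof -
    have "b x \<in> L 0" using S0 [OF that] S(1) T(1) by blast
    then show ?thesis by (auto simp: L_def hyperplane_def)
  qed
  then obtain xs where xs: "\<And>x. x \<in> P \<Longrightarrow> length (xs x) = n" "\<And>x. x \<in> P \<Longrightarrow> F (xs x) = b x"
    by metis
  \<comment> \<open>\<open>s x\<close> codes a coordinate, through \<open>tag\<close>, and a value
    which that coordinate shall take; each such demand recurs on a large subset of
    \<open>Q\<close>.\<close>
  define q where "q x = \<rho> (tag (fst (inv pair (s x)))) (snd (inv pair (s x)))" for x
  have q_len: "length (q x) = n" for x
    using \<rho>(1) tag(1) by (auto simp: q_def hyperplane_def)
  have q_T: "F (q x) \<notin> T" for x using \<rho>(2) tag(1) by (simp add: q_def)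
  define p where "p i x = (if x \<in> P then xs x else q x) ! i" for i x
  have p_in: "p i \<in> M" if i: "i < n" for i
  proof (rule generous_surjections_in)
    fix y
    obtain a where a: "tag a = i" using large_nonempty [OF tag(2) [of i]] i by auto
    show "large (p i -` {y})"
    proof (rule large_mono [OF s [of "pair (a, y)"]])
      have "q x ! i = y" if "s x = pair (a, y)" for x
        using \<rho>(1) [OF i, of y] that by (simp add: q_def inv_pair a hyperplane_def)
      then show "{x \<in> Q. s x = pair (a, y)} \<subseteq> p i -` {y}" using P(3) by (auto simp: p_def)
    qed
  qed
  have tup_p: "tup n p x = (if x \<in> P then xs x else q x)" for x
    by (rule tup_eq_listI) (use xs(1) q_len in \<open>auto simp: p_def\<close>)
  have on_P: "F (tup n p x) = b x" if "x \<in> P" for x using xs(2) that by (simp add: tup_p)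
  have on_Q: "F (tup n p x) \<notin> T" if "x \<notin> P" for x using q_T that by (simp add: tup_p)
  show ?thesis
  proof (rule large_fibre_in [OF _ _ _ _ P(1) _ r])
    show "(\<lambda>x. F (tup n p x)) \<in> M" by (rule tup_comp_unary_part [OF C F(1) p_in])
    show "inj_on (\<lambda>x. F (tup n p x)) P"
      using b on_P by (simp add: bij_betw_def inj_on_def)
    show "(\<lambda>x. F (tup n p x)) ` P \<inter> (\<lambda>x. F (tup n p x)) ` (- P) = {}"
    proof (rule equals0I)
      fix y assume "y \<in> (\<lambda>x. F (tup n p x)) ` P \<inter> (\<lambda>x. F (tup n p x)) ` (- P)"
      then have "y \<in> S0" "y \<notin> T" using on_P S0 on_Q by auto
      then show False using S(1) by blast
    qed
    show "large (- range (\<lambda>x. F (tup n p x)))"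
    proof (rule large_mono [OF S(4)], intro subsetI ComplI)
      fix y assume y: "y \<in> S1" "y \<in> range (\<lambda>x. F (tup n p x))"
      then obtain x where x: "y = F (tup n p x)" by blast
      show False
        using on_P [of x] S0 [of x] on_Q [of x] S(1,2) y(1) x by (cases "x \<in> P") auto
    qed
    show "large (- P)" using P by simp
  qed
qed

text \<open>Distinct values are chosen from the images of the \<open>n\<close> hyperplanes. The
  tuples realising them have coordinate \<open>i\<close> equal to \<open>c i\<close> on a large set,
  so each coordinate map is in \<open>M\<close>. This gives an injection in \<open>M\<close> with
  co-large range, and extensions of its inverse yield every map.\<close>

theorem contradiction: False
proof -
  obtain n F c where F: "op_of n F \<in> C" "n \<ge> 1" and c: "\<And>j. j < n \<Longrightarrow> large (F ` hyperplane n j (c j))"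
    by (rule not_almost_unary) (rule that)
  have fibre_in: "r \<in> M" if r: "large (r -` {z})" for r z
  proof (cases "\<exists>j u v. j < n \<and> large (F ` hyperplane n j u - F ` hyperplane n j v)")
    case True
    then obtain j u v where "j < n" "large (F ` hyperplane n j u - F ` hyperplane n j v)" by blast
    then show ?thesis by (rule separating_case_a [OF F(1) _ _ r])
  next
    case False
    then have small: "small (F ` hyperplane n j u - F ` hyperplane n j v)" if "j < n" for j u v
      using that unfolding small_def by blast
    show ?thesis
    proof (rule separating_case_b [OF F _ _ r])
      show "large (F ` hyperplane n j (c j))" if "j < n" for j by (rule c [OF that])
      show "small (F ` hyperplane n j u - F ` hyperplane n j v)" if "j < n" for j u v
        by (rule small [OF that])
    qed
  qed
  \<comment> \<open>Tag \<open>n\<close> is an extra class, fed from hyperplane \<open>0\<close>;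
    its values are kept out of the range to make it co-large.\<close>
  define L where "L i = F ` hyperplane n (if i < n then i else 0) (c (if i < n then i else 0))" for i
  have "|{..n}| \<le>o |UNIV :: 'a set|"
    by (rule ordLess_imp_ordLeq [OF finite_card_ordLess]) (simp_all add: infinite_base)
  then obtain tag :: "'a \<Rightarrow> nat" where tag: "\<And>x. tag x \<in> {..n}"
    "\<And>i. i \<in> {..n} \<Longrightarrow> large {x \<in> UNIV. tag x = i}"
    by (rule fibred_map [OF large_UNIV]) (auto intro: that)
  have "large (L (tag t))" for t using c F(2) by (simp add: L_def)
  then obtain y where y: "\<And>t. y t \<in> L (tag t)" "inj y"
    by (rule inj_selection [of "\<lambda>t. L (tag t)" "{} :: nat set"]) (use that in auto)
  let ?X = "{t. tag t < n}"
  have "large ?X"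
    by (rule large_mono [OF tag(2) [of 0]]) (use F(2) in auto)
  then obtain j where j: "bij_betw j (UNIV :: 'a set) ?X" by (rule large_bij [OF large_UNIV])
  then have inj_j: "inj j" and jX: "\<And>x. tag (j x) < n" by (auto simp: bij_betw_def)
  have "\<exists>xs. xs \<in> hyperplane n (tag (j x)) (c (tag (j x))) \<and> F xs = y (j x)" for x
  proof -
    have "y (j x) \<in> F ` hyperplane n (tag (j x)) (c (tag (j x)))"
      using y(1) [of "j x"] jX [of x] by (simp add: L_def)
    then show ?thesis by auto
  qed
  then obtain xs where xs: "\<And>x. xs x \<in> hyperplane n (tag (j x)) (c (tag (j x)))"
    "\<And>x. F (xs x) = y (j x)" by metis
  have p_in: "(\<lambda>x. xs x ! i) \<in> M" if i: "i < n" for i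
  proof (rule fibre_in)
    have "large {t. tag t = i}" using tag(2) [of i] i by simp
    moreover have "{t. tag t = i} = j ` {x. tag (j x) = i}"
    proof -
      have "t \<in> j ` UNIV" if "tag t = i" for t using j i that by (simp add: bij_betw_def)
      then show ?thesis by fastforce
    qed
    ultimately have "large {x. tag (j x) = i}" using image_large_imp_large by metis
    then show "large ((\<lambda>x. xs x ! i) -` {c i})"
    proof (rule large_mono)
      show "{x. tag (j x) = i} \<subseteq> (\<lambda>x. xs x ! i) -` {c i}"
        using xs(1) by (auto simp: hyperplane_def)
    qed
  qed
  have "(\<lambda>x. F (tup n (\<lambda>i x. xs x ! i) x)) \<in> M" by (rule tup_comp_unary_part [OF C F(1) p_in])
  moreover have "tup n (\<lambda>i x. xs x ! i) x = xs x" for x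
    by (rule tup_eq_listI) (use xs(1) in \<open>auto simp: hyperplane_def\<close>)
  ultimately have m: "(\<lambda>x. y (j x)) \<in> M" by (simp add: xs(2))
  have inj_m: "inj (\<lambda>x. y (j x))"
    by (rule injI) (use injD [OF y(2)] injD [OF inj_j] in blast)
  have "large (- range (\<lambda>x. y (j x)))"
  proof (rule large_mono)
    show "large (y ` {t. tag t = n})"
      using tag(2) [of n] large_image [OF inj_on_subset [OF y(2)]] by simp
    show "y ` {t. tag t = n} \<subseteq> - range (\<lambda>x. y (j x))"
    proof (intro subsetI ComplI)
      fix z assume "z \<in> y ` {t. tag t = n}" "z \<in> range (\<lambda>x. y (j x))"
      then obtain t x where "tag t = n" "y t = y (j x)" by auto
      then show False using injD [OF y(2), of t "j x"] jX [of x] by simp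
    qed
  qed
  note co_large = this
  have "g \<in> M" for g
  proof -
    obtain k where k: "k \<in> M" "\<forall>z\<in>range (\<lambda>x. y (j x)). k z = g (inv (\<lambda>x. y (j x)) z)"
      using extends [OF co_large] by metis
    have "k (y (j x)) = g x" for x
    proof -
      have "k (y (j x)) = g (inv (\<lambda>x. y (j x)) (y (j x)))" using k(2) by blast
      also have "inv (\<lambda>x. y (j x)) (y (j x)) = x" using inv_f_f [OF inj_m, of x] .
      finally show ?thesis .
    qed
    then show ?thesis using comp_in [OF k(1) m] by simp
  qed
  then show False using not_full by blast
qed

end

section \<open>Partition properties\<close>

text \<open>Covers the countable and the weakly compact case at once.\<close>

locale ramsey_base = infinite_base base for base :: "'a itself" +
  assumes homogeneous: "\<And>c :: 'a set \<Rightarrow> bool. \<exists>H. large H \<and> (\<exists>b. c ` nsets H 2 \<subseteq> {b})"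
begin

lemma homogeneous_pairs:
  fixes R :: "'a \<Rightarrow> 'a \<Rightarrow> bool"
  obtains H b where "large H" "\<And>x y. x \<in> H \<Longrightarrow> y \<in> H \<Longrightarrow> prec x y \<Longrightarrow> R x y = b"
proof -
  let ?c = "\<lambda>N. \<exists>x y. N = {x, y} \<and> prec x y \<and> R x y"
  obtain H b where H: "large H" "?c ` nsets H 2 \<subseteq> {b}" using homogeneous [of ?c] by blast
  have "R x y = b" if xy: "x \<in> H" "y \<in> H" "prec x y" for x y
  proof -
    have "x \<noteq> y" using xy(3) prec_irrefl by metis
    then have "{x, y} \<in> nsets H 2" using xy by simp
    then have "?c {x, y} = b" using H(2) by blast
    moreover have "?c {x, y} = R x y"
      using xy(3) prec_asym [OF xy(3)] by (auto simp: doubleton_eq_iff)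
    ultimately show ?thesis by simp
  qed
  with H(1) show thesis by (rule that)
qed

text \<open>Colour a pair by whether its points fall into the same one of few small blocks. A large
  homogeneous set would lie in one block or meet each block at most once; both are
  impossible.\<close>

lemma stable_if_homogeneous: "stable |UNIV :: 'a set|"
  unfolding stable_def
proof (intro allI impI, elim conjE, rule ccontr)
  fix A :: "'a set" and F :: "'a \<Rightarrow> 'a set"
  assume A: "|A| <o |UNIV :: 'a set|" and F: "\<forall>a\<in>A. |F a| <o |UNIV :: 'a set|"
    and "\<not> |SIGMA a : A. F a| <o |UNIV :: 'a set|"
  then have "|UNIV :: 'a set| \<le>o |SIGMA a : A. F a|"
    using not_ordLess_iff_ordLeq [OF card_of_Well_order card_of_Well_order] by blast
  then obtain f :: "'a \<Rightarrow> 'a \<times> 'a" where f: "inj f" "range f \<subseteq> (SIGMA a : A. F a)"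
    unfolding card_of_ordLeq [symmetric] by blast
  obtain H b where H: "large H"
    and b: "\<And>x y. x \<in> H \<Longrightarrow> y \<in> H \<Longrightarrow> prec x y \<Longrightarrow> (fst (f x) = fst (f y)) = b"
    by (rule homogeneous_pairs [of "\<lambda>x y. fst (f x) = fst (f y)"]) (rule that)
  have b': "(fst (f x) = fst (f y)) = b" if "x \<in> H" "y \<in> H" "x \<noteq> y" for x y
    using prec_total [OF that(3)] b [OF that(1,2)] b [OF that(2,1)] by metis
  have fst_in: "fst (f x) \<in> A" for x
  proof -
    have "f x \<in> (SIGMA a : A. F a)" using f(2) by blast
    then show ?thesis by (auto simp: mem_Sigma_iff split_beta)
  qed
  show False
  proof (cases b)
    case True
    obtain x0 where x0: "x0 \<in> H" using large_nonempty [OF H] by blast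
    have same: "fst (f x) = fst (f x0)" if "x \<in> H" for x
      using b' [OF that x0] True by metis
    have "inj_on (\<lambda>x. snd (f x)) H"
    proof (rule inj_onI)
      fix x y assume "x \<in> H" "y \<in> H" "snd (f x) = snd (f y)"
      then have "f x = f y" using same by (simp add: prod_eq_iff)
      then show "x = y" using f(1) by (simp add: inj_eq)
    qed
    then have "large ((\<lambda>x. snd (f x)) ` H)" using H large_image by blast
    moreover have "snd (f x) \<in> F (fst (f x0))" if "x \<in> H" for x
    proof -
      have "f x \<in> (SIGMA a : A. F a)" using f(2) by blast
      then show ?thesis using same [OF that] by (auto simp: mem_Sigma_iff split_beta)
    qed
    then have "(\<lambda>x. snd (f x)) ` H \<subseteq> F (fst (f x0))" by blast
    ultimately have "large (F (fst (f x0)))" by (rule large_mono)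
    moreover have "fst (f x0) \<in> A" by (rule fst_in)
    ultimately show False using F small_iff_ordLess unfolding small_def by blast
  next
    case False
    then have "inj_on (\<lambda>x. fst (f x)) H" by (intro inj_onI) (use b' in blast)
    then have "large ((\<lambda>x. fst (f x)) ` H)" using H large_image by blast
    moreover have "(\<lambda>x. fst (f x)) ` H \<subseteq> A" using fst_in by blast
    ultimately have "large A" by (rule large_mono)
    then show False using A small_iff_ordLess unfolding small_def by blast
  qed
qed

end

sublocale ramsey_base \<subseteq> regular_base
  by unfold_locales (rule stable_if_homogeneous)

text \<open>Lexicographic order, at the first difference along \<open>prec\<close>, of the sequences
  recording membership in the \<open>Z i\<close>; complementing all \<open>Z i\<close> reverses
  it.\<close>

definition lex_below :: "('a \<Rightarrow> 'a set) \<Rightarrow> 'a \<Rightarrow> 'a \<Rightarrow> bool" where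
  "lex_below Z x y \<longleftrightarrow> (\<exists>i. (\<forall>j. prec j i \<longrightarrow> (x \<in> Z j \<longleftrightarrow> y \<in> Z j)) \<and> x \<notin> Z i \<and> y \<in> Z i)"

lemma lex_below_total:
  "(\<forall>i. x \<in> Z i \<longleftrightarrow> y \<in> Z i) \<or> lex_below Z x y \<or> lex_below (\<lambda>i. - Z i) x y"
proof (cases "\<forall>i. x \<in> Z i \<longleftrightarrow> y \<in> Z i")
  case False
  then obtain i where i: "\<not> (x \<in> Z i \<longleftrightarrow> y \<in> Z i)"
    and min: "\<And>j. prec j i \<Longrightarrow> x \<in> Z j \<longleftrightarrow> y \<in> Z j"
    using wf_eq_minimal [THEN iffD1, OF wf_prec, rule_format, of _ "{i. \<not> (x \<in> Z i \<longleftrightarrow> y \<in> Z i)}"]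
    by blast
  show ?thesis
  proof (cases "x \<in> Z i")
    case True
    then have "lex_below (\<lambda>i. - Z i) x y"
      unfolding lex_below_def using i min by (intro exI [of _ i]) simp
    then show ?thesis by blast
  next
    case False
    then have "lex_below Z x y" unfolding lex_below_def using i min by (intro exI [of _ i]) simp
    then show ?thesis by blast
  qed
qed simp

context ramsey_base
begin

text \<open>Along a set on which the characteristic sequences increase lexicographically, every
  coordinate is eventually constant: once the earlier coordinates are constant, it is monotone.\<close>

lemma lex_monotone_decided:
  fixes Z :: "'a \<Rightarrow> 'a set"
  assumes H: "large H"
    and mono: "\<And>x y. x \<in> H \<Longrightarrow> y \<in> H \<Longrightarrow> prec x y \<Longrightarrow> (\<forall>i. x \<in> Z i \<longleftrightarrow> y \<in> Z i) \<or> lex_below Z x y"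
  shows "small (H \<inter> Z i) \<or> small (H - Z i)"
proof (induction i rule: wf_induct_rule [OF wf_prec])
  case (1 i)
  define B where "B j = (if small (H \<inter> Z j) then H \<inter> Z j else H - Z j)" for j
  have "small (B j)" if "prec j i" for j using 1 [of j] that by (auto simp: B_def)
  then have U: "small (\<Union>j\<in>{j. prec j i}. B j)" (is "small ?U")
    by (intro small_UN small_below) simp
  have agree: "x \<in> Z j \<longleftrightarrow> y \<in> Z j" if "x \<in> H - ?U" "y \<in> H - ?U" "prec j i" for x y j
  proof -
    have "x \<notin> B j" "y \<notin> B j" using that by blast+
    then show ?thesis using that(1,2) by (cases "small (H \<inter> Z j)") (auto simp: B_def)
  qed
  have up: "y \<in> Z i" if xy: "x \<in> H - ?U" "y \<in> H - ?U" "prec x y" "x \<in> Z i" for x y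
  proof (rule ccontr)
    assume y: "y \<notin> Z i"
    then have "lex_below Z x y" using mono [of x y] xy by blast
    then obtain i' where i': "\<And>j. prec j i' \<Longrightarrow> x \<in> Z j \<longleftrightarrow> y \<in> Z j" "x \<notin> Z i'" "y \<in> Z i'"
      unfolding lex_below_def by blast
    have "i' \<noteq> i" using i'(2) xy(4) by blast
    then consider "prec i' i" | "prec i i'" using prec_total [of i' i] by blast
    then show False
    proof cases
      case 1
      then show False using agree [OF xy(1,2)] i'(2,3) by blast
    next
      case 2
      then show False using i'(1) xy(4) y by blast
    qed
  qed
  show ?case
  proof (cases "\<exists>x0. x0 \<in> H - ?U \<and> x0 \<in> Z i")
    case True
    then obtain x0 where x0: "x0 \<in> H - ?U" "x0 \<in> Z i" by blast
    have "H - Z i \<subseteq> ?U \<union> ({x0} \<union> {y. prec y x0})"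
    proof
      fix y assume y: "y \<in> H - Z i"
      show "y \<in> ?U \<union> ({x0} \<union> {y. prec y x0})"
      proof (cases "y \<in> ?U")
        case False
        then have "\<not> prec x0 y" using up [OF x0(1) _ _ x0(2)] y by blast
        then show ?thesis using prec_total [of x0 y] by blast
      qed simp
    qed
    moreover have "small (?U \<union> ({x0} \<union> {y. prec y x0}))"
      by (intro small_Un U small_below) (simp add: finite_small)
    ultimately show ?thesis using small_mono by blast
  next
    case False
    then have "H \<inter> Z i \<subseteq> ?U" by blast
    then show ?thesis using small_mono [OF U] by blast
  qed
qed

text \<open>Colour pairs by whether these sequences weakly increase. On a homogeneous set they do so
  either for \<open>Z\<close> or for the complements, so one large set decides all \<kappa> many
  properties up to small errors.\<close>

lemma decide:
  fixes Z :: "'a \<Rightarrow> 'a set"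
  obtains H where "large H" "\<And>i. small (H \<inter> Z i) \<or> small (H - Z i)"
proof -
  let ?R = "\<lambda>x y. (\<forall>i. x \<in> Z i \<longleftrightarrow> y \<in> Z i) \<or> lex_below Z x y"
  obtain H b where H: "large H" "\<And>x y. x \<in> H \<Longrightarrow> y \<in> H \<Longrightarrow> prec x y \<Longrightarrow> ?R x y = b"
    by (rule homogeneous_pairs [of ?R]) (rule that)
  have "small (H \<inter> Z i) \<or> small (H - Z i)" for i
  proof (cases b)
    case True
    then show ?thesis using H(2) by (intro lex_monotone_decided [OF H(1)]) blast
  next
    case False
    have "small (H \<inter> - Z i) \<or> small (H - - Z i)"
    proof (rule lex_monotone_decided [where Z = "\<lambda>i. - Z i", OF H(1)])
      fix x y assume "x \<in> H" "y \<in> H" "prec x y"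
      from H(2) [OF this] False have "\<not> ?R x y" by blast
      then show "(\<forall>i. x \<in> - Z i \<longleftrightarrow> y \<in> - Z i) \<or> lex_below (\<lambda>i. - Z i) x y"
        using lex_below_total [of x Z y] by blast
    qed
    then show ?thesis by (simp add: Diff_eq disj_commute)
  qed
  with H(1) show thesis by (rule that)
qed

lemma decide_in:
  fixes Q :: "'a \<Rightarrow> 'a \<Rightarrow> 'a \<Rightarrow> bool"
  assumes L: "large L"
  obtains H where "H \<subseteq> L" "large H" "\<And>a b. small {y \<in> H. Q a b y} \<or> small {y \<in> H. \<not> Q a b y}"
proof -
  obtain l where l: "bij_betw l (UNIV :: 'a set) L" by (rule large_bij [OF large_UNIV L])
  then have inj_l: "inj l" by (simp add: bij_betw_def)
  obtain pair :: "'a \<times> 'a \<Rightarrow> 'a" where pair: "bij pair" by (rule pairing_exists)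
  have inv_pair: "inv pair (pair p) = p" for p using pair by (simp add: bij_is_inj)
  obtain H where H: "large H" "\<And>i. small (H \<inter> {x. Q (fst (inv pair i)) (snd (inv pair i)) (l x)})
      \<or> small (H - {x. Q (fst (inv pair i)) (snd (inv pair i)) (l x)})"
    by (rule decide) (rule that)
  have 1: "{y \<in> l ` H. Q a b y} = l ` (H \<inter> {x. Q a b (l x)})" for a b by auto
  have 2: "{y \<in> l ` H. \<not> Q a b y} = l ` (H - {x. Q a b (l x)})" for a b by auto
  have "small {y \<in> l ` H. Q a b y} \<or> small {y \<in> l ` H. \<not> Q a b y}" for a b
    unfolding 1 2 using H(2) [of "pair (a, b)"] small_image by (auto simp: inv_pair)
  moreover have "large (l ` H)" using H(1) large_image [OF inj_on_subset [OF inj_l]] by simp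
  moreover have "l ` H \<subseteq> L" using l by (auto simp: bij_betw_def)
  ultimately show thesis using that by blast
qed

end

context regular_base
begin

lemma prec_max3:
  obtains x :: 'a where "x \<in> {x1, x2, x3}" "x1 = x \<or> prec x1 x" "x2 = x \<or> prec x2 x" "x3 = x \<or> prec x3 x"
proof -
  have "\<exists>x\<in>{x1, x2, x3}. (x1 = x \<or> prec x1 x) \<and> (x2 = x \<or> prec x2 x) \<and> (x3 = x \<or> prec x3 x)"
    using prec_total [of x1 x2] prec_total [of x1 x3] prec_total [of x2 x3]
    by (metis insertCI prec_trans)
  then show thesis using that by blast
qed

lemma small_atMost: "small {y :: 'a. y = x \<or> prec y x}"
proof -
  have "{y. y = x \<or> prec y x} = {x} \<union> {y. prec y x}" by auto
  then show ?thesis using small_Un [OF finite_small small_below, of "{x}" x] by simp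
qed

text \<open>By regularity the exceptional sets of all triples up to \<open>x\<close> are bounded together, so that
  a sufficiently sparse subset avoids them.\<close>

lemma thinning:
  fixes B :: "'a \<Rightarrow> 'a \<Rightarrow> 'a \<Rightarrow> 'a set"
  assumes H: "large H"
    and B: "\<And>x1 x2 x3. x1 \<in> H \<Longrightarrow> x2 \<in> H \<Longrightarrow> x3 \<in> H \<Longrightarrow> small (H \<inter> B x1 x2 x3)"
  obtains H' where "H' \<subseteq> H" "large H'"
    "\<And>x1 x2 x3 y. x1 \<in> H' \<Longrightarrow> x2 \<in> H' \<Longrightarrow> x3 \<in> H' \<Longrightarrow> y \<in> H' \<Longrightarrow> prec x1 y \<Longrightarrow> prec x2 y \<Longrightarrow> prec x3 y
      \<Longrightarrow> y \<notin> B x1 x2 x3"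
proof -
  define D where "D x = {y. y = x \<or> prec y x} \<inter> H" for x
  have D: "small (D x)" for x by (rule small_mono [OF small_atMost [of x]]) (auto simp: D_def)
  have "small (\<Union>x1\<in>D x. \<Union>x2\<in>D x. \<Union>x3\<in>D x. H \<inter> B x1 x2 x3)" for x
    by (intro small_UN D B) (auto simp: D_def)
  then have "\<exists>b. \<forall>y\<in>(\<Union>x1\<in>D x. \<Union>x2\<in>D x. \<Union>x3\<in>D x. H \<inter> B x1 x2 x3). prec y b" for x
    by (meson small_bounded)
  then obtain \<beta> where \<beta>: "\<And>x y. y \<in> (\<Union>x1\<in>D x. \<Union>x2\<in>D x. \<Union>x3\<in>D x. H \<inter> B x1 x2 x3) \<Longrightarrow> prec y (\<beta> x)"
    by metis
  \<comment> \<open>A later point must not lie below the bound of an earlier one. The conflict is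
    symmetric because the enumeration may disagree with \<open>prec\<close>.\<close>
  let ?conf = "\<lambda>x y. x = y \<or> prec y (\<beta> x) \<and> prec x y \<or> prec x (\<beta> y) \<and> prec y x"
  have small_conf: "small {y \<in> H. ?conf x y}" for t x :: 'a
    by (rule small_mono [OF small_Un [OF small_atMost [of x] small_below [of "\<beta> x"]]]) auto
  obtain c where c: "\<And>t :: 'a. c t \<in> H" "\<And>s t. prec s t \<Longrightarrow> \<not> ?conf (c s) (c t)"
    by (rule selection [where W = "\<lambda>t. H" and conf = ?conf, OF H small_conf]) (rule that)
  have ne: "\<not> ?conf (c s) (c t)" if "s \<noteq> t" for s t
    using prec_total [OF that] c(2) [of s t] c(2) [of t s] by metis
  have inj: "inj c" by (rule injI) (use ne in metis)
  show thesis
  proof (rule that)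
    show "range c \<subseteq> H" using c(1) by blast
    show "large (range c)" using large_image [OF inj] by simp
    fix x1 x2 x3 y
    assume x: "x1 \<in> range c" "x2 \<in> range c" "x3 \<in> range c" and y: "y \<in> range c"
      and less: "prec x1 y" "prec x2 y" "prec x3 y"
    obtain x where xm: "x \<in> {x1, x2, x3}" "x1 = x \<or> prec x1 x" "x2 = x \<or> prec x2 x" "x3 = x \<or> prec x3 x"
      by (rule prec_max3)
    have "prec x y" "x \<in> range c" using xm(1) less x by auto
    then obtain s t where st: "x = c s" "y = c t" using y by blast
    have "s \<noteq> t" using st \<open>prec x y\<close> prec_irrefl by metis
    from ne [OF this] have "\<not> prec y (\<beta> x)" using \<open>prec x y\<close> st by blast
    then have "y \<notin> (\<Union>x1\<in>D x. \<Union>x2\<in>D x. \<Union>x3\<in>D x. H \<inter> B x1 x2 x3)" using \<beta> by metis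
    moreover have "x1 \<in> D x" "x2 \<in> D x" "x3 \<in> D x" "y \<in> H"
      using xm x y c(1) by (auto simp: D_def)
    ultimately show "y \<notin> B x1 x2 x3" by blast
  qed
qed

end

section \<open>Canonical form of binary operations on increasing pairs\<close>

definition inj_pairs :: "('a \<Rightarrow> 'a \<Rightarrow> 'a) \<Rightarrow> 'a set \<Rightarrow> bool" where
  "inj_pairs b A \<longleftrightarrow> (\<forall>x\<in>A. \<forall>y\<in>A. \<forall>x'\<in>A. \<forall>y'\<in>A. prec x y \<longrightarrow> prec x' y' \<longrightarrow> b x y = b x' y'
     \<longrightarrow> x = x' \<and> y = y')"

lemma inj_pairsD:
  "inj_pairs b A \<Longrightarrow> x \<in> A \<Longrightarrow> y \<in> A \<Longrightarrow> x' \<in> A \<Longrightarrow> y' \<in> A \<Longrightarrow> prec x y \<Longrightarrow> prec x' y'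
    \<Longrightarrow> b x y = b x' y' \<Longrightarrow> x = x' \<and> y = y'"
  unfolding inj_pairs_def by blast

lemma inj_pairs_mono: "inj_pairs b A \<Longrightarrow> A' \<subseteq> A \<Longrightarrow> inj_pairs b A'"
  unfolding inj_pairs_def by blast

context ramsey_base
begin

text \<open>A canonical Ramsey theorem for pairs, with the constant form included among the unary
  ones. Equations \<open>t x y = v\<close> and \<open>t x y = t x' y\<close> are decided up to small
  sets of \<open>y\<close>. Then many rows are almost constant, or many rows almost agree, or rows
  that pairwise differ almost everywhere can be selected and thinned to injectivity.\<close>

lemma canonical:
  fixes t :: "'a \<Rightarrow> 'a \<Rightarrow> 'a"
  assumes L: "large L"
  obtains H where "H \<subseteq> L" "large H"
    "(\<exists>v. \<forall>x\<in>H. \<forall>y\<in>H. prec x y \<longrightarrow> t x y = v x) \<or> (\<exists>v. \<forall>x\<in>H. \<forall>y\<in>H. prec x y \<longrightarrow> t x y = v y)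
      \<or> inj_pairs t H"
proof -
  obtain H1 where H1: "H1 \<subseteq> L" "large H1"
    "\<And>x v. small {y \<in> H1. t x y = v} \<or> small {y \<in> H1. \<not> t x y = v}"
    by (rule decide_in [OF L, of "\<lambda>x v y. t x y = v"]) (rule that)
  obtain H2 where H2: "H2 \<subseteq> H1" "large H2"
    "\<And>x x'. small {y \<in> H2. t x y = t x' y} \<or> small {y \<in> H2. \<not> t x y = t x' y}"
    by (rule decide_in [OF H1(2), of "\<lambda>x x' y. t x y = t x' y"]) (rule that)
  have dec: "small {y \<in> H2. t x y = v} \<or> small {y \<in> H2. t x y \<noteq> v}" for x v
    using H1(3) [of x v] small_mono [of "{y \<in> H1. t x y = v}" "{y \<in> H2. t x y = v}"]
      small_mono [of "{y \<in> H1. \<not> t x y = v}" "{y \<in> H2. t x y \<noteq> v}"] H2(1) by blast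
  define K where "K = {x \<in> H2. \<exists>v. small {y \<in> H2. t x y \<noteq> v}}"
  have "large (K \<union> (H2 - K))" by (rule large_mono [OF H2(2)]) blast
  then consider "large K" | "large (H2 - K)" using large_Un_cases by blast
  then show thesis
  proof cases
    case 1
    have "\<forall>x\<in>K. \<exists>v. small {y \<in> H2. t x y \<noteq> v}" by (simp add: K_def)
    from bchoice [OF this] obtain v where v: "\<And>x. x \<in> K \<Longrightarrow> small {y \<in> H2. t x y \<noteq> v x}" by blast
    have "small (K \<inter> {y. t x1 y \<noteq> v x1})" if "x1 \<in> K" for x1
      by (rule small_mono [OF v [OF that]]) (auto simp: K_def)
    then obtain H where H: "H \<subseteq> K" "large H" "\<And>x1 x2 x3 y. x1 \<in> H \<Longrightarrow> x2 \<in> H \<Longrightarrow> x3 \<in> H \<Longrightarrow> y \<in> H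
      \<Longrightarrow> prec x1 y \<Longrightarrow> prec x2 y \<Longrightarrow> prec x3 y \<Longrightarrow> y \<notin> {y. t x1 y \<noteq> v x1}"
      using thinning [OF 1, of "\<lambda>x1 x2 x3. {y. t x1 y \<noteq> v x1}"] by blast
    have "\<forall>x\<in>H. \<forall>y\<in>H. prec x y \<longrightarrow> t x y = v x"
    proof (intro ballI impI)
      fix x y assume "x \<in> H" "y \<in> H" "prec x y"
      with H(3) [of x x x y] show "t x y = v x" by simp
    qed
    moreover have "H \<subseteq> L" using H(1) H1(1) H2(1) by (auto simp: K_def)
    ultimately show thesis using H(2) that by blast
  next
    case 2
    let ?K = "H2 - K"
    have small_eq: "small {y \<in> H2. t x y = v}" if "x \<in> ?K" for x v
      using dec [of x v] that by (auto simp: K_def)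
    let ?E = "\<lambda>x x'. small {y \<in> H2. \<not> t x y = t x' y}"
    have E_sym: "?E x x' \<Longrightarrow> ?E x' x" for x x' by (rule small_mono) auto
    show thesis
    proof (cases "\<exists>x0\<in>?K. large {x \<in> ?K. ?E x0 x}")
      case True
      then obtain x0 where x0: "x0 \<in> ?K" "large {x \<in> ?K. ?E x0 x}" by blast
      let ?J = "{x \<in> ?K. ?E x0 x}"
      have "small (?J \<inter> {y. t x0 y \<noteq> t x1 y})" if "x1 \<in> ?J" for x1
      proof (rule small_mono)
        show "?E x0 x1" using that by blast
      qed auto
      then obtain H where H: "H \<subseteq> ?J" "large H" "\<And>x1 x2 x3 y. x1 \<in> H \<Longrightarrow> x2 \<in> H \<Longrightarrow> x3 \<in> H \<Longrightarrow> y \<in> H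
        \<Longrightarrow> prec x1 y \<Longrightarrow> prec x2 y \<Longrightarrow> prec x3 y \<Longrightarrow> y \<notin> {y. t x0 y \<noteq> t x1 y}"
        using thinning [OF x0(2), of "\<lambda>x1 x2 x3. {y. t x0 y \<noteq> t x1 y}"] by blast
      have "\<forall>x\<in>H. \<forall>y\<in>H. prec x y \<longrightarrow> t x y = t x0 y"
      proof (intro ballI impI)
        fix x y assume "x \<in> H" "y \<in> H" "prec x y"
        with H(3) [of x x x y] show "t x y = t x0 y" by simp
      qed
      then have "\<exists>v. \<forall>x\<in>H. \<forall>y\<in>H. prec x y \<longrightarrow> t x y = v y" by (rule exI [of _ "t x0"])
      moreover have "H \<subseteq> L" using H(1) H1(1) H2(1) by blast
      ultimately show thesis using H(2) that by blast
    next
      case False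
      let ?conf = "\<lambda>x y. x \<in> ?K \<and> ?E x y"
      have "small {y \<in> ?K. ?conf x y}" for x
      proof (cases "x \<in> ?K")
        case True
        then have "small {y \<in> ?K. ?E x y}" using False by (auto simp: small_def)
        then show ?thesis by (rule small_mono) auto
      next
        case False
        then have "{y \<in> ?K. ?conf x y} = {}" by blast
        then show ?thesis by (simp only: small_empty)
      qed
      note small_conf = this
      obtain c where c: "\<And>t :: 'a. c t \<in> ?K" "\<And>s t. prec s t \<Longrightarrow> \<not> ?conf (c s) (c t)"
        by (rule selection [where W = "\<lambda>t. ?K" and conf = ?conf, OF 2 small_conf]) (rule that)
      have notE: "\<not> ?E (c s) (c t)" if "s \<noteq> t" for s t
        using prec_total [OF that] c(1) c(2) [of s t] c(2) [of t s] E_sym by blast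
      have "inj c"
      proof (rule injI, rule ccontr)
        fix s t assume "c s = c t" "s \<noteq> t"
        then show False using notE [of s t] by simp
      qed
      from large_image [OF this] have large_c: "large (range c)" by simp
      have small_ne: "small {y \<in> H2. t x y = t x' y}" if xx: "x \<in> range c" "x' \<in> range c" "x \<noteq> x'" for x x'
      proof -
        obtain s t where st: "x = c s" "x' = c t" using xx by blast
        with xx(3) have "\<not> ?E x x'" using notE [of s t] by auto
        then show ?thesis using H2(3) [of x x'] by blast
      qed
      \<comment> \<open>A later \<open>y\<close> shall neither repeat an earlier value nor give
        equal values in two different earlier rows; the first makes second entries agree, the second
        first entries.\<close>
      define B where "B x1 x2 x3 = {y. t x1 y = t x2 x3 \<or> x1 \<noteq> x2 \<and> t x1 y = t x2 y}" for x1 x2 x3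
      have B: "small (range c \<inter> B x1 x2 x3)" if x: "x1 \<in> range c" "x2 \<in> range c" for x1 x2 x3
      proof (rule small_mono)
        have "small {y \<in> H2. x1 \<noteq> x2 \<and> t x1 y = t x2 y}"
          using small_ne [OF x] by (cases "x1 = x2") simp_all
        moreover have "x1 \<in> ?K" using x(1) c(1) by blast
        ultimately show "small ({y \<in> H2. t x1 y = t x2 x3} \<union> {y \<in> H2. x1 \<noteq> x2 \<and> t x1 y = t x2 y})"
          by (intro small_Un small_eq)
        show "range c \<inter> B x1 x2 x3
          \<subseteq> {y \<in> H2. t x1 y = t x2 x3} \<union> {y \<in> H2. x1 \<noteq> x2 \<and> t x1 y = t x2 y}"
          using c(1) by (auto simp: B_def)
      qed
      obtain H where H: "H \<subseteq> range c" "large H" "\<And>x1 x2 x3 y. x1 \<in> H \<Longrightarrow> x2 \<in> H \<Longrightarrow> x3 \<in> H \<Longrightarrow> y \<in> H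
        \<Longrightarrow> prec x1 y \<Longrightarrow> prec x2 y \<Longrightarrow> prec x3 y \<Longrightarrow> y \<notin> B x1 x2 x3"
        using thinning [of "range c" B, OF large_c B] by blast
      have *: "\<not> prec y' y" if "x \<in> H" "y \<in> H" "x' \<in> H" "y' \<in> H" "prec x y" "prec x' y'" "t x y = t x' y'"
        for x y x' y'
      proof
        assume y: "prec y' y"
        have "prec x' y" using prec_trans that(6) y by metis
        then have "y \<notin> B x x' y'" using H(3) that(1-5) y by blast
        then show False using that(7) by (simp add: B_def)
      qed
      have "inj_pairs t H"
        unfolding inj_pairs_def
      proof (intro ballI impI)
        fix x y x' y' assume xy: "x \<in> H" "y \<in> H" "x' \<in> H" "y' \<in> H" "prec x y" "prec x' y'"
          and eq: "t x y = t x' y'"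
        have "\<not> prec y' y" by (rule * [OF xy eq])
        moreover have "\<not> prec y y'" by (rule * [OF xy(3,4,1,2,6,5) eq [symmetric]])
        ultimately have "y = y'" using prec_total by metis
        moreover have "x = x'"
        proof (rule ccontr)
          assume "x \<noteq> x'"
          have "y \<notin> B x x' x" using H(3) [of x x' x y] xy \<open>y = y'\<close> by blast
          then show False using \<open>x \<noteq> x'\<close> eq \<open>y = y'\<close> by (simp add: B_def)
        qed
        ultimately show "x = x' \<and> y = y'" by simp
      qed
      moreover have "H \<subseteq> L"
        using H(1) c(1) H1(1) H2(1) by blast
      ultimately show thesis using H(2) that by blast
    qed
  qed
qed

end

section \<open>Precomplete clones above the unary operations\<close>

definition unary_binary_ops :: "('a \<Rightarrow> 'a \<Rightarrow> 'a) set" where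
  "unary_binary_ops = {u. (\<exists>g. u = (\<lambda>x y. g x)) \<or> (\<exists>g. u = (\<lambda>x y. g y))}"

lemma unary_binary_ops_I: "(\<lambda>x y. g x) \<in> unary_binary_ops" "(\<lambda>x y. g y) \<in> unary_binary_ops"
  unfolding unary_binary_ops_def by blast+

lemma unary_binary_ops_comp: "u \<in> unary_binary_ops \<Longrightarrow> (\<lambda>x y. g (u x y)) \<in> unary_binary_ops"
  unfolding unary_binary_ops_def by auto

definition tup2 :: "nat \<Rightarrow> (nat \<Rightarrow> 'a \<Rightarrow> 'a \<Rightarrow> 'a) \<Rightarrow> 'a \<Rightarrow> 'a \<Rightarrow> 'a list" where
  "tup2 n u x y = map (\<lambda>i. u i x y) [0..<n]"

lemma length_tup2 [simp]: "length (tup2 n u x y) = n"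
  by (simp add: tup2_def)

lemma nth_tup2 [simp]: "i < n \<Longrightarrow> tup2 n u x y ! i = u i x y"
  by (simp add: tup2_def)

lemma tup2_eqI: "(\<And>i. i < n \<Longrightarrow> u i x y = v i x' y') \<Longrightarrow> tup2 n u x y = tup2 n v x' y'"
  by (simp add: tup2_def)

text \<open>A clone with all unary operations is closed under these substitutions. If this set is a
  clone above the unary operations, it is therefore the largest one whose binary members lie in
  \<open>T\<close>.\<close>

definition unary_subst_clone :: "('a \<Rightarrow> 'a \<Rightarrow> 'a) set \<Rightarrow> 'a operation set" where
  "unary_subst_clone T = {op_of n F | n F. n \<ge> 1 \<and>
     (\<forall>u. (\<forall>i<n. u i \<in> unary_binary_ops) \<longrightarrow> (\<lambda>x y. F (tup2 n u x y)) \<in> T)}"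

lemma op_of_unary_subst_iff:
  "op_of n F \<in> unary_subst_clone T \<longleftrightarrow> n \<ge> 1 \<and>
     (\<forall>u. (\<forall>i<n. u i \<in> unary_binary_ops) \<longrightarrow> (\<lambda>x y. F (tup2 n u x y)) \<in> T)"
proof
  assume "op_of n F \<in> unary_subst_clone T"
  then obtain n' F' where eq: "op_of n F = op_of n' F'" and n': "n' \<ge> 1"
    and F': "\<And>u. \<forall>i<n'. u i \<in> unary_binary_ops \<Longrightarrow> (\<lambda>x y. F' (tup2 n' u x y)) \<in> T"
    unfolding unary_subst_clone_def by blast
  have nn: "n' = n" using eq by (metis fst_op_of)
  have "F (tup2 n u x y) = F' (tup2 n u x y)" for u x y
    by (rule op_of_eqD [OF eq [unfolded nn]]) simp
  then show "n \<ge> 1 \<and> (\<forall>u. (\<forall>i<n. u i \<in> unary_binary_ops) \<longrightarrow> (\<lambda>x y. F (tup2 n u x y)) \<in> T)"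
    using n' F' nn by simp
next
  assume "n \<ge> 1 \<and> (\<forall>u. (\<forall>i<n. u i \<in> unary_binary_ops) \<longrightarrow> (\<lambda>x y. F (tup2 n u x y)) \<in> T)"
  then show "op_of n F \<in> unary_subst_clone T" unfolding unary_subst_clone_def by blast
qed

text \<open>This yields closure of \<open>unary_subst_clone T\<close> under composition: a composite
  leaving \<open>T\<close> is traded for one whose inner operations are unary, which the definition
  of that set controls.\<close>

definition reduces_to_unary :: "('a \<Rightarrow> 'a \<Rightarrow> 'a) set \<Rightarrow> bool" where
  "reduces_to_unary T \<longleftrightarrow> (\<forall>n (F :: 'a list \<Rightarrow> 'a) t. (\<forall>i<n. t i \<in> T) \<longrightarrow> (\<lambda>x y. F (tup2 n t x y)) \<notin> T \<longrightarrow>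
     (\<exists>u. (\<forall>i<n. u i \<in> unary_binary_ops) \<and> (\<lambda>x y. F (tup2 n u x y)) \<notin> T))"

lemma reduces_to_unaryD:
  fixes T :: "('a \<Rightarrow> 'a \<Rightarrow> 'a) set"
  assumes red: "reduces_to_unary T" and t: "\<And>i. i < n \<Longrightarrow> t i \<in> T" and F: "(\<lambda>x y. F (tup2 n t x y)) \<notin> T"
  shows "\<exists>u. (\<forall>i<n. u i \<in> unary_binary_ops) \<and> (\<lambda>x y. F (tup2 n u x y)) \<notin> T"
proof -
  have "\<forall>i<n. t i \<in> T" using t by blast
  from mp [OF mp [OF spec [OF spec [OF spec [OF red [unfolded reduces_to_unary_def], of n], of F], of t] this] F]
  show ?thesis .
qed

lemma is_clone_unary_subst:
  fixes T :: "('a \<Rightarrow> 'a \<Rightarrow> 'a) set"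
  assumes sub: "unary_binary_ops \<subseteq> T" and red: "reduces_to_unary T"
  shows "is_clone (unary_subst_clone T)"
proof (rule is_cloneI)
  show "unary_subst_clone T \<subseteq> all_ops"
  proof
    fix f assume "f \<in> unary_subst_clone T"
    then obtain n F where "f = op_of n F" "n \<ge> 1" unfolding unary_subst_clone_def by blast
    then show "f \<in> all_ops" by (simp add: op_of_all_ops)
  qed
  fix n k :: nat assume k: "k < n"
  have "(\<lambda>x y. tup2 n u x y ! k) \<in> T" if "\<forall>i<n. u i \<in> unary_binary_ops" for u :: "nat \<Rightarrow> 'a \<Rightarrow> 'a \<Rightarrow> 'a"
  proof -
    have "(\<lambda>x y. tup2 n u x y ! k) = u k" using k by simp
    then show ?thesis using that k sub by auto
  qed
  then show "op_of n (\<lambda>xs. xs ! k) \<in> unary_subst_clone T"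
    unfolding op_of_unary_subst_iff using k by auto
next
  fix n m and F :: "'a list \<Rightarrow> 'a" and Gs :: "('a list \<Rightarrow> 'a) list"
  assume F: "op_of n F \<in> unary_subst_clone T" and m: "m \<ge> 1" and len: "length Gs = n"
    and Gs: "\<And>G. G \<in> set Gs \<Longrightarrow> op_of m G \<in> unary_subst_clone T"
  have "(\<lambda>x y. F (map (\<lambda>G. G (tup2 m u x y)) Gs)) \<in> T"
    if u: "\<forall>i<m. u i \<in> unary_binary_ops" for u :: "nat \<Rightarrow> 'a \<Rightarrow> 'a \<Rightarrow> 'a"
  proof (rule ccontr)
    let ?t = "\<lambda>i x y. (Gs ! i) (tup2 m u x y)"
    have eq: "map (\<lambda>G. G (tup2 m u x y)) Gs = tup2 n ?t x y" for x y
      by (rule nth_equalityI) (simp_all add: len)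
    assume "(\<lambda>x y. F (map (\<lambda>G. G (tup2 m u x y)) Gs)) \<notin> T"
    then have "(\<lambda>x y. F (tup2 n ?t x y)) \<notin> T" by (simp only: eq not_False_eq_True)
    note notin = this
    have t_in: "?t i \<in> T" if "i < n" for i
    proof -
      have "op_of m (Gs ! i) \<in> unary_subst_clone T" using Gs that len by simp
      then have "\<forall>u. (\<forall>i<m. u i \<in> unary_binary_ops) \<longrightarrow> (\<lambda>x y. (Gs ! i) (tup2 m u x y)) \<in> T"
        unfolding op_of_unary_subst_iff by (rule conjunct2)
      from mp [OF spec [OF this, of u] u] show ?thesis .
    qed
    have "\<exists>v. (\<forall>i<n. v i \<in> unary_binary_ops) \<and> (\<lambda>x y. F (tup2 n v x y)) \<notin> T"
      by (rule reduces_to_unaryD [OF red _ notin]) (rule t_in)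
    then obtain v where v: "\<forall>i<n. v i \<in> unary_binary_ops" "(\<lambda>x y. F (tup2 n v x y)) \<notin> T" by (elim exE conjE)
    have "\<forall>u. (\<forall>i<n. u i \<in> unary_binary_ops) \<longrightarrow> (\<lambda>x y. F (tup2 n u x y)) \<in> T"
      using F unfolding op_of_unary_subst_iff by (rule conjunct2)
    from mp [OF spec [OF this, of v] v(1)] show False using v(2) by contradiction
  qed
  then show "op_of m (\<lambda>xs. F (map (\<lambda>G. G xs) Gs)) \<in> unary_subst_clone T"
    unfolding op_of_unary_subst_iff using m by blast
qed

lemma unary_part_unary_subst:
  assumes "unary_binary_ops \<subseteq> T"
  shows "unary_part (unary_subst_clone T) = UNIV"
proof -
  have "g \<in> unary_part (unary_subst_clone T)" for g
    unfolding unary_part_def mem_Collect_eq op_of_unary_subst_iff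
  proof (intro conjI allI impI)
    fix u :: "nat \<Rightarrow> 'a \<Rightarrow> 'a \<Rightarrow> 'a" assume "\<forall>i<1. u i \<in> unary_binary_ops"
    then have "(\<lambda>x y. g (u 0 x y)) \<in> T" using assms unary_binary_ops_comp by auto
    moreover have "hd (tup2 1 u x y) = u 0 x y" for x y by (simp add: tup2_def)
    ultimately show "(\<lambda>x y. g (hd (tup2 1 u x y))) \<in> T" by simp
  qed simp
  then show ?thesis by blast
qed

lemma binary_part_unary_subst_iff:
  "b \<in> binary_part (unary_subst_clone T) \<longleftrightarrow>
    (\<forall>u\<in>unary_binary_ops. \<forall>v\<in>unary_binary_ops. (\<lambda>x y. b (u x y) (v x y)) \<in> T)" (is "_ \<longleftrightarrow> ?R")
proof -
  have nth: "tup2 2 w x y ! 0 = w 0 x y" "tup2 2 w x y ! 1 = w 1 x y" for w :: "nat \<Rightarrow> 'a \<Rightarrow> 'a \<Rightarrow> 'a" and x y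
    by simp_all
  have "(\<forall>w :: nat \<Rightarrow> 'a \<Rightarrow> 'a \<Rightarrow> 'a. (\<forall>i<2. w i \<in> unary_binary_ops) \<longrightarrow> (\<lambda>x y. b (w 0 x y) (w 1 x y)) \<in> T) \<longleftrightarrow> ?R" (is "?L \<longleftrightarrow> _")
  proof
    assume L: ?L
    show ?R
    proof (intro ballI)
      fix u v :: "'a \<Rightarrow> 'a \<Rightarrow> 'a" assume "u \<in> unary_binary_ops" "v \<in> unary_binary_ops"
      then show "(\<lambda>x y. b (u x y) (v x y)) \<in> T"
        using L [THEN spec, of "\<lambda>i. if i = 0 then u else v"] by simp
    qed
  next
    assume R: ?R
    show ?L
    proof (intro allI impI)
      fix w :: "nat \<Rightarrow> 'a \<Rightarrow> 'a \<Rightarrow> 'a" assume "\<forall>i<2. w i \<in> unary_binary_ops"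
      then show "(\<lambda>x y. b (w 0 x y) (w 1 x y)) \<in> T" using R by simp
    qed
  qed
  then show ?thesis by (simp add: binary_part_def op_of_unary_subst_iff nth)
qed

lemma not_subset_unary_subst:
  assumes D: "is_clone D" "unary_part D = UNIV" "\<not> D \<subseteq> unary_subst_clone T"
  obtains b where "b \<in> binary_part D" "b \<notin> T"
proof -
  obtain f where f: "f \<in> D" "f \<notin> unary_subst_clone T" using D(3) by blast
  then have "f \<in> all_ops" using clone_sub [OF D(1)] by blast
  then obtain n F where nF: "n \<ge> 1" "f = op_of n F" by (rule all_ops_cases)
  then obtain u where u: "\<forall>i<n. u i \<in> unary_binary_ops" "(\<lambda>x y. F (tup2 n u x y)) \<notin> T"
    using f(2) op_of_unary_subst_iff by blast
  have "u i \<in> binary_part D" if "i < n" for i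
  proof -
    consider g where "u i = (\<lambda>x y. g x)" | g where "u i = (\<lambda>x y. g y)"
      using u(1) \<open>i < n\<close> unfolding unary_binary_ops_def by blast
    then show ?thesis
      using unary_fst [OF D(1)] unary_snd [OF D(1)] D(2) by cases simp_all
  qed
  then have "(\<lambda>x y. F (map (\<lambda>b. b x y) (map u [0..<n]))) \<in> binary_part D"
    using f(1) nF by (intro binary_part_comp [OF D(1)]) auto
  then have "(\<lambda>x y. F (tup2 n u x y)) \<in> binary_part D" by (simp add: tup2_def comp_def)
  then show thesis using u(2) by (rule that)
qed

section \<open>The two kinds of binary operations to be excluded\<close>

definition almost_unary_binary :: "('a \<Rightarrow> 'a \<Rightarrow> 'a) set" where
  "almost_unary_binary =
     {b. (\<forall>x. small (range (\<lambda>y. b x y))) \<or> (\<forall>y. small (range (\<lambda>x. b x y)))}"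

definition never_inj_pairs :: "('a \<Rightarrow> 'a \<Rightarrow> 'a) set" where
  "never_inj_pairs = {b. \<forall>A. large A \<longrightarrow> \<not> inj_pairs b A}"

context infinite_base
begin

lemma unary_almost_unary_binary: "(unary_binary_ops :: ('a \<Rightarrow> 'a \<Rightarrow> 'a) set) \<subseteq> almost_unary_binary"
proof
  fix u :: "'a \<Rightarrow> 'a \<Rightarrow> 'a" assume "u \<in> unary_binary_ops"
  then consider g where "u = (\<lambda>x y. g x)" | g where "u = (\<lambda>x y. g y)"
    unfolding unary_binary_ops_def by blast
  then show "u \<in> almost_unary_binary"
    by cases (simp_all add: almost_unary_binary_def finite_small)
qed

end

context regular_base
begin

lemma large_above: "large (H :: 'a set) \<Longrightarrow> large {y \<in> H. prec x y}"
proof -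
  assume "large H"
  then have "large (H - {y. y = x \<or> prec y x})" by (rule large_Diff_small [OF _ small_atMost])
  then show ?thesis
  proof (rule large_mono, intro subsetI)
    fix y assume "y \<in> H - {y. y = x \<or> prec y x}"
    then show "y \<in> {y \<in> H. prec x y}" using prec_total [of x y] by auto
  qed
qed

lemma obtain_above:
  assumes "large (H :: 'a set)"
  obtains y where "y \<in> H" "prec x y"
  using large_nonempty [OF large_above [OF assms, of x]] by blast

lemma unary_never_inj_pairs: "(unary_binary_ops :: ('a \<Rightarrow> 'a \<Rightarrow> 'a) set) \<subseteq> never_inj_pairs"
proof
  fix u :: "'a \<Rightarrow> 'a \<Rightarrow> 'a" assume u: "u \<in> unary_binary_ops"
  show "u \<in> never_inj_pairs"
    unfolding never_inj_pairs_def
  proof (intro CollectI allI impI notI)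
    fix A :: "'a set" assume A: "large A" and inj: "inj_pairs u A"
    obtain x where x: "x \<in> A" using large_nonempty [OF A] by blast
    obtain y where y: "y \<in> A" "prec x y" by (rule obtain_above [OF A])
    obtain z where z: "z \<in> A" "prec y z" by (rule obtain_above [OF A])
    have xz: "prec x z" by (rule prec_trans [OF y(2) z(2)])
    consider g where "u = (\<lambda>x y. g x)" | g where "u = (\<lambda>x y. g y)"
      using u unfolding unary_binary_ops_def by blast
    then show False
    proof cases
      case 1
      then have "y = z" using inj_pairsD [OF inj x y(1) x z(1) y(2) xz] by simp
      then show False using z(2) by simp
    next
      case 2
      then have "x = y" using inj_pairsD [OF inj x z(1) y(1) z(1) xz z(2)] by simp
      then show False using y(2) by simp
    qed
  qed
qed

text \<open>Each \<open>q i\<close> takes few values, so by regularity one of its fibres still has a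
  large image under \<open>g\<close>; the finitely many \<open>q i\<close> are treated in
  turn.\<close>

lemma pigeonhole_constant:
  fixes q :: "'i \<Rightarrow> 'a \<Rightarrow> 'a" and g :: "'a \<Rightarrow> 'a"
  assumes "finite I" "\<And>i. i \<in> I \<Longrightarrow> small (range (q i))" "large (g ` Y)"
  shows "\<exists>Y'\<subseteq>Y. large (g ` Y') \<and> (\<forall>i\<in>I. \<exists>a. \<forall>y\<in>Y'. q i y = a)"
  using assms(1,2)
proof (induction I rule: finite_induct)
  case empty
  then show ?case using assms(3) by (intro exI [of _ Y]) simp
next
  case (insert i I)
  then obtain Y' where Y': "Y' \<subseteq> Y" "large (g ` Y')" "\<forall>i\<in>I. \<exists>a. \<forall>y\<in>Y'. q i y = a" by auto
  have "\<exists>a. large (g ` {y \<in> Y'. q i y = a})"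
  proof (rule ccontr)
    assume "\<not> ?thesis"
    then have "small (\<Union>a\<in>range (q i). g ` {y \<in> Y'. q i y = a})"
      using insert.prems by (intro small_UN) (auto simp: small_def)
    then have "small (g ` Y')" by (rule small_mono) auto
    then show False using Y'(2) by (simp add: small_def)
  qed
  then obtain a where a: "large (g ` {y \<in> Y'. q i y = a})" by blast
  have "\<exists>a'. \<forall>y\<in>{y \<in> Y'. q i y = a}. q j y = a'" if "j \<in> insert i I" for j
  proof (cases "j = i")
    case True
    then show ?thesis by blast
  next
    case False
    then have "j \<in> I" using that by simp
    then obtain a' where "\<forall>y\<in>Y'. q j y = a'" using Y'(3) by blast
    then show ?thesis by (intro exI [of _ a']) simp
  qed
  then show ?case using a Y'(1) by (intro exI [of _ "{y \<in> Y'. q i y = a}"]) auto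
qed

lemma large_image_remove:
  fixes g :: "'a \<Rightarrow> 'a"
  assumes "large (g ` Y)"
  shows "large (g ` (Y - {z}))"
proof (rule large_mono)
  show "large (g ` Y - {g z})" by (rule large_Diff_small [OF assms]) (simp add: finite_small)
qed auto

text \<open>Only one row and one column with large ranges matter. An operation with small rows is
  constant on a part of the row that still carries a large image, so a function of \<open>x\<close>
  copies it on both lines; if the columns are small, a function of \<open>y\<close> does.\<close>

lemma almost_unary_reduces: "reduces_to_unary (almost_unary_binary :: ('a \<Rightarrow> 'a \<Rightarrow> 'a) set)"
  unfolding reduces_to_unary_def
proof (intro allI impI)
  fix n and F :: "'a list \<Rightarrow> 'a" and t :: "nat \<Rightarrow> 'a \<Rightarrow> 'a \<Rightarrow> 'a"
  assume t: "\<forall>i<n. t i \<in> almost_unary_binary"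
    and h: "(\<lambda>x y. F (tup2 n t x y)) \<notin> almost_unary_binary"
  then obtain x0 y0 where x0: "large (range (\<lambda>y. F (tup2 n t x0 y)))"
    and y0: "large (range (\<lambda>x. F (tup2 n t x y0)))"
    by (auto simp: almost_unary_binary_def small_def)
  define I where "I = {i. i < n \<and> (\<forall>x. small (range (\<lambda>y. t i x y)))}"
  define J where "J = {i. i < n \<and> i \<notin> I}"
  have I: "small (range (t i x0))" if "i \<in> I" for i using that by (simp add: I_def)
  have J: "small (range (\<lambda>x. t i x y0))" if "i \<in> J" for i
    using that t by (auto simp: I_def J_def almost_unary_binary_def)
  obtain Y where Y: "large ((\<lambda>y. F (tup2 n t x0 y)) ` Y)" "\<forall>i\<in>I. \<exists>a. \<forall>y\<in>Y. t i x0 y = a"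
    using pigeonhole_constant [of I "\<lambda>i. t i x0", OF _ I x0] by (auto simp: I_def)
  obtain X where X: "large ((\<lambda>x. F (tup2 n t x y0)) ` X)" "\<forall>i\<in>J. \<exists>b. \<forall>x\<in>X. t i x y0 = b"
    using pigeonhole_constant [of J "\<lambda>i x. t i x y0", OF _ J y0] by (auto simp: J_def)
  from bchoice [OF Y(2)] obtain a where a: "\<And>i y. i \<in> I \<Longrightarrow> y \<in> Y \<Longrightarrow> t i x0 y = a i" by blast
  from bchoice [OF X(2)] obtain b where b: "\<And>i x. i \<in> J \<Longrightarrow> x \<in> X \<Longrightarrow> t i x y0 = b i" by blast
  \<comment> \<open>The two prescriptions may clash at the crossing point \<open>(x0, y0)\<close>,
    which is therefore left out on both lines.\<close>
  define u where "u i = (if i \<in> I then (\<lambda>x y. if x = x0 then a i else t i x y0)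
    else (\<lambda>x y. if y = y0 then b i else t i x0 y))" for i
  have "u i \<in> unary_binary_ops" for i
    using unary_binary_ops_I(1) [of "\<lambda>x. if x = x0 then a i else t i x y0"]
      unary_binary_ops_I(2) [of "\<lambda>y. if y = y0 then b i else t i x0 y"] by (simp add: u_def)
  moreover have "large (range (\<lambda>y. F (tup2 n u x0 y)))"
  proof (rule large_mono [OF large_image_remove [OF Y(1), of y0]])
    have "tup2 n u x0 y = tup2 n t x0 y" if "y \<in> Y - {y0}" for y
      by (rule tup2_eqI) (use a that in \<open>auto simp: u_def\<close>)
    then show "(\<lambda>y. F (tup2 n t x0 y)) ` (Y - {y0}) \<subseteq> range (\<lambda>y. F (tup2 n u x0 y))"
      by (metis (no_types, lifting) image_subsetI rangeI)
  qed
  moreover have "large (range (\<lambda>x. F (tup2 n u x y0)))"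
  proof (rule large_mono [OF large_image_remove [OF X(1), of x0]])
    have "tup2 n u x y0 = tup2 n t x y0" if "x \<in> X - {x0}" for x
      by (rule tup2_eqI) (use b that in \<open>auto simp: u_def J_def\<close>)
    then show "(\<lambda>x. F (tup2 n t x y0)) ` (X - {x0}) \<subseteq> range (\<lambda>x. F (tup2 n u x y0))"
      by (metis (no_types, lifting) image_subsetI rangeI)
  qed
  ultimately show "\<exists>u. (\<forall>i<n. u i \<in> unary_binary_ops) \<and> (\<lambda>x y. F (tup2 n u x y)) \<notin> almost_unary_binary"
    by (intro exI [of _ u]) (auto simp: almost_unary_binary_def small_def)
qed

end

context ramsey_base
begin

text \<open>No \<open>t i\<close> is injective on the increasing pairs of a large set, so the
  canonical form, applied to one coordinate after the other, makes all of them unary on the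
  increasing pairs of a common large set.\<close>

lemma never_inj_reduces: "reduces_to_unary (never_inj_pairs :: ('a \<Rightarrow> 'a \<Rightarrow> 'a) set)"
  unfolding reduces_to_unary_def
proof (intro allI impI)
  fix n and F :: "'a list \<Rightarrow> 'a" and t :: "nat \<Rightarrow> 'a \<Rightarrow> 'a \<Rightarrow> 'a"
  assume t: "\<forall>i<n. t i \<in> never_inj_pairs"
    and h: "(\<lambda>x y. F (tup2 n t x y)) \<notin> never_inj_pairs"
  then obtain A where A: "large A" "inj_pairs (\<lambda>x y. F (tup2 n t x y)) A"
    unfolding never_inj_pairs_def by blast
  have "\<exists>H\<subseteq>A. large H \<and> (\<forall>i<k. \<exists>w\<in>unary_binary_ops. \<forall>x\<in>H. \<forall>y\<in>H. prec x y \<longrightarrow> t i x y = w x y)"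
    if "k \<le> n" for k
    using that
  proof (induction k)
    case 0
    then show ?case using A(1) by (intro exI [of _ A]) simp
  next
    case (Suc k)
    then obtain H where H: "H \<subseteq> A" "large H"
      "\<forall>i<k. \<exists>w\<in>unary_binary_ops. \<forall>x\<in>H. \<forall>y\<in>H. prec x y \<longrightarrow> t i x y = w x y" by auto
    obtain H' where H': "H' \<subseteq> H" "large H'"
      "(\<exists>v. \<forall>x\<in>H'. \<forall>y\<in>H'. prec x y \<longrightarrow> t k x y = v x) \<or>
        (\<exists>v. \<forall>x\<in>H'. \<forall>y\<in>H'. prec x y \<longrightarrow> t k x y = v y) \<or> inj_pairs (t k) H'"
      by (rule canonical [OF H(2), of "t k"]) (rule that)
    have "\<not> inj_pairs (t k) H'"
      using t Suc.prems H'(2) unfolding never_inj_pairs_def by auto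
    with H'(3) have "(\<exists>v. \<forall>x\<in>H'. \<forall>y\<in>H'. prec x y \<longrightarrow> t k x y = v x) \<or>
        (\<exists>v. \<forall>x\<in>H'. \<forall>y\<in>H'. prec x y \<longrightarrow> t k x y = v y)" by blast
    then have k: "\<exists>w\<in>unary_binary_ops. \<forall>x\<in>H'. \<forall>y\<in>H'. prec x y \<longrightarrow> t k x y = w x y"
    proof (elim disjE exE)
      fix v assume "\<forall>x\<in>H'. \<forall>y\<in>H'. prec x y \<longrightarrow> t k x y = v x"
      then show ?thesis by (intro bexI [OF _ unary_binary_ops_I(1) [of v]])
    next
      fix v assume "\<forall>x\<in>H'. \<forall>y\<in>H'. prec x y \<longrightarrow> t k x y = v y"
      then show ?thesis by (intro bexI [OF _ unary_binary_ops_I(2) [of v]])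
    qed
    have "\<exists>w\<in>unary_binary_ops. \<forall>x\<in>H'. \<forall>y\<in>H'. prec x y \<longrightarrow> t i x y = w x y" if "i < Suc k" for i
    proof (cases "i = k")
      case False
      then have "i < k" using that by simp
      with H(3) have "\<exists>w\<in>unary_binary_ops. \<forall>x\<in>H. \<forall>y\<in>H. prec x y \<longrightarrow> t i x y = w x y" by blast
      then obtain w where w: "w \<in> unary_binary_ops" "\<forall>x\<in>H. \<forall>y\<in>H. prec x y \<longrightarrow> t i x y = w x y"
        by (elim bexE) (rule that)
      show ?thesis by (rule bexI [OF _ w(1)]) (use w(2) H'(1) in blast)
    qed (use k in simp)
    then show ?case using H(1) H'(1,2) by (intro exI [of _ H']) auto
  qed
  from this [of n] obtain H where H: "H \<subseteq> A" "large H"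
    "\<forall>i<n. \<exists>w\<in>unary_binary_ops. \<forall>x\<in>H. \<forall>y\<in>H. prec x y \<longrightarrow> t i x y = w x y" by auto
  then obtain u where u: "\<And>i. i < n \<Longrightarrow> u i \<in> unary_binary_ops"
    "\<And>i x y. i < n \<Longrightarrow> x \<in> H \<Longrightarrow> y \<in> H \<Longrightarrow> prec x y \<Longrightarrow> t i x y = u i x y" by metis
  have "inj_pairs (\<lambda>x y. F (tup2 n u x y)) H"
    unfolding inj_pairs_def
  proof (intro ballI impI)
    fix x y x' y' assume xy: "x \<in> H" "y \<in> H" "x' \<in> H" "y' \<in> H" "prec x y" "prec x' y'"
      and eq: "F (tup2 n u x y) = F (tup2 n u x' y')"
    have "tup2 n t x y = tup2 n u x y" "tup2 n t x' y' = tup2 n u x' y'"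
      by (rule tup2_eqI; rule u(2); (assumption | rule xy))+
    then have "F (tup2 n t x y) = F (tup2 n t x' y')" using eq by simp
    then show "x = x' \<and> y = y'"
      by (intro inj_pairsD [OF inj_pairs_mono [OF A(2) H(1)] xy])
  qed
  then have "(\<lambda>x y. F (tup2 n u x y)) \<notin> never_inj_pairs"
    using H(2) unfolding never_inj_pairs_def by blast
  then show "\<exists>u. (\<forall>i<n. u i \<in> unary_binary_ops) \<and> (\<lambda>x y. F (tup2 n u x y)) \<notin> never_inj_pairs"
    using u(1) by blast
qed

text \<open>The canonical form of \<open>\<lambda>p q. b q p\<close> splits the proof. Pairs with
  equal larger entries are exempt, since \<open>thinning\<close> compares a point only with earlier
  ones.\<close>

lemma inj_pairs_separated_from_converse:
  fixes b :: "'a \<Rightarrow> 'a \<Rightarrow> 'a"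
  assumes A: "large A" "inj_pairs b A"
  obtains H where "H \<subseteq> A" "large H"
    "\<And>r s p q. r \<in> H \<Longrightarrow> s \<in> H \<Longrightarrow> p \<in> H \<Longrightarrow> q \<in> H \<Longrightarrow> prec r s \<Longrightarrow> prec p q \<Longrightarrow> q \<noteq> s \<Longrightarrow> b r s \<noteq> b q p"
proof -
  note found = that
  have at_most_one: "small {y \<in> H. prec r y \<and> b r y = z}" if "H \<subseteq> A" "r \<in> A" for H r z
  proof (cases "\<exists>y0. y0 \<in> H \<and> prec r y0 \<and> b r y0 = z")
    case True
    then obtain y0 where y0: "y0 \<in> H" "prec r y0" "b r y0 = z" by blast
    have "{y \<in> H. prec r y \<and> b r y = z} \<subseteq> {y0}"
      using inj_pairsD [OF A(2) that(2) _ that(2)] y0 that(1) by blast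
    then show ?thesis by (rule small_mono [rotated]) (simp add: finite_small)
  next
    case False
    then have "{y \<in> H. prec r y \<and> b r y = z} = {}" by blast
    then show ?thesis by (simp only: small_empty)
  qed
  \<comment> \<open>If the converse is constant, at most one increasing pair has that value;
    deleting its larger point suffices.\<close>
  have const_case: thesis if K: "K \<subseteq> A" "large K" and k: "\<And>p q. p \<in> K \<Longrightarrow> q \<in> K \<Longrightarrow> prec p q \<Longrightarrow> b q p = v0" for K v0
  proof (cases "\<exists>r0 s0. r0 \<in> K \<and> s0 \<in> K \<and> prec r0 s0 \<and> b r0 s0 = v0")
    case True
    then obtain r0 s0 where rs: "r0 \<in> K" "s0 \<in> K" "prec r0 s0" "b r0 s0 = v0" by blast
    show thesis
    proof (rule found)
      show "K - {s0} \<subseteq> A" using K(1) by blast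
      show "large (K - {s0})" by (rule large_Diff_small [OF K(2)]) (simp add: finite_small)
      fix r s p q assume mem: "r \<in> K - {s0}" "s \<in> K - {s0}" "p \<in> K - {s0}" "q \<in> K - {s0}"
        and less: "prec r s" "prec p q"
      have "b q p = v0" using k mem less by blast
      moreover have "b r s \<noteq> v0"
        using inj_pairsD [OF inj_pairs_mono [OF A(2) K(1)], of r s r0 s0] mem less rs by auto
      ultimately show "b r s \<noteq> b q p" by simp
    qed
  next
    case False
    then show thesis by (intro found [OF K]) (metis k)
  qed
  \<comment> \<open>If each smaller entry \<open>p\<close> gives any value for few \<open>q\<close>
    only, the pair with the later larger entry can be thinned away from all earlier values.\<close>
  have spread_case: thesis if K: "K \<subseteq> A" "large K" and sp: "\<And>p z. p \<in> K \<Longrightarrow> small {q \<in> K. prec p q \<and> b q p = z}" for K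
  proof -
    define B where "B x1 x2 x3 = {y. prec x1 y \<and> b y x1 = b x2 x3} \<union> {y. prec x1 y \<and> b x1 y = b x3 x2}" for x1 x2 x3
    have small_B: "small (K \<inter> B x1 x2 x3)" if "x1 \<in> K" for x1 x2 x3
    proof (rule small_mono)
      show "small ({q \<in> K. prec x1 q \<and> b q x1 = b x2 x3} \<union> {y \<in> K. prec x1 y \<and> b x1 y = b x3 x2})"
        by (intro small_Un sp at_most_one) (use that K in auto)
    qed (auto simp: B_def)
    obtain H where H: "H \<subseteq> K" "large H" "\<And>x1 x2 x3 y. x1 \<in> H \<Longrightarrow> x2 \<in> H \<Longrightarrow> x3 \<in> H \<Longrightarrow> y \<in> H
      \<Longrightarrow> prec x1 y \<Longrightarrow> prec x2 y \<Longrightarrow> prec x3 y \<Longrightarrow> y \<notin> B x1 x2 x3"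
      by (rule thinning [of K B, OF K(2)]) (rule small_B, assumption, rule that)
    show thesis
    proof (rule found)
      show "H \<subseteq> A" using H(1) K(1) by blast
      show "large H" by (rule H(2))
      fix r s p q assume mem: "r \<in> H" "s \<in> H" "p \<in> H" "q \<in> H" and less: "prec r s" "prec p q" "q \<noteq> s"
      consider "prec s q" | "prec q s" using prec_total less(3) by metis
      then show "b r s \<noteq> b q p"
      proof cases
        case 1
        have "q \<notin> B p r s" by (rule H(3) [OF mem(3,1,2,4) less(2) prec_trans [OF less(1) 1] 1])
        then show ?thesis using less(2) by (auto simp: B_def)
      next
        case 2
        have "s \<notin> B r p q" by (rule H(3) [OF mem(1,3,4,2) less(1) prec_trans [OF less(2) 2] 2])
        then show ?thesis using less(1) by (auto simp: B_def)
      qed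
    qed
  qed
  obtain H1 where H1: "H1 \<subseteq> A" "large H1"
    and can: "(\<exists>v. \<forall>p\<in>H1. \<forall>q\<in>H1. prec p q \<longrightarrow> b q p = v p) \<or>
      (\<exists>v. \<forall>p\<in>H1. \<forall>q\<in>H1. prec p q \<longrightarrow> b q p = v q) \<or> inj_pairs (\<lambda>p q. b q p) H1"
    by (rule canonical [OF A(1), of "\<lambda>p q. b q p"]) (rule that)
  from can show thesis
  proof (elim disjE exE)
    fix v assume v: "\<forall>p\<in>H1. \<forall>q\<in>H1. prec p q \<longrightarrow> b q p = v p"
    show thesis
    proof (cases "\<exists>z. large {p \<in> H1. v p = z}")
      case True
      then obtain z where "large {p \<in> H1. v p = z}" by blast
      then show thesis by (rule const_case [rotated]) (use v H1(1) in auto)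
    next
      case False
      then have small_v: "small {p \<in> H1. v p = z}" for z by (simp add: small_def)
      obtain H2 where H2: "H2 \<subseteq> H1" "large H2"
        and dec: "\<And>r. small {s \<in> H2. b r s = v s} \<or> small {s \<in> H2. \<not> b r s = v s}"
        using decide_in [OF H1(2), of "\<lambda>r _ s. b r s = v s"] by metis
      have H2A: "H2 \<subseteq> A" using H1(1) H2(1) by blast
      \<comment> \<open>By injectivity on increasing pairs, two rows of \<open>b\<close> cannot both
        agree with \<open>v\<close> almost everywhere; so after deleting at most one row, the
        coincidences \<open>b r s = v s\<close> are few in each.\<close>
      have unique: "r = r'" if rr: "r \<in> H2" "r' \<in> H2"
        "small {s \<in> H2. \<not> b r s = v s}" "small {s \<in> H2. \<not> b r' s = v s}" for r r'
      proof -
        have "large {s \<in> {s \<in> H2. prec r s}. prec r' s}" by (intro large_above H2(2))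
        moreover have "small ({s \<in> H2. \<not> b r s = v s} \<union> {s \<in> H2. \<not> b r' s = v s})"
          by (rule small_Un [OF rr(3,4)])
        ultimately obtain s where "s \<in> {s \<in> {s \<in> H2. prec r s}. prec r' s}"
          "s \<notin> {s \<in> H2. \<not> b r s = v s} \<union> {s \<in> H2. \<not> b r' s = v s}" by (rule large_obtain)
        then have "s \<in> H2" "prec r s" "prec r' s" "b r s = b r' s" by auto
        then show "r = r'" using inj_pairsD [OF inj_pairs_mono [OF A(2) H2A] rr(1) _ rr(2)] by blast
      qed
      obtain H3 where H3: "H3 \<subseteq> H2" "large H3" "\<And>r. r \<in> H3 \<Longrightarrow> small {s \<in> H2. b r s = v s}"
      proof (cases "\<exists>r0\<in>H2. small {s \<in> H2. \<not> b r0 s = v s}")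
        case True
        then obtain r0 where r0: "r0 \<in> H2" "small {s \<in> H2. \<not> b r0 s = v s}" by blast
        have "large (H2 - {r0})" by (rule large_Diff_small [OF H2(2)]) (simp add: finite_small)
        moreover have "small {s \<in> H2. b r s = v s}" if "r \<in> H2 - {r0}" for r
          using dec [of r] unique [OF _ r0(1) _ r0(2), of r] that by blast
        ultimately show thesis using that [of "H2 - {r0}"] by blast
      next
        case False
        then show thesis using dec by (intro that [OF subset_refl H2(2)]) blast
      qed
      \<comment> \<open>The three exclusions handle \<open>b r s = v p\<close> with \<open>p\<close>
        after \<open>s\<close>, before \<open>s\<close> and equal to \<open>s\<close>.\<close>
      define B where "B x1 x2 x3 = {y. v y = b x2 x3} \<union> {y. prec x1 y \<and> b x1 y = v x2} \<union> {y. b x1 y = v y}"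
        for x1 x2 x3
      have small_B: "small (H3 \<inter> B x1 x2 x3)" if x1: "x1 \<in> H3" for x1 x2 x3
      proof (rule small_mono)
        have "x1 \<in> A" "H3 \<subseteq> A" using x1 H3(1) H2A by blast+
        then show "small ({y \<in> H1. v y = b x2 x3} \<union> {y \<in> H3. prec x1 y \<and> b x1 y = v x2}
            \<union> {s \<in> H2. b x1 s = v s})"
          by (intro small_Un small_v at_most_one H3(3) x1)
      qed (use H3(1) H2(1) in \<open>auto simp: B_def\<close>)
      obtain H where H: "H \<subseteq> H3" "large H" "\<And>x1 x2 x3 y. x1 \<in> H \<Longrightarrow> x2 \<in> H \<Longrightarrow> x3 \<in> H \<Longrightarrow> y \<in> H
        \<Longrightarrow> prec x1 y \<Longrightarrow> prec x2 y \<Longrightarrow> prec x3 y \<Longrightarrow> y \<notin> B x1 x2 x3"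
        by (rule thinning [of H3 B, OF H3(2)]) (rule small_B, assumption, rule that)
      show thesis
      proof (rule that)
        show "H \<subseteq> A" using H(1) H3(1) H2(1) H1(1) by blast
        show "large H" by (rule H(2))
        fix r s p q assume mem: "r \<in> H" "s \<in> H" "p \<in> H" "q \<in> H" and less: "prec r s" "prec p q"
        have bv: "b q p = v p" using v mem less(2) H(1) H3(1) H2(1) by blast
        consider "p = s" | "prec s p" | "prec p s" using prec_total by metis
        then show "b r s \<noteq> b q p"
        proof cases
          case 1
          have "s \<notin> B r r r" by (rule H(3) [OF mem(1,1,1,2) less(1) less(1) less(1)])
          then show ?thesis using bv 1 by (auto simp: B_def)
        next
          case 2
          have rp: "prec r p" by (rule prec_trans [OF less(1) 2])
          have "p \<notin> B r r s" by (rule H(3) [OF mem(1,1,2,3) rp rp 2])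
          then show ?thesis using bv by (auto simp: B_def)
        next
          case 3
          have "s \<notin> B r p r" by (rule H(3) [OF mem(1,3,1,2) less(1) 3 less(1)])
          then show ?thesis using bv less(1) by (auto simp: B_def)
        qed
      qed
    qed
  next
    fix v assume v: "\<forall>p\<in>H1. \<forall>q\<in>H1. prec p q \<longrightarrow> b q p = v q"
    show thesis
    proof (cases "\<exists>z. large {p \<in> H1. v p = z}")
      case True
      then obtain z where "large {p \<in> H1. v p = z}" by blast
      then show thesis by (rule const_case [rotated]) (use v H1(1) in auto)
    next
      case False
      show thesis
      proof (rule spread_case [OF H1])
        fix p z assume "p \<in> H1"
        have "small {q \<in> H1. v q = z}" using False by (simp add: small_def)
        then show "small {q \<in> H1. prec p q \<and> b q p = z}"
          by (rule small_mono) (use v \<open>p \<in> H1\<close> in auto)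
      qed
    qed
  next
    assume inj: "inj_pairs (\<lambda>p q. b q p) H1"
    show thesis
    proof (rule spread_case [OF H1])
      fix p z assume p: "p \<in> H1"
      show "small {q \<in> H1. prec p q \<and> b q p = z}"
      proof (cases "\<exists>q0. q0 \<in> H1 \<and> prec p q0 \<and> b q0 p = z")
        case True
        then obtain q0 where q0: "q0 \<in> H1" "prec p q0" "b q0 p = z" by blast
        have "{q \<in> H1. prec p q \<and> b q p = z} \<subseteq> {q0}"
          using inj_pairsD [OF inj p _ p] q0 by blast
        then show ?thesis by (rule small_mono [rotated]) (simp add: finite_small)
      next
        case False
        then have "{q \<in> H1. prec p q \<and> b q p = z} = {}" by blast
        then show ?thesis by (simp only: small_empty)
      qed
    qed
  qed
qed

end

lemma binary_part_unary_subst_D: "b \<in> binary_part (unary_subst_clone T) \<Longrightarrow> b \<in> T"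
proof -
  assume "b \<in> binary_part (unary_subst_clone T)"
  then have "\<forall>u\<in>unary_binary_ops. \<forall>v\<in>unary_binary_ops. (\<lambda>x y. b (u x y) (v x y)) \<in> T"
    by (simp only: binary_part_unary_subst_iff)
  from bspec [OF bspec [OF this unary_binary_ops_I(1) [of "\<lambda>x. x"]] unary_binary_ops_I(2) [of "\<lambda>x. x"]]
  show "b \<in> T" .
qed

section \<open>Two incomparable clones and generation above the unary operations\<close>

context ramsey_base
begin

abbreviation "clone1 \<equiv> unary_subst_clone (almost_unary_binary :: ('a \<Rightarrow> 'a \<Rightarrow> 'a) set)"
abbreviation "clone2 \<equiv> unary_subst_clone (never_inj_pairs :: ('a \<Rightarrow> 'a \<Rightarrow> 'a) set)"

text \<open>Each \<open>e2 x\<close> sits between \<open>e1 x\<close> and all later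
  \<open>e1 y\<close>, so the two ranges are disjoint and even equal arguments become an increasing
  pair.\<close>

lemma interleaved_embeddings:
  assumes H: "large (H :: 'a set)"
  obtains e1 e2 :: "'a \<Rightarrow> 'a" where "\<And>x. e1 x \<in> H" "\<And>x. e2 x \<in> H" "\<And>x. prec (e1 x) (e2 x)"
    "\<And>x y. prec x y \<Longrightarrow> prec (e2 x) (e1 y)"
proof -
  have "\<exists>z. z \<in> H \<and> prec x z" for x using obtain_above [OF H, of x] by blast
  then obtain \<sigma> where \<sigma>: "\<And>x. \<sigma> x \<in> H" "\<And>x. prec x (\<sigma> x)" by metis
  let ?conf = "\<lambda>x y. \<not> prec (\<sigma> x) y"
  have small_conf: "small {y \<in> H. ?conf x y}" for x
  proof (rule small_mono [OF small_atMost [of "\<sigma> x"]], intro subsetI)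
    fix y assume "y \<in> {y \<in> H. ?conf x y}"
    then show "y \<in> {y. y = \<sigma> x \<or> prec y (\<sigma> x)}" using prec_total [of y "\<sigma> x"] by auto
  qed
  obtain c :: "'a \<Rightarrow> 'a" where c: "\<And>t. c t \<in> H" "\<And>s t. prec s t \<Longrightarrow> \<not> ?conf (c s) (c t)"
    by (rule selection [where W = "\<lambda>t. H" and conf = ?conf, OF H small_conf]) (rule that)
  show thesis by (rule that [of c "\<lambda>x. \<sigma> (c x)"]) (use c \<sigma> in auto)
qed

text \<open>The interleaved embeddings turn \<open>x \<preceq> y\<close> into an increasing pair and
  the opposite into a decreasing one; as their ranges are disjoint, the exempt case of equal larger
  entries does not occur.\<close>

lemma order_separating:
  assumes D: "is_clone D" "unary_part D = UNIV" "\<not> D \<subseteq> clone2"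
  obtains g where "g \<in> binary_part D"
    "\<And>x y x' y'. \<not> prec y x \<Longrightarrow> \<not> prec y' x' \<Longrightarrow> g x y = g x' y' \<Longrightarrow> x = x' \<and> y = (y' :: 'a)"
    "\<And>x y x' y'. \<not> prec y x \<Longrightarrow> prec y' x' \<Longrightarrow> g x y \<noteq> g x' y'"
proof -
  obtain b where b: "b \<in> binary_part D" "b \<notin> never_inj_pairs" by (rule not_subset_unary_subst [OF D])
  then obtain A where A: "large A" "inj_pairs b A" unfolding never_inj_pairs_def by blast
  obtain H where H: "H \<subseteq> A" "large H"
    "\<And>r s p q. r \<in> H \<Longrightarrow> s \<in> H \<Longrightarrow> p \<in> H \<Longrightarrow> q \<in> H \<Longrightarrow> prec r s \<Longrightarrow> prec p q \<Longrightarrow> q \<noteq> s \<Longrightarrow> b r s \<noteq> b q p"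
    by (rule inj_pairs_separated_from_converse [OF A]) (rule that)
  obtain e1 e2 :: "'a \<Rightarrow> 'a" where e: "\<And>x. e1 x \<in> H" "\<And>x. e2 x \<in> H" "\<And>x. prec (e1 x) (e2 x)"
    "\<And>x y. prec x y \<Longrightarrow> prec (e2 x) (e1 y)"
    by (rule interleaved_embeddings [OF H(2)]) (rule that)
  have e1_mono: "prec (e1 x) (e1 y)" if "prec x y" for x y
    by (rule prec_trans [OF e(3) e(4) [OF that]])
  have e2_mono: "prec (e2 x) (e2 y)" if "prec x y" for x y
    by (rule prec_trans [OF e(4) [OF that] e(3)])
  have e1_inj: "x = y" if "e1 x = e1 y" for x y
    using e1_mono [of x y] e1_mono [of y x] prec_total [of x y] that by (metis prec_irrefl)
  have e2_inj: "x = y" if "e2 x = e2 y" for x y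
    using e2_mono [of x y] e2_mono [of y x] prec_total [of x y] that by (metis prec_irrefl)
  have le: "prec (e1 x) (e2 y)" if "\<not> prec y x" for x y
  proof (cases "x = y")
    case False
    then have "prec x y" using that prec_total by metis
    then show ?thesis by (rule prec_trans [OF e1_mono e(3)])
  qed (simp add: e(3))
  have ne: "e1 x \<noteq> e2 y" for x y
  proof (cases "prec y x")
    case True
    from e(4) [OF this] show ?thesis by (metis prec_irrefl)
  next
    case False
    from le [OF this] show ?thesis by (metis prec_irrefl)
  qed
  show thesis
  proof (rule that)
    have "e1 \<in> unary_part D" "e2 \<in> unary_part D" using D(2) by simp_all
    then show "(\<lambda>x y. b (e1 x) (e2 y)) \<in> binary_part D" by (rule binary_unary_args [OF D(1) b(1)])
    show "x = x' \<and> y = y'"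
      if "\<not> prec y x" "\<not> prec y' x'" "b (e1 x) (e2 y) = b (e1 x') (e2 y')" for x y x' y'
      using inj_pairsD [OF inj_pairs_mono [OF A(2) H(1)] e(1) e(2) e(1) e(2) le [OF that(1)] le [OF that(2)] that(3)]
        e1_inj e2_inj by blast
    show "b (e1 x) (e2 y) \<noteq> b (e1 x') (e2 y')" if "\<not> prec y x" "prec y' x'" for x y x' y'
      by (rule H(3) [OF e(1) e(2) e(2) e(1) le [OF that(1)] e(4) [OF that(2)] ne])
  qed
qed

text \<open>With \<open>g\<close> recognising the order of its arguments, \<open>b\<close> can be evaluated on the line \<open>x0\<close> for
  \<open>x \<preceq> y\<close> and on the line \<open>y0\<close> otherwise, injectively and with disjoint sets of values.\<close>

theorem full_above_both:
  assumes D: "is_clone D" "unary_part D = UNIV" "\<not> D \<subseteq> clone1" "\<not> D \<subseteq> clone2"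
  shows "D = all_ops"
proof -
  obtain g where g: "g \<in> binary_part D"
    "\<And>x y x' y'. \<not> prec y x \<Longrightarrow> \<not> prec y' x' \<Longrightarrow> g x y = g x' y' \<Longrightarrow> x = x' \<and> y = (y' :: 'a)"
    "\<And>x y x' y'. \<not> prec y x \<Longrightarrow> prec y' x' \<Longrightarrow> g x y \<noteq> g x' y'"
    by (rule order_separating [OF D(1,2,4)]) (rule that)
  obtain b where b: "b \<in> binary_part D" "b \<notin> almost_unary_binary"
    by (rule not_subset_unary_subst [OF D(1,2,3)])
  then obtain x0 y0 where x0: "large (range (\<lambda>y. b x0 y))" and y0: "large (range (\<lambda>x. b x y0))"
    by (auto simp: almost_unary_binary_def small_def)
  \<comment> \<open>Row and column may have the same range; shrinking that of the row leaves both
    with large disjoint sets of values.\<close>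
  obtain S1 where S1: "S1 \<subseteq> range (\<lambda>y. b x0 y)" "large S1"
    and S2: "\<And>L. L \<in> {range (\<lambda>x. b x y0)} \<Longrightarrow> large (L - S1)"
    by (rule large_subset_avoiding [of "{range (\<lambda>x. b x y0)}", OF _ x0]) (use y0 that in auto)
  define S2 where "S2 = range (\<lambda>x. b x y0) - S1"
  have S2: "large S2" using S2 by (simp add: S2_def)
  obtain pair :: "'a \<times> 'a \<Rightarrow> 'a" where pair: "bij pair" by (rule pairing_exists)
  have pair_eq: "pair p = pair q \<longleftrightarrow> p = q" for p q using pair by (simp add: bij_is_inj inj_eq)
  obtain j1 where j1: "bij_betw j1 (UNIV :: 'a set) S1" by (rule large_bij [OF large_UNIV S1(2)])
  obtain j2 where j2: "bij_betw j2 (UNIV :: 'a set) S2" by (rule large_bij [OF large_UNIV S2])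
  have j1_eq: "j1 x = j1 y \<longleftrightarrow> x = y" for x y using j1 by (simp add: bij_betw_def inj_eq)
  have j2_eq: "j2 x = j2 y \<longleftrightarrow> x = y" for x y using j2 by (simp add: bij_betw_def inj_eq)
  have j1_in: "j1 x \<in> S1" and j2_in: "j2 x \<in> S2" for x using j1 j2 by (auto simp: bij_betw_def)
  have "\<exists>y. b x0 y = j1 x" for x using j1_in [of x] S1(1) by (metis imageE subsetD)
  then obtain k1 where k1: "\<And>x. b x0 (k1 x) = j1 x" by metis
  have "\<exists>y. b y y0 = j2 x" for x using j2_in [of x] unfolding S2_def by (metis DiffD1 imageE)
  then obtain k2 where k2: "\<And>x. b (k2 x) y0 = j2 x" by metis
  \<comment> \<open>\<open>u\<close> decodes \<open>g x y\<close>: it moves along the line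
    \<open>x0\<close> if \<open>x \<preceq> y\<close> and rests at \<open>y0\<close> otherwise.
    \<open>v\<close> decodes \<open>g y x\<close>, with the roles exchanged; on the diagonal only
    \<open>u\<close> moves.\<close>
  define u where "u z = (if \<exists>p. \<not> prec (snd p) (fst p) \<and> g (fst p) (snd p) = z
    then k1 (pair (SOME p. \<not> prec (snd p) (fst p) \<and> g (fst p) (snd p) = z)) else y0)" for z
  define v where "v z = (if \<exists>p. prec (snd p) (fst p) \<and> g (snd p) (fst p) = z
    then k2 (pair (SOME p. prec (snd p) (fst p) \<and> g (snd p) (fst p) = z)) else x0)" for z
  have u1: "u (g x y) = k1 (pair (x, y))" if "\<not> prec y x" for x y
  proof -
    have "(SOME p. \<not> prec (snd p) (fst p) \<and> g (fst p) (snd p) = g x y) = (x, y)"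
    proof (rule some_equality)
      fix p assume p: "\<not> prec (snd p) (fst p) \<and> g (fst p) (snd p) = g x y"
      then have "fst p = x \<and> snd p = y" using g(2) [OF conjunct1 [OF p] that] by blast
      then show "p = (x, y)" by (simp add: prod_eq_iff)
    qed (use that in simp)
    moreover have "\<exists>p. \<not> prec (snd p) (fst p) \<and> g (fst p) (snd p) = g x y"
      by (rule exI [of _ "(x, y)"]) (use that in simp)
    ultimately show ?thesis by (simp add: u_def)
  qed
  have u2: "u (g x y) = y0" if xy: "prec y x" for x y
  proof -
    have "g (fst p) (snd p) \<noteq> g x y" if "\<not> prec (snd p) (fst p)" for p by (rule g(3) [OF that xy])
    then show ?thesis by (auto simp: u_def)
  qed
  have v1: "v (g y x) = k2 (pair (x, y))" if xy: "prec y x" for x y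
  proof -
    have xy': "\<not> prec x y" by (rule prec_asym [OF xy])
    have "(SOME p. prec (snd p) (fst p) \<and> g (snd p) (fst p) = g y x) = (x, y)"
    proof (rule some_equality)
      fix p assume p: "prec (snd p) (fst p) \<and> g (snd p) (fst p) = g y x"
      have "\<not> prec (fst p) (snd p)" by (rule prec_asym [OF conjunct1 [OF p]])
      from g(2) [OF this xy'] p have "snd p = y \<and> fst p = x" by blast
      then show "p = (x, y)" by (simp add: prod_eq_iff)
    qed (use xy in simp)
    moreover have "\<exists>p. prec (snd p) (fst p) \<and> g (snd p) (fst p) = g y x"
      by (rule exI [of _ "(x, y)"]) (use xy in simp)
    ultimately show ?thesis by (simp add: v_def)
  qed
  have v2: "v (g y x) = x0" if xy: "\<not> prec y x" for x y
  proof -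
    have "g (snd p) (fst p) \<noteq> g y x" if p: "prec (snd p) (fst p)" for p
    proof
      assume eq: "g (snd p) (fst p) = g y x"
      have p': "\<not> prec (fst p) (snd p)" by (rule prec_asym [OF p])
      show False
      proof (cases "prec x y")
        case True
        from g(3) [OF p' True] show False using eq by blast
      next
        case False
        from g(2) [OF p' False eq] have "snd p = y \<and> fst p = x" .
        then show False using p xy by simp
      qed
    qed
    then show ?thesis by (auto simp: v_def)
  qed
  define f where "f x y = b (v (g y x)) (u (g x y))" for x y
  have f1: "f x y = j1 (pair (x, y))" if "\<not> prec y x" for x y
    using that by (simp add: f_def u1 v2 k1)
  have f2: "f x y = j2 (pair (x, y))" if "prec y x" for x y
    using that by (simp add: f_def u2 v1 k2)
  have uv: "u \<in> unary_part D" "v \<in> unary_part D" using D(2) by simp_all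
  have "(\<lambda>x y. g y x) \<in> binary_part D"
    by (rule binary_binary [OF D(1) g(1) snd_binary_part [OF D(1)] fst_binary_part [OF D(1)]])
  from binary_binary [OF D(1) b(1) unary_binary [OF D(1) uv(2) this] unary_binary [OF D(1) uv(1) g(1)]]
  have "f \<in> binary_part D" by (simp add: f_def [abs_def])
  then show ?thesis
  proof (rule clone_full [OF D(1,2), of f "\<lambda>x. x"])
    have disj: "j1 p \<noteq> j2 q" for p q using j1_in [of p] j2_in [of q] by (auto simp: S2_def)
    fix x y x' y' assume eq: "f x y = f x' y'"
    show "x = x' \<and> y = y'"
    proof (cases "prec y x"; cases "prec y' x'")
      assume 1: "prec y x" "prec y' x'"
      then show ?thesis using eq by (simp add: f2 j2_eq pair_eq)
    next
      assume 2: "prec y x" "\<not> prec y' x'"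
      then show ?thesis using eq disj [of "pair (x', y')" "pair (x, y)"] by (simp add: f1 f2)
    next
      assume 3: "\<not> prec y x" "prec y' x'"
      then show ?thesis using eq disj [of "pair (x, y)" "pair (x', y')"] by (simp add: f1 f2)
    next
      assume 4: "\<not> prec y x" "\<not> prec y' x'"
      then show ?thesis using eq by (simp add: f1 j1_eq pair_eq)
    qed
  qed
qed

lemma clone1_clone:
  "is_clone clone1" "unary_part clone1 = UNIV" "clone1 \<noteq> all_ops"
proof -
  show "is_clone clone1"
    by (rule is_clone_unary_subst [OF unary_almost_unary_binary almost_unary_reduces])
  show "unary_part clone1 = UNIV" by (rule unary_part_unary_subst [OF unary_almost_unary_binary])
  obtain pair :: "'a \<times> 'a \<Rightarrow> 'a" where pair: "bij pair" by (rule pairing_exists)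
  have pair_eq: "pair p = pair q \<longleftrightarrow> p = q" for p q using pair by (simp add: bij_is_inj inj_eq)
  show "clone1 \<noteq> all_ops"
  proof
    assume "clone1 = all_ops"
    then have "(\<lambda>x y. pair (x, y)) \<in> binary_part clone1" by (simp add: binary_part_def op_of_all_ops)
    then have "(\<lambda>x y. pair (x, y)) \<in> almost_unary_binary"
      by (rule binary_part_unary_subst_D)
    moreover have "large (range (\<lambda>y. pair (x, y)))" "large (range (\<lambda>x. pair (x, y)))" for x y
      by (subst large_image; auto simp: inj_on_def pair_eq)+
    ultimately show False by (auto simp: almost_unary_binary_def small_def)
  qed
qed

lemma clone2_clone:
  "is_clone clone2" "unary_part clone2 = UNIV" "clone2 \<noteq> all_ops"
proof -
  show "is_clone clone2"
    by (rule is_clone_unary_subst [OF unary_never_inj_pairs never_inj_reduces])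
  show "unary_part clone2 = UNIV" by (rule unary_part_unary_subst [OF unary_never_inj_pairs])
  obtain pair :: "'a \<times> 'a \<Rightarrow> 'a" where pair: "bij pair" by (rule pairing_exists)
  have pair_eq: "pair p = pair q \<longleftrightarrow> p = q" for p q using pair by (simp add: bij_is_inj inj_eq)
  show "clone2 \<noteq> all_ops"
  proof
    assume "clone2 = all_ops"
    then have "(\<lambda>x y. pair (x, y)) \<in> binary_part clone2" by (simp add: binary_part_def op_of_all_ops)
    then have "(\<lambda>x y. pair (x, y)) \<in> never_inj_pairs"
      by (rule binary_part_unary_subst_D)
    then have "\<not> inj_pairs (\<lambda>x y. pair (x, y)) (UNIV :: 'a set)"
      using large_UNIV unfolding never_inj_pairs_def by blast
    then show False by (simp add: inj_pairs_def pair_eq)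
  qed
qed

text \<open>The pairing confined to \<open>x\<close> before \<open>y\<close> has small columns,
  because initial segments are small, and is injective on increasing pairs.\<close>

lemma clone1_not_sub: "\<not> clone1 \<subseteq> clone2"
proof
  assume sub: "clone1 \<subseteq> clone2"
  obtain pair :: "'a \<times> 'a \<Rightarrow> 'a" where pair: "bij pair" by (rule pairing_exists)
  have pair_eq: "pair p = pair q \<longleftrightarrow> p = q" for p q using pair by (simp add: bij_is_inj inj_eq)
  define f where "f x y = (if prec x y then pair (x, y) else undefined)" for x y :: 'a
  have small_f: "small (range (\<lambda>x. f (h x) y))" for h and y
  proof (rule small_mono)
    show "small ((\<lambda>x. pair (x, y)) ` {x. prec x y} \<union> {undefined})"
      by (intro small_Un small_image small_below) (simp add: finite_small)
  qed (auto simp: f_def)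
  have "(\<lambda>x y. f (u x y) (v x y)) \<in> almost_unary_binary"
    if "u \<in> unary_binary_ops" "v \<in> unary_binary_ops" for u v
  proof -
    consider h where "v = (\<lambda>x y. h x)" | h where "v = (\<lambda>x y. h y)"
      using \<open>v \<in> unary_binary_ops\<close> unfolding unary_binary_ops_def by blast
    then show ?thesis
    proof cases
      case 1
      have "small (range (\<lambda>y. f (u x y) (h x)))" for x by (rule small_f)
      then show ?thesis using 1 by (simp add: almost_unary_binary_def)
    next
      case 2
      have "small (range (\<lambda>x. f (u x y) (h y)))" for y by (rule small_f)
      then show ?thesis using 2 by (simp add: almost_unary_binary_def)
    qed
  qed
  then have "f \<in> binary_part clone1" unfolding binary_part_unary_subst_iff by blast
  then have "f \<in> binary_part clone2" using sub unfolding binary_part_def by blast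
  then have "f \<in> never_inj_pairs"
    by (rule binary_part_unary_subst_D)
  then have "\<not> inj_pairs f (UNIV :: 'a set)"
    using large_UNIV unfolding never_inj_pairs_def by blast
  then show False by (auto simp: inj_pairs_def f_def pair_eq)
qed

text \<open>\<open>f\<close> is onto on both lines through \<open>o0\<close> and constant off them.
  Two points below three others already give a coincidence for \<open>f (u x) (v y)\<close>: at most
  one \<open>v y\<close> is \<open>o0\<close>, and for the other two either both \<open>u x\<close>
  are \<open>o0\<close> or some \<open>u x\<close> gives the value \<open>o0\<close> twice.\<close>

lemma clone2_not_sub: "\<not> clone2 \<subseteq> clone1"
proof
  assume sub: "clone2 \<subseteq> clone1"
  define o0 where "o0 = (undefined :: 'a)"
  define f where "f x y = (if y = o0 then x else if x = o0 then y else o0)" for x y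
  have f_sym: "f x y = f y x" for x y by (simp add: f_def)
  have no_inj: False if A: "large A" and inj: "inj_pairs (\<lambda>x y. f (u x) (v y)) A" for u v and A :: "'a set"
  proof -
    obtain x1 where x1: "x1 \<in> A" using large_nonempty [OF A] by blast
    obtain x2 where x2: "x2 \<in> A" "prec x1 x2" by (rule obtain_above [OF A])
    obtain y1 where y1: "y1 \<in> A" "prec x2 y1" by (rule obtain_above [OF A])
    obtain y2 where y2: "y2 \<in> A" "prec y1 y2" by (rule obtain_above [OF A])
    obtain y3 where y3: "y3 \<in> A" "prec y2 y3" by (rule obtain_above [OF A])
    have o1: "prec x1 y1" "prec x2 y2" "prec x2 y3" "prec y1 y3"
      using prec_trans x2(2) y1(2) y2(2) y3(2) by metis+
    then have o2: "prec x1 y2" "prec x1 y3" using prec_trans x2(2) by metis+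
    have distinct: "x1 \<noteq> x2" "y1 \<noteq> y2" "y1 \<noteq> y3" "y2 \<noteq> y3"
      using x2(2) y2(2) y3(2) o1(4) by (metis prec_irrefl)+
    have key: "False" if "v y \<noteq> o0" "v y' \<noteq> o0" "y \<noteq> y'" "y \<in> A" "y' \<in> A"
      "prec x1 y" "prec x2 y" "prec x1 y'" "prec x2 y'" for y y'
    proof (cases "u x1 = o0 \<and> u x2 = o0")
      case True
      then have "f (u x1) (v y) = f (u x2) (v y)" by simp
      then show False using inj_pairsD [OF inj x1 that(4) x2(1) that(4) that(6,7)] distinct(1) by blast
    next
      case False
      then obtain x where x: "x \<in> {x1, x2}" "u x \<noteq> o0" by auto
      have "f (u x) (v y) = f (u x) (v y')" using x(2) that(1,2) by (simp add: f_def)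
      moreover have "x \<in> A" "prec x y" "prec x y'" using x(1) x1 x2(1) that by auto
      ultimately show False using inj_pairsD [OF inj _ that(4) _ that(5)] that(3) by blast
    qed
    have zero: "y = y'" if "v y = o0" "v y' = o0" "y \<in> A" "y' \<in> A" "prec x1 y" "prec x1 y'" for y y'
    proof -
      have "f (u x1) (v y) = f (u x1) (v y')" using that(1,2) by simp
      then show ?thesis using inj_pairsD [OF inj x1 that(3) x1 that(4) that(5,6)] by blast
    qed
    consider "v y1 \<noteq> o0" "v y2 \<noteq> o0" | "v y1 \<noteq> o0" "v y3 \<noteq> o0" | "v y2 \<noteq> o0" "v y3 \<noteq> o0"
      using zero [of y1 y2] zero [of y1 y3] zero [of y2 y3] distinct y1(1) y2(1) y3(1) o1 o2 by metis
    then show False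
    proof cases
      case 1
      then show False by (rule key) (use distinct y1 y2 o1 o2 in auto)
    next
      case 2
      then show False by (rule key) (use distinct y1 y3 o1 o2 in auto)
    next
      case 3
      then show False by (rule key) (use distinct y2 y3 o1 o2 in auto)
    qed
  qed
  have "(\<lambda>x y. f (u x y) (v x y)) \<in> never_inj_pairs"
    if "u \<in> unary_binary_ops" "v \<in> unary_binary_ops" for u v
  proof -
    have unary: "(\<lambda>x y. h x) \<in> never_inj_pairs" "(\<lambda>x y. h y) \<in> never_inj_pairs" for h :: "'a \<Rightarrow> 'a"
      using unary_never_inj_pairs unary_binary_ops_I by blast+
    have mixed: "(\<lambda>x y. f (h x) (k y)) \<in> never_inj_pairs" for h k
      using no_inj unfolding never_inj_pairs_def by blast
    consider g h where "u = (\<lambda>x y. g x)" "v = (\<lambda>x y. h x)" | g h where "u = (\<lambda>x y. g y)" "v = (\<lambda>x y. h y)"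
      | g h where "u = (\<lambda>x y. g x)" "v = (\<lambda>x y. h y)" | g h where "u = (\<lambda>x y. g y)" "v = (\<lambda>x y. h x)"
      using \<open>u \<in> unary_binary_ops\<close> \<open>v \<in> unary_binary_ops\<close> unfolding unary_binary_ops_def by blast
    then show ?thesis
    proof cases
      case 1
      then show ?thesis using unary(1) [of "\<lambda>x. f (g x) (h x)"] by simp
    next
      case 2
      then show ?thesis using unary(2) [of "\<lambda>x. f (g x) (h x)"] by simp
    next
      case 3
      then show ?thesis using mixed by simp
    next
      case 4
      then show ?thesis using mixed [of h g] f_sym by simp
    qed
  qed
  then have "f \<in> binary_part clone2" unfolding binary_part_unary_subst_iff by blast
  then have "f \<in> binary_part clone1" using sub unfolding binary_part_def by blast
  then have "f \<in> almost_unary_binary"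
    by (rule binary_part_unary_subst_D)
  moreover have "range (\<lambda>y. f o0 y) = UNIV" "range (\<lambda>x. f x o0) = UNIV" by (auto simp: f_def image_def)
  ultimately show False unfolding almost_unary_binary_def by (auto simp: small_def) (metis large_UNIV)+
qed

theorem two_precomplete_above_unary:
  "{C :: 'a operation set. precomplete C \<and> nary_ops 1 \<subseteq> C} = {clone1, clone2}"
proof
  have above: "unary_part D = UNIV" if "C \<subseteq> D" "unary_part C = UNIV" for C D :: "'a operation set"
    using that unfolding unary_part_def by blast
  have "precomplete clone1"
  proof (rule precompleteI [OF clone1_clone(1,3)])
    fix D assume D: "is_clone D" "clone1 \<subseteq> D" "D \<noteq> clone1"
    show "D = all_ops"
      by (rule full_above_both [OF D(1) above [OF D(2) clone1_clone(2)]])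
        (use D clone1_not_sub in blast)+
  qed
  moreover have "precomplete clone2"
  proof (rule precompleteI [OF clone2_clone(1,3)])
    fix D assume D: "is_clone D" "clone2 \<subseteq> D" "D \<noteq> clone2"
    show "D = all_ops"
      by (rule full_above_both [OF D(1) above [OF D(2) clone2_clone(2)]])
        (use D clone2_not_sub in blast)+
  qed
  ultimately show "{clone1, clone2} \<subseteq> {C :: 'a operation set. precomplete C \<and> nary_ops 1 \<subseteq> C}"
    unfolding nary_ops_1_subset_iff using clone1_clone(2) clone2_clone(2) by simp
  show "{C :: 'a operation set. precomplete C \<and> nary_ops 1 \<subseteq> C} \<subseteq> {clone1, clone2}"
  proof
    fix C :: "'a operation set" assume "C \<in> {C. precomplete C \<and> nary_ops 1 \<subseteq> C}"
    then have C: "precomplete C" "unary_part C = UNIV" unfolding nary_ops_1_subset_iff by simp_all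
    have "C \<noteq> all_ops" using C(1) unfolding precomplete_def by blast
    then have "C \<subseteq> clone1 \<or> C \<subseteq> clone2"
      using full_above_both [OF precomplete_clone [OF C(1)] C(2)] by blast
    then show "C \<in> {clone1, clone2}"
      using precompleteD [OF C(1)] clone1_clone(1,3) clone2_clone(1,3) by blast
  qed
qed

lemma card_two: "card {C :: 'a operation set. precomplete C \<and> nary_ops 1 \<subseteq> C} = 2"
proof -
  have "clone1 \<noteq> clone2" using clone1_not_sub by blast
  then show ?thesis unfolding two_precomplete_above_unary by simp
qed

end

section \<open>The classification\<close>

lemma (in regular_base) symmetric_precomplete_iff:
  "{C :: 'a operation set. symmetric_clone C \<and> precomplete C \<and> \<not> nary_ops 1 \<subseteq> C}
    = Pol ` listed_monoids"
proof
  show "Pol ` listed_monoids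
      \<subseteq> {C :: 'a operation set. symmetric_clone C \<and> precomplete C \<and> \<not> nary_ops 1 \<subseteq> C}"
    using Pol_A Pol_B Pol_E Pol_F Pol_G by (auto simp: listed_monoids_def)
  show "{C :: 'a operation set. symmetric_clone C \<and> precomplete C \<and> \<not> nary_ops 1 \<subseteq> C}
      \<subseteq> Pol ` listed_monoids"
  proof
    fix C :: "'a operation set"
    assume "C \<in> {C. symmetric_clone C \<and> precomplete C \<and> \<not> nary_ops 1 \<subseteq> C}"
    then have C: "symmetric_clone C" "precomplete C" "unary_part C \<noteq> UNIV"
      unfolding nary_ops_1_subset_iff by simp_all
    have "\<exists>G\<in>listed_monoids. C \<subseteq> Pol G"
    proof (rule ccontr)
      assume no: "\<not> (\<exists>G\<in>listed_monoids. C \<subseteq> Pol G)"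
      interpret permutation_clone base C
      proof
        show "p \<in> unary_part C" if "bij p" for p
          by (rule symmetric_precomplete_perms [OF C(2,1) that])
      qed (use C no in auto)
      show False by (rule contradiction)
    qed
    then obtain G where G: "G \<in> listed_monoids" "C \<subseteq> Pol G" by blast
    have "Pol G \<noteq> all_ops"
    proof -
      have "\<not> nary_ops 1 \<subseteq> Pol G"
        using G(1) Pol_A Pol_B Pol_E Pol_F Pol_G by (auto simp: listed_monoids_def)
      then show ?thesis by (auto simp: all_ops_def)
    qed
    then have "Pol G = C" using precompleteD [OF C(2) is_clone_Pol G(2)] by blast
    then show "C \<in> Pol ` listed_monoids" using G(1) by blast
  qed
qed

text \<open>Ramsey's theorem; infinite subsets of a countable set are large.\<close>

lemma homogeneous_countable:
  fixes c :: "'a set \<Rightarrow> bool"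
  assumes "infinite (UNIV :: 'a set)" "countable (UNIV :: 'a set)"
  shows "\<exists>H. large H \<and> (\<exists>b. c ` nsets H 2 \<subseteq> {b})"
proof -
  let ?f = "\<lambda>X. if c X then 1 else 0 :: nat"
  obtain H t where H: "infinite H" and t: "?f ` nsets H 2 \<subseteq> {t}"
    by (rule Ramsey_nsets [OF assms(1), of ?f 2 2]) (auto split: if_splits)
  have "bij_betw (from_nat_into H) (UNIV :: nat set) H"
    by (rule bij_betw_from_nat_into) (use H countable_subset [OF subset_UNIV assms(2)] in auto)
  moreover have "bij_betw (to_nat_on (UNIV :: 'a set)) UNIV UNIV"
    by (rule to_nat_on_infinite) (use assms in auto)
  ultimately have "bij_betw (from_nat_into H \<circ> to_nat_on (UNIV :: 'a set)) UNIV H"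
    by (rule bij_betw_trans [rotated])
  then have "large H" using bij_betw_large large_UNIV by blast
  moreover have "c ` nsets H 2 \<subseteq> {t = 1}"
  proof
    fix b assume "b \<in> c ` nsets H 2"
    then obtain X where X: "X \<in> nsets H 2" "b = c X" by blast
    then have "?f X = t" using t by blast
    then show "b \<in> {t = 1}" using X(2) by (auto split: if_splits)
  qed
  ultimately show ?thesis by blast
qed

lemma homogeneous_weakly_compact:
  fixes c :: "'a set \<Rightarrow> bool"
  assumes "weakly_compact |UNIV :: 'a set|"
  shows "\<exists>H. large H \<and> (\<exists>b. c ` nsets H 2 \<subseteq> {b})"
  using assms unfolding weakly_compact_def large_def by blast

theorem corollary4:
  assumes "infinite (UNIV :: 'a set)"
  shows "(regularCard |UNIV :: 'a set| \<longrightarrow>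
            {C :: 'a operation set. symmetric_clone C \<and> precomplete C \<and> \<not> nary_ops 1 \<subseteq> C}
              = Pol ` listed_monoids)
       \<and> (countable (UNIV :: 'a set) \<or> weakly_compact |UNIV :: 'a set| \<longrightarrow>
            {C :: 'a operation set. symmetric_clone C \<and> precomplete C}
              = Pol ` listed_monoids \<union> {C. precomplete C \<and> nary_ops 1 \<subseteq> C}
            \<and> card {C :: 'a operation set. precomplete C \<and> nary_ops 1 \<subseteq> C} = 2)"
proof (intro conjI impI)
  assume reg: "regularCard |UNIV :: 'a set|"
  interpret regular_base "TYPE('a)"
    by unfold_locales
      (use assms reg regularCard_stable [OF card_of_Card_order] in \<open>simp_all add: Field_card_of\<close>)
  show "{C :: 'a operation set. symmetric_clone C \<and> precomplete C \<and> \<not> nary_ops 1 \<subseteq> C} = Pol ` listed_monoids"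
    by (rule symmetric_precomplete_iff)
next
  assume "countable (UNIV :: 'a set) \<or> weakly_compact |UNIV :: 'a set|"
  then have hom: "\<exists>H. large H \<and> (\<exists>b. c ` nsets H 2 \<subseteq> {b})" for c :: "'a set \<Rightarrow> bool"
    by (rule disjE) (rule homogeneous_countable [OF assms], assumption, rule homogeneous_weakly_compact)
  interpret ramsey_base "TYPE('a)"
    by unfold_locales (use assms hom in auto)
  \<comment> \<open>Clones above the unary operations contain all permutations, so symmetry is
    automatic.\<close>
  have "symmetric_clone C" if "precomplete C" "nary_ops 1 \<subseteq> C" for C :: "'a operation set"
    using symmetric_if_perms [OF precomplete_clone [OF that(1)]] that(2)
    unfolding nary_ops_1_subset_iff by simp
  then show "{C :: 'a operation set. symmetric_clone C \<and> precomplete C}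
      = Pol ` listed_monoids \<union> {C. precomplete C \<and> nary_ops 1 \<subseteq> C}"
    unfolding symmetric_precomplete_iff [symmetric] by blast
  show "card {C :: 'a operation set. precomplete C \<and> nary_ops 1 \<subseteq> C} = 2" by (rule card_two)
qed

end
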